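(* There are equivalences of categories $$\mathbf{ResRel}_{\otimes}\simeq\mathbf{Quant}\simeq\mathbf{SGrp}(\mathbf{Bond},\boxtimes)\simeq\mathbf{SGrp}(\mathbf{B}(\mathbf{Rel}),\boxtimes).$$
   Context: $\mathbf{Quant}$ is the category of quantales (complete lattices with an associative multiplication preserving arbitrary suprema in each variable; no unit assumed) and maps preserving arbitrary suprema and multiplication. $\mathbf{Sup}$ is the category of complete lattices and maps preserving arbitrary suprema; $(\mathbf{Sup},\boxtimes)$ is $\mathbf{Sup}$ with the standard tensor product of complete sup-lattices (classifying maps that preserve arbitrary suprema in each variable). For a relation $R\subseteq X\times Y$ (write $xRy$ for $(x,y)\in R$), $A\subseteq X$ and $B\subseteq Y$, put $R^{\uparrow}(A)=\{y\in Y\mid \forall a\in A,\ aRy\}$ and $R^{\downarrow}(B)=\{x\in X\mid \forall b\in B,\ xRb\}$. An $R$-extent is a subset $A\subseteq X$ with $A=R^{\downarrow}R^{\uparrow}(A)$; an $R$-intent is a subset $B\subseteq Y$ with $B=R^{\uparrow}R^{\downarrow}(B)$. $\mathsf{M}R$ is the complete lattice of $R$-extents ordered by inclusion. A bond from $R\subseteq X\times Y$ to $S\subseteq Z\times W$ is a relation $\mathbf{b}\subseteq X\times W$ such that every row $\mathbf{b}[x]=\{w\in W\mid x\mathbf{b}w\}$ is an $S$-intent and every column $\mathbf{b}^{-1}[w]=\{x\in X\mid x\mathbf{b}w\}$ is an $R$-extent. It induces the sup-preserving map $\mathbf{b}_*\colon\mathsf{M}R\to\mathsf{M}S$, $\mathbf{b}_*(A)=S^{\downarrow}\mathbf{b}^{\uparrow}(A)$,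 where $\mathbf{b}^{\uparrow}(A)=\{w\in W\mid\forall a\in A,\ a\mathbf{b}w\}$. $\mathbf{Bond}$ is the category whose objects are relations between sets (formal contexts) and whose morphisms are bonds; the identity on $R$ is $R$ itself, and the composite of $\mathbf{b}\colon R\to S$ and $\mathbf{c}\colon S\to T$ (with $T\subseteq U\times V$) is given by $x(\mathbf{c}\circ\mathbf{b})v\iff S^{\downarrow}(\mathbf{b}[x])\subseteq\mathbf{c}^{-1}[v]$. The assignment $R\mapsto\mathsf{M}R$, $\mathbf{b}\mapsto\mathbf{b}_*$ is an equivalence of categories $\mathbf{Bond}\simeq\mathbf{Sup}$. $\boxtimes$ on $\mathbf{Bond}$ is Mori's lattice tensor, a monoidal structure on $\mathbf{Bond}$ for which there is a strong monoidal equivalence $(\mathbf{Bond},\boxtimes)\simeq(\mathbf{Sup},\boxtimes)$ (a known result that is assumed). $\mathbf{B}(\mathbf{Rel})$ is the quantaloid of back diagonals of the quantaloid $\mathbf{Rel}$ of sets and relations. It is canonically isomorphic, as a category, to $\mathbf{Bond}$ (a known result): in elementwise form, its objects are relations and a back diagonal from $R\subseteq X\times Y$ to $S\subseteq Z\times W$ is exactly a relation $\mathbf{b}\subseteq X\times W$ whose rows are $S$-intents and whose columns are $R$-extents. The tensor $\boxtimes$ on $\mathbf{B}(\mathbf{Rel})$ is the one transported from $\mathbf{Bond}$ along this isomorphism, so that the isomorphism is strong monoidal. For a monoidal category $(\mathcal{C},\boxtimes)$, $\mathbf{SGrp}(\mathcal{C},\boxtimes)$ is the category of semigroup objects: objects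 $A$ with an associative multiplication $A\boxtimes A\to A$ (no unit), with morphisms of $\mathcal{C}$ commuting with the multiplications. For a semigroup $X$ and a set $Y$, a relation $R\subseteq X\times Y$ is residuated if there exist maps $\swarrow\colon Y\times X\to Y$ and $\searrow\colon X\times Y\to Y$ such that $(xx')Ry\iff xR(y\swarrow x')\iff x'R(x\searrow y)$ for all $x,x'\in X$, $y\in Y$. For $S$-intents $P,Q$ of a residuated relation $S$, put $P\otimes_S Q=S^{\uparrow}(S^{\downarrow}(P)*S^{\downarrow}(Q))$, where $A*B=\{ab\mid a\in A,\ b\in B\}$. A bond $\mathbf{b}\colon R\to S$ between residuated relations is multiplicative if $\mathbf{b}[xx']=\mathbf{b}[x]\otimes_S\mathbf{b}[x']$ for all $x,x'$ in the domain semigroup of $R$. $\mathbf{ResRel}_{\otimes}$ is the category whose objects are residuated relations (a semigroup $X$, a set $Y$ and a residuated relation $R\subseteq X\times Y$) and whose morphisms are multiplicative bonds, with identities and composition as for bonds. *)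

theory Defs
  imports "HOL-Algebra.Complete_Lattice" "HOL-Library.Equipollence"
begin

section \<open>Categories, functors and equivalences\<close>

record ('o, 'm) cat =
  Obj :: "'o set"
  Arr :: "'m set"
  Dom :: "'m \<Rightarrow> 'o"
  Cod :: "'m \<Rightarrow> 'o"
  Idn :: "'o \<Rightarrow> 'm"
  Cmp :: "'m \<Rightarrow> 'm \<Rightarrow> 'm"  (infixr \<open>\<cdot>\<index>\<close> 70)

text \<open>Composition is written in applicative order: \<open>g \<cdot> f\<close> is \<open>f\<close> followed by \<open>g\<close>.\<close>

definition Hom :: "('o, 'm, 'z) cat_scheme \<Rightarrow> 'o \<Rightarrow> 'o \<Rightarrow> 'm set" where
  "Hom C A B = {f \<in> Arr C. Dom C f = A \<and> Cod C f = B}"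

locale category =
  fixes C :: "('o, 'm, 'z) cat_scheme" (structure)
  assumes Dom_in: "f \<in> Arr C \<Longrightarrow> Dom C f \<in> Obj C"
    and Cod_in: "f \<in> Arr C \<Longrightarrow> Cod C f \<in> Obj C"
    and Idn_in: "A \<in> Obj C \<Longrightarrow> Idn C A \<in> Hom C A A"
    and Cmp_in: "\<lbrakk>f \<in> Hom C A B; g \<in> Hom C B D\<rbrakk> \<Longrightarrow> g \<cdot> f \<in> Hom C A D"
    and Idn_left: "f \<in> Hom C A B \<Longrightarrow> Idn C B \<cdot> f = f"
    and Idn_right: "f \<in> Hom C A B \<Longrightarrow> f \<cdot> Idn C A = f"
    and Cmp_assoc: "\<lbrakk>f \<in> Hom C A B; g \<in> Hom C B D; h \<in> Hom C D E\<rbrakk>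
                      \<Longrightarrow> (h \<cdot> g) \<cdot> f = h \<cdot> (g \<cdot> f)"

definition is_iso :: "('o, 'm, 'z) cat_scheme \<Rightarrow> 'm \<Rightarrow> bool" where
  "is_iso C f \<longleftrightarrow> f \<in> Arr C \<and>
     (\<exists>g \<in> Hom C (Cod C f) (Dom C f).
        g \<cdot>\<^bsub>C\<^esub> f = Idn C (Dom C f) \<and> f \<cdot>\<^bsub>C\<^esub> g = Idn C (Cod C f))"

record ('o, 'm, 'p, 'n) fctr =
  on_obj :: "'o \<Rightarrow> 'p"
  on_arr :: "'m \<Rightarrow> 'n"

definition id_fctr :: "('o, 'm, 'o, 'm) fctr" where
  "id_fctr = \<lparr>on_obj = \<lambda>A. A, on_arr = \<lambda>f. f\<rparr>"

definition comp_fctr ::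
  "('p, 'n, 'q, 'k) fctr \<Rightarrow> ('o, 'm, 'p, 'n) fctr \<Rightarrow> ('o, 'm, 'q, 'k) fctr" where
  "comp_fctr G F = \<lparr>on_obj = \<lambda>A. on_obj G (on_obj F A), on_arr = \<lambda>f. on_arr G (on_arr F f)\<rparr>"

locale cat_functor = C: category C + D: category D
  for C :: "('o, 'm, 'y) cat_scheme" and D :: "('p, 'n, 'z) cat_scheme" +
  fixes F :: "('o, 'm, 'p, 'n) fctr"
  assumes on_obj_in: "A \<in> Obj C \<Longrightarrow> on_obj F A \<in> Obj D"
    and on_arr_in: "f \<in> Hom C A B \<Longrightarrow> on_arr F f \<in> Hom D (on_obj F A) (on_obj F B)"
    and on_arr_Idn: "A \<in> Obj C \<Longrightarrow> on_arr F (Idn C A) = Idn D (on_obj F A)"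
    and on_arr_Cmp: "\<lbrakk>f \<in> Hom C A B; g \<in> Hom C B E\<rbrakk>
                       \<Longrightarrow> on_arr F (g \<cdot>\<^bsub>C\<^esub> f) = on_arr F g \<cdot>\<^bsub>D\<^esub> on_arr F f"

definition nat_iso ::
  "('o, 'm, 'y) cat_scheme \<Rightarrow> ('p, 'n, 'z) cat_scheme \<Rightarrow>
   ('o, 'm, 'p, 'n) fctr \<Rightarrow> ('o, 'm, 'p, 'n) fctr \<Rightarrow> ('o \<Rightarrow> 'n) \<Rightarrow> bool" where
  "nat_iso C D F G \<eta> \<longleftrightarrow>
     (\<forall>A \<in> Obj C. \<eta> A \<in> Hom D (on_obj F A) (on_obj G A) \<and> is_iso D (\<eta> A)) \<and>
     (\<forall>f \<in> Arr C. \<eta> (Cod C f) \<cdot>\<^bsub>D\<^esub> on_arr F f = on_arr G f \<cdot>\<^bsub>D\<^esub> \<eta> (Dom C f))"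

definition equivalence_functor ::
  "('o, 'm, 'y) cat_scheme \<Rightarrow> ('p, 'n, 'z) cat_scheme \<Rightarrow> ('o, 'm, 'p, 'n) fctr \<Rightarrow> bool" where
  "equivalence_functor C D F \<longleftrightarrow> cat_functor C D F \<and>
     (\<exists>G \<eta> \<epsilon>. cat_functor D C G \<and>
        nat_iso C C id_fctr (comp_fctr G F) \<eta> \<and> nat_iso D D (comp_fctr F G) id_fctr \<epsilon>)"

definition equivalent_categories ::
  "('o, 'm, 'y) cat_scheme \<Rightarrow> ('p, 'n, 'z) cat_scheme \<Rightarrow> bool"  (infix \<open>\<simeq>\<close> 50) where
  "C \<simeq> D \<longleftrightarrow> (\<exists>F. equivalence_functor C D F)"


section \<open>Monoidal categories and semigroup objects\<close>

record ('o, 'm) tensor =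
  tobj :: "'o \<Rightarrow> 'o \<Rightarrow> 'o"  (infixl \<open>\<boxtimes>\<index>\<close> 75)
  tarr :: "'m \<Rightarrow> 'm \<Rightarrow> 'm"  (infixl \<open>\<otimes>\<index>\<close> 75)
  tunit :: "'o"
  assoc :: "'o \<Rightarrow> 'o \<Rightarrow> 'o \<Rightarrow> 'm"
  lunit :: "'o \<Rightarrow> 'm"
  runit :: "'o \<Rightarrow> 'm"

text \<open>
  \<open>assoc T A B D : (A \<boxtimes> B) \<boxtimes> D \<rightarrow> A \<boxtimes> (B \<boxtimes> D)\<close>, \<open>lunit T A : I \<boxtimes> A \<rightarrow> A\<close>,
  \<open>runit T A : A \<boxtimes> I \<rightarrow> A\<close>.
\<close>

locale monoidal_category = category C
  for C :: "('o, 'm, 'z) cat_scheme" (structure) +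
  fixes T :: "('o, 'm) tensor"
  assumes tobj_in: "\<lbrakk>A \<in> Obj C; B \<in> Obj C\<rbrakk> \<Longrightarrow> A \<boxtimes>\<^bsub>T\<^esub> B \<in> Obj C"
    and tarr_in: "\<lbrakk>f \<in> Hom C A A'; g \<in> Hom C B B'\<rbrakk>
          \<Longrightarrow> f \<otimes>\<^bsub>T\<^esub> g \<in> Hom C (A \<boxtimes>\<^bsub>T\<^esub> B) (A' \<boxtimes>\<^bsub>T\<^esub> B')"
    and tarr_Idn: "\<lbrakk>A \<in> Obj C; B \<in> Obj C\<rbrakk>
          \<Longrightarrow> Idn C A \<otimes>\<^bsub>T\<^esub> Idn C B = Idn C (A \<boxtimes>\<^bsub>T\<^esub> B)"
    and tarr_Cmp: "\<lbrakk>f \<in> Hom C A A'; f' \<in> Hom C A' A''; g \<in> Hom C B B'; g' \<in> Hom C B' B''\<rbrakk>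
          \<Longrightarrow> (f' \<cdot> f) \<otimes>\<^bsub>T\<^esub> (g' \<cdot> g) = (f' \<otimes>\<^bsub>T\<^esub> g') \<cdot> (f \<otimes>\<^bsub>T\<^esub> g)"
    and tunit_in: "tunit T \<in> Obj C"
    and assoc_in: "\<lbrakk>A \<in> Obj C; B \<in> Obj C; D \<in> Obj C\<rbrakk>
          \<Longrightarrow> assoc T A B D \<in> Hom C ((A \<boxtimes>\<^bsub>T\<^esub> B) \<boxtimes>\<^bsub>T\<^esub> D) (A \<boxtimes>\<^bsub>T\<^esub> (B \<boxtimes>\<^bsub>T\<^esub> D))"
    and assoc_iso: "\<lbrakk>A \<in> Obj C; B \<in> Obj C; D \<in> Obj C\<rbrakk> \<Longrightarrow> is_iso C (assoc T A B D)"
    and assoc_natural: "\<lbrakk>f \<in> Hom C A A'; g \<in> Hom C B B'; h \<in> Hom C D D'\<rbrakk>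
          \<Longrightarrow> assoc T A' B' D' \<cdot> ((f \<otimes>\<^bsub>T\<^esub> g) \<otimes>\<^bsub>T\<^esub> h) = (f \<otimes>\<^bsub>T\<^esub> (g \<otimes>\<^bsub>T\<^esub> h)) \<cdot> assoc T A B D"
    and lunit_in: "A \<in> Obj C \<Longrightarrow> lunit T A \<in> Hom C (tunit T \<boxtimes>\<^bsub>T\<^esub> A) A"
    and lunit_iso: "A \<in> Obj C \<Longrightarrow> is_iso C (lunit T A)"
    and lunit_natural: "f \<in> Hom C A A'
          \<Longrightarrow> lunit T A' \<cdot> (Idn C (tunit T) \<otimes>\<^bsub>T\<^esub> f) = f \<cdot> lunit T A"
    and runit_in: "A \<in> Obj C \<Longrightarrow> runit T A \<in> Hom C (A \<boxtimes>\<^bsub>T\<^esub> tunit T) A"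
    and runit_iso: "A \<in> Obj C \<Longrightarrow> is_iso C (runit T A)"
    and runit_natural: "f \<in> Hom C A A'
          \<Longrightarrow> runit T A' \<cdot> (f \<otimes>\<^bsub>T\<^esub> Idn C (tunit T)) = f \<cdot> runit T A"
    and pentagon: "\<lbrakk>A \<in> Obj C; B \<in> Obj C; D \<in> Obj C; E \<in> Obj C\<rbrakk>
          \<Longrightarrow> assoc T A B (D \<boxtimes>\<^bsub>T\<^esub> E) \<cdot> assoc T (A \<boxtimes>\<^bsub>T\<^esub> B) D E
            = (Idn C A \<otimes>\<^bsub>T\<^esub> assoc T B D E) \<cdot> assoc T A (B \<boxtimes>\<^bsub>T\<^esub> D) E \<cdot> (assoc T A B D \<otimes>\<^bsub>T\<^esub> Idn C E)"
    and triangle: "\<lbrakk>A \<in> Obj C; B \<in> Obj C\<rbrakk>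
          \<Longrightarrow> (Idn C A \<otimes>\<^bsub>T\<^esub> lunit T B) \<cdot> assoc T A (tunit T) B = runit T A \<otimes>\<^bsub>T\<^esub> Idn C B"

definition strong_monoidal_functor ::
  "('o, 'm, 'y) cat_scheme \<Rightarrow> ('o, 'm) tensor \<Rightarrow> ('p, 'n, 'z) cat_scheme \<Rightarrow> ('p, 'n) tensor \<Rightarrow>
   ('o, 'm, 'p, 'n) fctr \<Rightarrow> ('o \<Rightarrow> 'o \<Rightarrow> 'n) \<Rightarrow> 'n \<Rightarrow> bool" where
  "strong_monoidal_functor C S D T F \<phi> \<phi>0 \<longleftrightarrow> cat_functor C D F \<and>
     (\<forall>A \<in> Obj C. \<forall>B \<in> Obj C.
        \<phi> A B \<in> Hom D (on_obj F A \<boxtimes>\<^bsub>T\<^esub> on_obj F B) (on_obj F (A \<boxtimes>\<^bsub>S\<^esub> B)) \<and> is_iso D (\<phi> A B)) \<and>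
     \<phi>0 \<in> Hom D (tunit T) (on_obj F (tunit S)) \<and> is_iso D \<phi>0 \<and>
     (\<forall>f \<in> Arr C. \<forall>g \<in> Arr C.
        \<phi> (Cod C f) (Cod C g) \<cdot>\<^bsub>D\<^esub> (on_arr F f \<otimes>\<^bsub>T\<^esub> on_arr F g)
          = on_arr F (f \<otimes>\<^bsub>S\<^esub> g) \<cdot>\<^bsub>D\<^esub> \<phi> (Dom C f) (Dom C g)) \<and>
     (\<forall>A \<in> Obj C. \<forall>B \<in> Obj C. \<forall>E \<in> Obj C.
        on_arr F (assoc S A B E) \<cdot>\<^bsub>D\<^esub> \<phi> (A \<boxtimes>\<^bsub>S\<^esub> B) E \<cdot>\<^bsub>D\<^esub> (\<phi> A B \<otimes>\<^bsub>T\<^esub> Idn D (on_obj F E))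
          = \<phi> A (B \<boxtimes>\<^bsub>S\<^esub> E) \<cdot>\<^bsub>D\<^esub> (Idn D (on_obj F A) \<otimes>\<^bsub>T\<^esub> \<phi> B E)
              \<cdot>\<^bsub>D\<^esub> assoc T (on_obj F A) (on_obj F B) (on_obj F E)) \<and>
     (\<forall>A \<in> Obj C.
        on_arr F (lunit S A) \<cdot>\<^bsub>D\<^esub> \<phi> (tunit S) A \<cdot>\<^bsub>D\<^esub> (\<phi>0 \<otimes>\<^bsub>T\<^esub> Idn D (on_obj F A))
          = lunit T (on_obj F A) \<and>
        on_arr F (runit S A) \<cdot>\<^bsub>D\<^esub> \<phi> A (tunit S) \<cdot>\<^bsub>D\<^esub> (Idn D (on_obj F A) \<otimes>\<^bsub>T\<^esub> \<phi>0)
          = runit T (on_obj F A))"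

text \<open>
  A strong monoidal functor whose underlying functor is an equivalence; its quasi-inverse then
  carries a strong monoidal structure automatically.
\<close>

definition strong_monoidal_equivalence ::
  "('o, 'm, 'y) cat_scheme \<Rightarrow> ('o, 'm) tensor \<Rightarrow> ('p, 'n, 'z) cat_scheme \<Rightarrow> ('p, 'n) tensor \<Rightarrow>
   ('o, 'm, 'p, 'n) fctr \<Rightarrow> ('o \<Rightarrow> 'o \<Rightarrow> 'n) \<Rightarrow> 'n \<Rightarrow> bool" where
  "strong_monoidal_equivalence C S D T F \<phi> \<phi>0 \<longleftrightarrow>
     strong_monoidal_functor C S D T F \<phi> \<phi>0 \<and> equivalence_functor C D F"

text \<open>
  Transport of a monoidal structure along an isomorphism of categories \<open>F\<close> with inverse \<open>G\<close>:
  the unique structure on the codomain making \<open>F\<close> strictly monoidal.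
\<close>

definition transport_tensor ::
  "('o, 'm, 'p, 'n) fctr \<Rightarrow> ('p, 'n, 'o, 'm) fctr \<Rightarrow> ('o, 'm) tensor \<Rightarrow> ('p, 'n) tensor" where
  "transport_tensor F G T =
     \<lparr>tobj = \<lambda>A B. on_obj F (on_obj G A \<boxtimes>\<^bsub>T\<^esub> on_obj G B),
      tarr = \<lambda>f g. on_arr F (on_arr G f \<otimes>\<^bsub>T\<^esub> on_arr G g),
      tunit = on_obj F (tunit T),
      assoc = \<lambda>A B D. on_arr F (assoc T (on_obj G A) (on_obj G B) (on_obj G D)),
      lunit = \<lambda>A. on_arr F (lunit T (on_obj G A)),
      runit = \<lambda>A. on_arr F (runit T (on_obj G A))\<rparr>"

text \<open>Arrows of the concrete categories below: a datum together with its domain and codomain.\<close>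

record ('o, 'd) arrow =
  adom :: "'o"
  acod :: "'o"
  adat :: "'d"

definition semigroup_object :: "('o, 'm, 'z) cat_scheme \<Rightarrow> ('o, 'm) tensor \<Rightarrow> 'o \<times> 'm \<Rightarrow> bool" where
  "semigroup_object C T X \<longleftrightarrow>
     (let A = fst X; m = snd X in
        A \<in> Obj C \<and> m \<in> Hom C (A \<boxtimes>\<^bsub>T\<^esub> A) A \<and>
        m \<cdot>\<^bsub>C\<^esub> (m \<otimes>\<^bsub>T\<^esub> Idn C A) = m \<cdot>\<^bsub>C\<^esub> (Idn C A \<otimes>\<^bsub>T\<^esub> m) \<cdot>\<^bsub>C\<^esub> assoc T A A A)"

definition SGrp ::
  "('o, 'm, 'z) cat_scheme \<Rightarrow> ('o, 'm) tensor \<Rightarrow> ('o \<times> 'm, ('o \<times> 'm, 'm) arrow) cat" where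
  "SGrp C T =
    \<lparr>Obj = {X. semigroup_object C T X},
     Arr = {\<lparr>adom = X, acod = Y, adat = f\<rparr> | X Y f.
              semigroup_object C T X \<and> semigroup_object C T Y \<and>
              f \<in> Hom C (fst X) (fst Y) \<and> f \<cdot>\<^bsub>C\<^esub> snd X = snd Y \<cdot>\<^bsub>C\<^esub> (f \<otimes>\<^bsub>T\<^esub> f)},
     Dom = adom, Cod = acod,
     Idn = \<lambda>X. \<lparr>adom = X, acod = X, adat = Idn C (fst X)\<rparr>,
     Cmp = \<lambda>g f. \<lparr>adom = adom f, acod = acod g, adat = adat g \<cdot>\<^bsub>C\<^esub> adat f\<rparr>\<rparr>"


section \<open>Size\<close>

text \<open>
  All structures live on small subsets of a fixed type \<open>'u\<close>, which plays the role of a universe: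
  a set is small when its cardinality is below that of \<open>'u\<close>. To be a universe, \<open>'u\<close> is required
  to be a strong limit, i.e. the small sets are closed under power sets; closure of the small
  sets under unions of small families (inaccessibility) is not needed.
\<close>

definition small :: "'u set \<Rightarrow> bool" where
  "small A \<longleftrightarrow> A \<prec> (UNIV :: 'u set)"


section \<open>Complete lattices and quantales\<close>

text \<open>
  The second conjunct of \<open>small_complete_lattice\<close> only normalises the record: the order is a
  relation on the carrier, without junk outside of it.
\<close>

definition small_complete_lattice :: "('u, 'z) gorder_scheme \<Rightarrow> bool" where
  "small_complete_lattice L \<longleftrightarrow> complete_lattice L \<and>
     (\<forall>x y. x \<sqsubseteq>\<^bsub>L\<^esub> y \<longrightarrow> x \<in> carrier L \<and> y \<in> carrier L) \<and> small (carrier L)"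

definition sup_map :: "('u, 'y) gorder_scheme \<Rightarrow> ('u, 'z) gorder_scheme \<Rightarrow> ('u \<Rightarrow> 'u) \<Rightarrow> bool" where
  "sup_map L M f \<longleftrightarrow> f \<in> carrier L \<rightarrow>\<^sub>E carrier M \<and> sup_pres L M f"

definition SupCat :: "('u gorder, ('u gorder, 'u \<Rightarrow> 'u) arrow) cat" where
  "SupCat =
    \<lparr>Obj = {L. small_complete_lattice L},
     Arr = {\<lparr>adom = L, acod = M, adat = f\<rparr> | L M f.
              small_complete_lattice L \<and> small_complete_lattice M \<and> sup_map L M f},
     Dom = adom, Cod = acod,
     Idn = \<lambda>L. \<lparr>adom = L, acod = L, adat = \<lambda>x \<in> carrier L. x\<rparr>,
     Cmp = \<lambda>g f. \<lparr>adom = adom f, acod = acod g,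
                   adat = compose (carrier (adom f)) (adat g) (adat f)\<rparr>\<rparr>"

record 'u quantale = "'u gorder" +
  qmul :: "'u \<Rightarrow> 'u \<Rightarrow> 'u"

definition is_quantale :: "'u quantale \<Rightarrow> bool" where
  "is_quantale Q \<longleftrightarrow> small_complete_lattice Q \<and>
     qmul Q \<in> carrier Q \<rightarrow>\<^sub>E carrier Q \<rightarrow>\<^sub>E carrier Q \<and>
     (\<forall>a \<in> carrier Q. \<forall>b \<in> carrier Q. \<forall>c \<in> carrier Q.
        qmul Q (qmul Q a b) c = qmul Q a (qmul Q b c)) \<and>
     (\<forall>A b. A \<subseteq> carrier Q \<longrightarrow> b \<in> carrier Q \<longrightarrow>
        qmul Q (\<Squnion>\<^bsub>Q\<^esub> A) b = \<Squnion>\<^bsub>Q\<^esub> ((\<lambda>a. qmul Q a b) ` A) \<and>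
        qmul Q b (\<Squnion>\<^bsub>Q\<^esub> A) = \<Squnion>\<^bsub>Q\<^esub> ((\<lambda>a. qmul Q b a) ` A))"

definition quantale_map :: "'u quantale \<Rightarrow> 'u quantale \<Rightarrow> ('u \<Rightarrow> 'u) \<Rightarrow> bool" where
  "quantale_map Q P f \<longleftrightarrow> sup_map Q P f \<and>
     (\<forall>a \<in> carrier Q. \<forall>b \<in> carrier Q. f (qmul Q a b) = qmul P (f a) (f b))"

definition Quant :: "('u quantale, ('u quantale, 'u \<Rightarrow> 'u) arrow) cat" where
  "Quant =
    \<lparr>Obj = {Q. is_quantale Q},
     Arr = {\<lparr>adom = Q, acod = P, adat = f\<rparr> | Q P f.
              is_quantale Q \<and> is_quantale P \<and> quantale_map Q P f},
     Dom = adom, Cod = acod,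
     Idn = \<lambda>Q. \<lparr>adom = Q, acod = Q, adat = \<lambda>x \<in> carrier Q. x\<rparr>,
     Cmp = \<lambda>g f. \<lparr>adom = adom f, acod = acod g,
                   adat = compose (carrier (adom f)) (adat g) (adat f)\<rparr>\<rparr>"


section \<open>The tensor product of complete sup-lattices\<close>

definition bimorphism ::
  "'u gorder \<Rightarrow> 'u gorder \<Rightarrow> 'u gorder \<Rightarrow> ('u \<Rightarrow> 'u \<Rightarrow> 'u) \<Rightarrow> bool" where
  "bimorphism L M N t \<longleftrightarrow> t \<in> carrier L \<rightarrow>\<^sub>E carrier M \<rightarrow>\<^sub>E carrier N \<and>
     (\<forall>b \<in> carrier M. sup_pres L N (\<lambda>a. t a b)) \<and>
     (\<forall>a \<in> carrier L. sup_pres M N (\<lambda>b. t a b))"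

definition universal_bimorphism ::
  "'u gorder \<Rightarrow> 'u gorder \<Rightarrow> 'u gorder \<Rightarrow> ('u \<Rightarrow> 'u \<Rightarrow> 'u) \<Rightarrow> bool" where
  "universal_bimorphism L M P t \<longleftrightarrow> small_complete_lattice P \<and> bimorphism L M P t \<and>
     (\<forall>N s. small_complete_lattice N \<longrightarrow> bimorphism L M N s \<longrightarrow>
        (\<exists>!f. sup_map P N f \<and> (\<forall>a \<in> carrier L. \<forall>b \<in> carrier M. f (t a b) = s a b)))"

text \<open>A choice of universal bimorphism \<open>(a, b) \<mapsto> pure L M a b\<close> for each pair of lattices.\<close>

definition chosen_bimorphism :: "'u gorder \<Rightarrow> 'u gorder \<Rightarrow> 'u gorder \<times> ('u \<Rightarrow> 'u \<Rightarrow> 'u)" where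
  "chosen_bimorphism L M = (SOME p. universal_bimorphism L M (fst p) (snd p))"

definition lattice_tensor :: "'u gorder \<Rightarrow> 'u gorder \<Rightarrow> 'u gorder" where
  "lattice_tensor L M = fst (chosen_bimorphism L M)"

definition pure :: "'u gorder \<Rightarrow> 'u gorder \<Rightarrow> 'u \<Rightarrow> 'u \<Rightarrow> 'u" where
  "pure L M = snd (chosen_bimorphism L M)"

text \<open>The unit is the two-element lattice, which is free on its top element.\<close>

definition two_lattice :: "'u gorder" where
  "two_lattice = (SOME L. small_complete_lattice L \<and> card (carrier L) = 2)"

definition sup_tensor :: "('u gorder, ('u gorder, 'u \<Rightarrow> 'u) arrow) tensor" where
  "sup_tensor =
    \<lparr>tobj = lattice_tensor,
     tarr = \<lambda>f g. THE h.
       h \<in> Hom SupCat (lattice_tensor (adom f) (adom g)) (lattice_tensor (acod f) (acod g)) \<and>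
       (\<forall>a \<in> carrier (adom f). \<forall>b \<in> carrier (adom g).
          adat h (pure (adom f) (adom g) a b) = pure (acod f) (acod g) (adat f a) (adat g b)),
     tunit = two_lattice,
     assoc = \<lambda>L M N. THE h.
       h \<in> Hom SupCat (lattice_tensor (lattice_tensor L M) N) (lattice_tensor L (lattice_tensor M N)) \<and>
       (\<forall>a \<in> carrier L. \<forall>b \<in> carrier M. \<forall>c \<in> carrier N.
          adat h (pure (lattice_tensor L M) N (pure L M a b) c)
            = pure L (lattice_tensor M N) a (pure M N b c)),
     lunit = \<lambda>L. THE h.
       h \<in> Hom SupCat (lattice_tensor two_lattice L) L \<and>
       (\<forall>a \<in> carrier L. adat h (pure two_lattice L \<top>\<^bsub>two_lattice\<^esub> a) = a),
     runit = \<lambda>L. THE h.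
       h \<in> Hom SupCat (lattice_tensor L two_lattice) L \<and>
       (\<forall>a \<in> carrier L. adat h (pure L two_lattice a \<top>\<^bsub>two_lattice\<^esub>) = a)\<rparr>"


section \<open>Formal contexts and bonds\<close>

record 'u fcontext =
  objs :: "'u set"
  attrs :: "'u set"
  inc :: "('u \<times> 'u) set"

definition is_fcontext :: "('u, 'z) fcontext_scheme \<Rightarrow> bool" where
  "is_fcontext R \<longleftrightarrow> small (objs R) \<and> small (attrs R) \<and> inc R \<subseteq> objs R \<times> attrs R"

definition up :: "('u, 'z) fcontext_scheme \<Rightarrow> 'u set \<Rightarrow> 'u set" where
  "up R A = {y \<in> attrs R. \<forall>a \<in> A. (a, y) \<in> inc R}"

definition down :: "('u, 'z) fcontext_scheme \<Rightarrow> 'u set \<Rightarrow> 'u set" where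
  "down R B = {x \<in> objs R. \<forall>b \<in> B. (x, b) \<in> inc R}"

definition extent :: "('u, 'z) fcontext_scheme \<Rightarrow> 'u set \<Rightarrow> bool" where
  "extent R A \<longleftrightarrow> A \<subseteq> objs R \<and> A = down R (up R A)"

definition intent :: "('u, 'z) fcontext_scheme \<Rightarrow> 'u set \<Rightarrow> bool" where
  "intent R B \<longleftrightarrow> B \<subseteq> attrs R \<and> B = up R (down R B)"

definition bond ::
  "('u, 'y) fcontext_scheme \<Rightarrow> ('u, 'z) fcontext_scheme \<Rightarrow> ('u \<times> 'u) set \<Rightarrow> bool" where
  "bond R S b \<longleftrightarrow> b \<subseteq> objs R \<times> attrs S \<and>
     (\<forall>x \<in> objs R. intent S (b `` {x})) \<and> (\<forall>w \<in> attrs S. extent R (b\<inverse> `` {w}))"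

text \<open>\<open>bond_comp R S T c b\<close> is the composite of \<open>b : R \<rightarrow> S\<close> followed by \<open>c : S \<rightarrow> T\<close>.\<close>

definition bond_comp ::
  "('u, 'x) fcontext_scheme \<Rightarrow> ('u, 'y) fcontext_scheme \<Rightarrow> ('u, 'z) fcontext_scheme \<Rightarrow>
   ('u \<times> 'u) set \<Rightarrow> ('u \<times> 'u) set \<Rightarrow> ('u \<times> 'u) set" where
  "bond_comp R S T c b =
     {(x, v). x \<in> objs R \<and> v \<in> attrs T \<and> down S (b `` {x}) \<subseteq> c\<inverse> `` {v}}"

definition Bond :: "('u fcontext, ('u fcontext, ('u \<times> 'u) set) arrow) cat" where
  "Bond =
    \<lparr>Obj = {R. is_fcontext R},
     Arr = {\<lparr>adom = R, acod = S, adat = b\<rparr> | R S b. is_fcontext R \<and> is_fcontext S \<and> bond R S b},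
     Dom = adom, Cod = acod,
     Idn = \<lambda>R. \<lparr>adom = R, acod = R, adat = inc R\<rparr>,
     Cmp = \<lambda>g f. \<lparr>adom = adom f, acod = acod g,
                   adat = bond_comp (adom f) (acod f) (acod g) (adat g) (adat f)\<rparr>\<rparr>"

text \<open>
  Mori's lattice tensor has no constant of its own: it enters only through the known property assumed of it,
  as a monoidal structure on \<open>Bond\<close> together with a strong monoidal equivalence from \<open>Bond\<close> to
  \<open>SupCat\<close> with \<open>sup_tensor\<close>.
\<close>


section \<open>Residuated relations and multiplicative bonds\<close>

record 'u sgcontext = "'u fcontext" +
  smul :: "'u \<Rightarrow> 'u \<Rightarrow> 'u"

text \<open>
  In \<open>residuated\<close>, \<open>sl y x\<close> stands for \<open>y \<swarrow> x\<close> and \<open>sr x y\<close> for \<open>x \<searrow> y\<close>.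
\<close>

definition residuated :: "'u sgcontext \<Rightarrow> bool" where
  "residuated R \<longleftrightarrow>
     (\<exists>sl \<in> attrs R \<rightarrow> objs R \<rightarrow> attrs R. \<exists>sr \<in> objs R \<rightarrow> attrs R \<rightarrow> attrs R.
        \<forall>x \<in> objs R. \<forall>x' \<in> objs R. \<forall>y \<in> attrs R.
          ((smul R x x', y) \<in> inc R \<longleftrightarrow> (x, sl y x') \<in> inc R) \<and>
          ((smul R x x', y) \<in> inc R \<longleftrightarrow> (x', sr x y) \<in> inc R))"

definition residuated_relation :: "'u sgcontext \<Rightarrow> bool" where
  "residuated_relation R \<longleftrightarrow> is_fcontext R \<and>
     smul R \<in> objs R \<rightarrow>\<^sub>E objs R \<rightarrow>\<^sub>E objs R \<and>
     (\<forall>x \<in> objs R. \<forall>y \<in> objs R. \<forall>z \<in> objs R.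
        smul R (smul R x y) z = smul R x (smul R y z)) \<and>
     residuated R"

definition set_mul :: "'u sgcontext \<Rightarrow> 'u set \<Rightarrow> 'u set \<Rightarrow> 'u set" where
  "set_mul R A B = {smul R a b | a b. a \<in> A \<and> b \<in> B}"

definition intent_mul :: "'u sgcontext \<Rightarrow> 'u set \<Rightarrow> 'u set \<Rightarrow> 'u set" where
  "intent_mul S P Q = up S (set_mul S (down S P) (down S Q))"

definition multiplicative :: "'u sgcontext \<Rightarrow> 'u sgcontext \<Rightarrow> ('u \<times> 'u) set \<Rightarrow> bool" where
  "multiplicative R S b \<longleftrightarrow>
     (\<forall>x \<in> objs R. \<forall>x' \<in> objs R. b `` {smul R x x'} = intent_mul S (b `` {x}) (b `` {x'}))"

definition ResRel :: "('u sgcontext, ('u sgcontext, ('u \<times> 'u) set) arrow) cat" where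
  "ResRel =
    \<lparr>Obj = {R. residuated_relation R},
     Arr = {\<lparr>adom = R, acod = S, adat = b\<rparr> | R S b.
              residuated_relation R \<and> residuated_relation S \<and> bond R S b \<and> multiplicative R S b},
     Dom = adom, Cod = acod,
     Idn = \<lambda>R. \<lparr>adom = R, acod = R, adat = inc R\<rparr>,
     Cmp = \<lambda>g f. \<lparr>adom = adom f, acod = acod g,
                   adat = bond_comp (adom f) (acod f) (acod g) (adat g) (adat f)\<rparr>\<rparr>"


section \<open>Back diagonals\<close>

record ('o, 'm) quantaloid = "('o, 'm) cat" +
  aleq :: "'m \<Rightarrow> 'm \<Rightarrow> bool"

text \<open>
  The two residuals of composition: \<open>rlift Q s b\<close> is the greatest \<open>l\<close> with \<open>b \<cdot> l \<le> s\<close>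
  (written \<open>b \<searrow> s\<close>; here \<open>b\<close> and \<open>s\<close> have the same codomain), and \<open>rext Q s l\<close> is the greatest
  \<open>e\<close> with \<open>e \<cdot> l \<le> s\<close> (written \<open>s \<swarrow> l\<close>; here \<open>l\<close> and \<open>s\<close> have the same domain).
\<close>

definition rlift :: "('o, 'm) quantaloid \<Rightarrow> 'm \<Rightarrow> 'm \<Rightarrow> 'm" where
  "rlift Q s b = (THE l. l \<in> Hom Q (Dom Q s) (Dom Q b) \<and> aleq Q (b \<cdot>\<^bsub>Q\<^esub> l) s \<and>
     (\<forall>l' \<in> Hom Q (Dom Q s) (Dom Q b). aleq Q (b \<cdot>\<^bsub>Q\<^esub> l') s \<longrightarrow> aleq Q l' l))"

definition rext :: "('o, 'm) quantaloid \<Rightarrow> 'm \<Rightarrow> 'm \<Rightarrow> 'm" where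
  "rext Q s l = (THE e. e \<in> Hom Q (Cod Q l) (Cod Q s) \<and> aleq Q (e \<cdot>\<^bsub>Q\<^esub> l) s \<and>
     (\<forall>e' \<in> Hom Q (Cod Q l) (Cod Q s). aleq Q (e' \<cdot>\<^bsub>Q\<^esub> l) s \<longrightarrow> aleq Q e' e))"

definition back_diagonal :: "('o, 'm) quantaloid \<Rightarrow> 'm \<Rightarrow> 'm \<Rightarrow> 'm \<Rightarrow> bool" where
  "back_diagonal Q u v b \<longleftrightarrow> b \<in> Hom Q (Dom Q u) (Cod Q v) \<and>
     rext Q v (rlift Q v b) = b \<and> rlift Q u (rext Q u b) = b"

definition BackDiag :: "('o, 'm) quantaloid \<Rightarrow> ('m, ('m, 'm) arrow) cat" where
  "BackDiag Q =
    \<lparr>Obj = Arr Q,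
     Arr = {\<lparr>adom = u, acod = v, adat = b\<rparr> | u v b.
              u \<in> Arr Q \<and> v \<in> Arr Q \<and> back_diagonal Q u v b},
     Dom = adom, Cod = acod,
     Idn = \<lambda>u. \<lparr>adom = u, acod = u, adat = u\<rparr>,
     Cmp = \<lambda>g f. \<lparr>adom = adom f, acod = acod g,
                   adat = rext Q (adat g) (rlift Q (acod f) (adat f))\<rparr>\<rparr>"

definition Rel :: "('u set, ('u set, ('u \<times> 'u) set) arrow) quantaloid" where
  "Rel =
    \<lparr>Obj = {X. small X},
     Arr = {\<lparr>adom = X, acod = Y, adat = R\<rparr> | X Y R. small X \<and> small Y \<and> R \<subseteq> X \<times> Y},
     Dom = adom, Cod = acod,
     Idn = \<lambda>X. \<lparr>adom = X, acod = X, adat = Id_on X\<rparr>,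
     Cmp = \<lambda>g f. \<lparr>adom = adom f, acod = acod g, adat = adat f O adat g\<rparr>,
     aleq = \<lambda>f g. adom f = adom g \<and> acod f = acod g \<and> adat f \<subseteq> adat g\<rparr>"

text \<open>
  The canonical isomorphism between \<open>Bond\<close> and \<open>BackDiag Rel\<close> and its inverse: a context is
  regarded as an arrow of \<open>Rel\<close>, and a bond \<open>b\<close> from \<open>R \<subseteq> X \<times> Y\<close> to \<open>S \<subseteq> Z \<times> W\<close> as an arrow
  from \<open>X\<close> to \<open>W\<close>.
\<close>

type_synonym 'u rel_arrow = "('u set, ('u \<times> 'u) set) arrow"

definition ctx_to_rel :: "'u fcontext \<Rightarrow> 'u rel_arrow" where
  "ctx_to_rel R = \<lparr>adom = objs R, acod = attrs R, adat = inc R\<rparr>"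

definition rel_to_ctx :: "'u rel_arrow \<Rightarrow> 'u fcontext" where
  "rel_to_ctx r = \<lparr>objs = adom r, attrs = acod r, inc = adat r\<rparr>"

definition Bond_to_BRel ::
  "('u fcontext, ('u fcontext, ('u \<times> 'u) set) arrow,
    'u rel_arrow, ('u rel_arrow, 'u rel_arrow) arrow) fctr" where
  "Bond_to_BRel =
    \<lparr>on_obj = ctx_to_rel,
     on_arr = \<lambda>f. \<lparr>adom = ctx_to_rel (adom f), acod = ctx_to_rel (acod f),
       adat = \<lparr>adom = objs (adom f), acod = attrs (acod f), adat = adat f\<rparr>\<rparr>\<rparr>"

definition BRel_to_Bond ::
  "('u rel_arrow, ('u rel_arrow, 'u rel_arrow) arrow,
    'u fcontext, ('u fcontext, ('u \<times> 'u) set) arrow) fctr" where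
  "BRel_to_Bond =
    \<lparr>on_obj = rel_to_ctx,
     on_arr = \<lambda>f. \<lparr>adom = rel_to_ctx (adom f), acod = rel_to_ctx (acod f),
       adat = adat (adat f)\<rparr>\<rparr>"

end

theory Submission
  imports Defs
begin

text \<open>
  A fully faithful and essentially surjective functor is an equivalence, so every equivalence is
  obtained from such a functor. A quantale \<open>Q\<close> becomes the residuated relation \<open>\<le>\<close> on \<open>Q\<close>; bonds
  between such relations are exactly the sup-preserving maps, and every residuated relation is
  isomorphic to the one of its quantale of extents, because residuation makes the closure operator
  a nucleus. A quantale is also a semigroup object in sup-lattices, as its multiplication is
  classified by the tensor product, which is realised by the sets of pairs closed under suprema in
  each variable. Semigroup objects are carried along strong monoidal equivalences by transporting
  the multiplication along the coherence isomorphisms. Finally, the residuals of composition in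
  \<open>Rel\<close> are the derivation operators of contexts, so that back diagonals are bonds.
\<close>

section \<open>Equivalences of categories\<close>

text \<open>A semigroup object involves the tensor and the associator of a monoidal structure, so
  the tensors on \<open>Bond\<close>, \<open>SupCat\<close> and \<open>BackDiag Rel\<close> are all
  handled through \<open>semigroupal_category\<close>. For \<open>SupCat\<close> the laws are
  established from scratch: the tensor of lattices, its action on arrows and the associator are
  given by \<open>SOME\<close> and \<open>THE\<close>, and each description must be shown to denote.
  Size shapes the constructions. Extents and closed sets of pairs are sets, while the carrier of a
  lattice is a small subset of \<open>'u\<close>. Hence closed sets are named by elements of
  \<open>'u\<close> through an injection, which exists because power sets of small sets are small.
  Suprema are handled through their upper bounds: two elements are equal when they lie below the
  same elements. Tested in this way against an extent, closures disappear and identities in the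
  lattice reduce to identities of sets. \<open>Quant\<close> and \<open>SGrp Bond T\<close> are both
  compared with \<open>SGrp SupCat sup_tensor\<close>, since the assumed equivalence leads from
  \<open>Bond\<close> to \<open>SupCat\<close>.\<close>

lemma HomI: "\<lbrakk>f \<in> Arr C; Dom C f = A; Cod C f = B\<rbrakk> \<Longrightarrow> f \<in> Hom C A B"
  by (simp add: Hom_def)

lemma HomD:
  assumes "f \<in> Hom C A B"
  shows "f \<in> Arr C" "Dom C f = A" "Cod C f = B"
  using assms by (auto simp: Hom_def)

section \<open>Composition and inverses in a category\<close>

context category
begin

text \<open>The axioms are restated with \<open>Arr\<close>, \<open>Dom\<close> and
  \<open>Cod\<close>. The objects of a \<open>Hom\<close> premise cannot be read off from the
  conclusion; in this form the simplifier can check composability and reassociate composites to the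
  right.\<close>

lemma Idn_arr [simp]:
  assumes "A \<in> Obj C"
  shows "Idn C A \<in> Arr C" "Dom C (Idn C A) = A" "Cod C (Idn C A) = A"
  using Idn_in[OF assms] by (auto simp: Hom_def)

lemma Dom_Cod_Obj [simp]:
  assumes "f \<in> Arr C"
  shows "Dom C f \<in> Obj C" "Cod C f \<in> Obj C"
  using assms by (auto intro: Dom_in Cod_in)

lemma Cmp_arr [simp]:
  assumes "f \<in> Arr C" "g \<in> Arr C" "Dom C g = Cod C f"
  shows "g \<cdot> f \<in> Arr C" "Dom C (g \<cdot> f) = Dom C f" "Cod C (g \<cdot> f) = Cod C g"
  using Cmp_in[of f "Dom C f" "Cod C f" g "Cod C g"] assms by (auto simp: Hom_def)

lemma Cmp_Idn [simp]:
  assumes "f \<in> Arr C"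
  shows "Cod C f = A \<Longrightarrow> Idn C A \<cdot> f = f" "Dom C f = A \<Longrightarrow> f \<cdot> Idn C A = f"
  using Idn_left[of f "Dom C f" "Cod C f"] Idn_right[of f "Dom C f" "Cod C f"] assms
  by (auto simp: Hom_def)

lemma Cmp_assoc' [simp]:
  assumes "f \<in> Arr C" "g \<in> Arr C" "h \<in> Arr C" "Dom C g = Cod C f" "Dom C h = Cod C g"
  shows "(h \<cdot> g) \<cdot> f = h \<cdot> g \<cdot> f"
  using Cmp_assoc[of f "Dom C f" "Cod C f" g "Cod C g" h "Cod C h"] assms
  by (auto simp: Hom_def)

text \<open>Names the inverse that \<open>is_iso\<close> hides under a quantifier, so that
  cancellation becomes a rewrite rule.\<close>

definition inverse_arrows :: "'m \<Rightarrow> 'm \<Rightarrow> bool" where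
  "inverse_arrows f g \<longleftrightarrow> f \<in> Arr C \<and> g \<in> Arr C \<and> Dom C g = Cod C f \<and> Cod C g = Dom C f \<and>
     g \<cdot> f = Idn C (Dom C f) \<and> f \<cdot> g = Idn C (Cod C f)"

lemma is_iso_iff_inverse: "is_iso C f \<longleftrightarrow> (\<exists>g. inverse_arrows f g)"
  by (auto simp: is_iso_def inverse_arrows_def Hom_def)

lemma inverse_arrowsD:
  assumes "inverse_arrows f g"
  shows "f \<in> Arr C" "g \<in> Arr C" "Dom C g = Cod C f" "Cod C g = Dom C f"
    and "g \<cdot> f = Idn C (Dom C f)" "f \<cdot> g = Idn C (Cod C f)"
  using assms by (auto simp: inverse_arrows_def)

lemma inverse_arrows_Cmp_Idn [simp]:
  assumes "inverse_arrows f g"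
  shows "g \<cdot> f = Idn C (Dom C f)" "f \<cdot> g = Idn C (Cod C f)"
  using inverse_arrowsD[OF assms] by simp_all

text \<open>Composites are normalised to the right, so a cancelling pair followed by
  \<open>h\<close> appears as \<open>g \<cdot> (f \<cdot> h)\<close> and needs rules of its
  own.\<close>

lemma inverse_arrows_cancel [simp]:
  assumes "inverse_arrows f g" "h \<in> Arr C"
  shows "Cod C h = Dom C f \<Longrightarrow> g \<cdot> f \<cdot> h = h" "Cod C h = Cod C f \<Longrightarrow> f \<cdot> g \<cdot> h = h"
proof -
  note fg = inverse_arrowsD[OF assms(1)]
  assume h: "Cod C h = Dom C f"
  have "g \<cdot> f \<cdot> h = (g \<cdot> f) \<cdot> h" by (rule Cmp_assoc'[symmetric]) (use fg assms(2) h in auto)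
  then show "g \<cdot> f \<cdot> h = h" using fg(5) h assms(2) by (simp del: Cmp_assoc')
next
  note fg = inverse_arrowsD[OF assms(1)]
  assume h: "Cod C h = Cod C f"
  have "f \<cdot> g \<cdot> h = (f \<cdot> g) \<cdot> h" by (rule Cmp_assoc'[symmetric]) (use fg assms(2) h in auto)
  then show "f \<cdot> g \<cdot> h = h" using fg(6) h assms(2) by (simp del: Cmp_assoc')
qed

lemma inverse_arrows_sym: "inverse_arrows f g \<Longrightarrow> inverse_arrows g f"
  unfolding inverse_arrows_def by metis

lemma inverse_arrows_Idn: "A \<in> Obj C \<Longrightarrow> inverse_arrows (Idn C A) (Idn C A)"
  unfolding inverse_arrows_def by simp

lemma inverse_arrows_Cmp:
  assumes "inverse_arrows f f'" "inverse_arrows g g'" "Dom C g = Cod C f"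
  shows "inverse_arrows (g \<cdot> f) (f' \<cdot> g')"
  unfolding inverse_arrows_def[of "g \<cdot> f"]
  using assms inverse_arrowsD[OF assms(1)] inverse_arrowsD[OF assms(2)] by simp

lemma is_iso_cancel_right:
  assumes "is_iso C e" "f \<in> Arr C" "g \<in> Arr C" "Dom C f = Cod C e" "Dom C g = Cod C e"
    and eq: "f \<cdot> e = g \<cdot> e"
  shows "f = g"
proof -
  obtain e' where e': "inverse_arrows e e'" using assms(1) is_iso_iff_inverse by blast
  have "(f \<cdot> e) \<cdot> e' = (g \<cdot> e) \<cdot> e'" using eq by simp
  with inverse_arrowsD[OF e'] assms(2-5) show ?thesis by simp
qed

lemma is_iso_cancel_left:
  assumes "is_iso C e" "f \<in> Arr C" "g \<in> Arr C" "Cod C f = Dom C e" "Cod C g = Dom C e"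
    and eq: "e \<cdot> f = e \<cdot> g"
  shows "f = g"
proof -
  obtain e' where e': "inverse_arrows e e'" using assms(1) is_iso_iff_inverse by blast
  have "e' \<cdot> (e \<cdot> f) = e' \<cdot> (e \<cdot> g)" using eq by simp
  with e' assms(2-5) show ?thesis by simp
qed

end

context cat_functor
begin

lemma on_obj_Obj [simp]: "A \<in> Obj C \<Longrightarrow> on_obj F A \<in> Obj D"
  by (rule on_obj_in)

lemma on_arr_Arr [simp]:
  assumes "f \<in> Arr C"
  shows "on_arr F f \<in> Arr D" "Dom D (on_arr F f) = on_obj F (Dom C f)"
    "Cod D (on_arr F f) = on_obj F (Cod C f)"
  using on_arr_in[of f "Dom C f" "Cod C f"] assms by (auto simp: Hom_def)

lemma on_arr_Idn' [simp]: "A \<in> Obj C \<Longrightarrow> on_arr F (Idn C A) = Idn D (on_obj F A)"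
  by (rule on_arr_Idn)

lemma on_arr_Cmp' [simp]:
  assumes "f \<in> Arr C" "g \<in> Arr C" "Dom C g = Cod C f"
  shows "on_arr F (g \<cdot>\<^bsub>C\<^esub> f) = on_arr F g \<cdot>\<^bsub>D\<^esub> on_arr F f"
  using on_arr_Cmp[of f "Dom C f" "Cod C f" g "Cod C g"] assms by (auto simp: Hom_def)

lemma on_arr_inverse: "C.inverse_arrows f g \<Longrightarrow> D.inverse_arrows (on_arr F f) (on_arr F g)"
  unfolding D.inverse_arrows_def
  using C.inverse_arrowsD[of f g] on_arr_Cmp'[of f g] on_arr_Cmp'[of g f] by simp

end

lemma cat_functorI:
  assumes "category C" "category D"
    and "\<And>A. A \<in> Obj C \<Longrightarrow> on_obj F A \<in> Obj D"
    and "\<And>f. f \<in> Arr C \<Longrightarrow> on_arr F f \<in> Arr D"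
    and "\<And>f. f \<in> Arr C \<Longrightarrow> Dom D (on_arr F f) = on_obj F (Dom C f)"
    and "\<And>f. f \<in> Arr C \<Longrightarrow> Cod D (on_arr F f) = on_obj F (Cod C f)"
    and "\<And>A. A \<in> Obj C \<Longrightarrow> on_arr F (Idn C A) = Idn D (on_obj F A)"
    and "\<And>f g. \<lbrakk>f \<in> Arr C; g \<in> Arr C; Dom C g = Cod C f\<rbrakk>
           \<Longrightarrow> on_arr F (g \<cdot>\<^bsub>C\<^esub> f) = on_arr F g \<cdot>\<^bsub>D\<^esub> on_arr F f"
  shows "cat_functor C D F"
  unfolding cat_functor_def cat_functor_axioms_def using assms by (auto simp: Hom_def)

section \<open>Fully faithful and essentially surjective functors\<close>

definition weak_equivalence ::
  "('o, 'm, 'y) cat_scheme \<Rightarrow> ('p, 'n, 'z) cat_scheme \<Rightarrow> ('o, 'm, 'p, 'n) fctr \<Rightarrow> bool" where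
  "weak_equivalence C D F \<longleftrightarrow> cat_functor C D F \<and>
     (\<forall>f \<in> Arr C. \<forall>g \<in> Arr C. Dom C f = Dom C g \<longrightarrow> Cod C f = Cod C g \<longrightarrow>
        on_arr F f = on_arr F g \<longrightarrow> f = g) \<and>
     (\<forall>A \<in> Obj C. \<forall>B \<in> Obj C. \<forall>h \<in> Hom D (on_obj F A) (on_obj F B).
        \<exists>f \<in> Hom C A B. on_arr F f = h) \<and>
     (\<forall>B \<in> Obj D. \<exists>A \<in> Obj C. \<exists>e \<in> Hom D (on_obj F A) B. is_iso D e)"

lemma weak_equivalenceD:
  assumes "weak_equivalence C D F"
  shows weak_equivalence_functor: "cat_functor C D F"
    and weak_equivalence_faithful: "\<lbrakk>f \<in> Arr C; g \<in> Arr C; Dom C f = Dom C g; Cod C f = Cod C g;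
          on_arr F f = on_arr F g\<rbrakk> \<Longrightarrow> f = g"
    and weak_equivalence_full: "\<lbrakk>A \<in> Obj C; B \<in> Obj C; h \<in> Arr D; Dom D h = on_obj F A;
          Cod D h = on_obj F B\<rbrakk>
          \<Longrightarrow> \<exists>f. f \<in> Arr C \<and> Dom C f = A \<and> Cod C f = B \<and> on_arr F f = h"
    and weak_equivalence_eso: "Y \<in> Obj D
          \<Longrightarrow> \<exists>X e. X \<in> Obj C \<and> e \<in> Arr D \<and> Dom D e = on_obj F X \<and> Cod D e = Y \<and> is_iso D e"
proof -
  assume *: "A \<in> Obj C" "B \<in> Obj C" "h \<in> Arr D" "Dom D h = on_obj F A" "Cod D h = on_obj F B"
  then have "h \<in> Hom D (on_obj F A) (on_obj F B)" by (simp add: Hom_def)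
  with assms * obtain f where "f \<in> Hom C A B" "on_arr F f = h"
    unfolding weak_equivalence_def by blast
  then show "\<exists>f. f \<in> Arr C \<and> Dom C f = A \<and> Cod C f = B \<and> on_arr F f = h"
    by (auto simp: Hom_def)
next
  assume "Y \<in> Obj D"
  with assms obtain X e where "X \<in> Obj C" "e \<in> Hom D (on_obj F X) Y" "is_iso D e"
    unfolding weak_equivalence_def by meson
  then show "\<exists>X e. X \<in> Obj C \<and> e \<in> Arr D \<and> Dom D e = on_obj F X \<and> Cod D e = Y \<and> is_iso D e"
    by (auto simp: Hom_def)
qed (use assms in \<open>auto simp: weak_equivalence_def\<close>)

text \<open>Composing the naturality square of \<open>\<eta>\<close> on both sides with inverse
  components yields the square of the inverses.\<close>

lemma nat_iso_inverse:
  assumes F: "cat_functor C D F" and G: "cat_functor C D G" and \<eta>: "nat_iso C D F G \<eta>"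
  shows "\<exists>\<theta>. nat_iso C D G F \<theta>"
proof -
  interpret F: cat_functor C D F by (rule F)
  interpret G: cat_functor C D G by (rule G)
  have "\<forall>A \<in> Obj C. \<exists>t. F.D.inverse_arrows (\<eta> A) t"
    using \<eta> by (auto simp: nat_iso_def F.D.is_iso_iff_inverse)
  then obtain \<theta> where \<theta>: "\<And>A. A \<in> Obj C \<Longrightarrow> F.D.inverse_arrows (\<eta> A) (\<theta> A)" by metis
  have dom: "Dom D (\<eta> A) = on_obj F A" "Cod D (\<eta> A) = on_obj G A" if "A \<in> Obj C" for A
    using \<eta> that by (auto simp: nat_iso_def Hom_def)
  have nat: "\<eta> (Cod C f) \<cdot>\<^bsub>D\<^esub> on_arr F f = on_arr G f \<cdot>\<^bsub>D\<^esub> \<eta> (Dom C f)" if "f \<in> Arr C" for f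
    using \<eta> that by (auto simp: nat_iso_def)
  have "nat_iso C D G F \<theta>"
    unfolding nat_iso_def
  proof (intro conjI ballI)
    fix A assume A: "A \<in> Obj C"
    show "\<theta> A \<in> Hom D (on_obj G A) (on_obj F A)" "is_iso D (\<theta> A)"
      using F.D.inverse_arrowsD[OF \<theta>[OF A]] dom[OF A] F.D.inverse_arrows_sym[OF \<theta>[OF A]]
      by (auto simp: Hom_def F.D.is_iso_iff_inverse)
  next
    fix f assume f: "f \<in> Arr C"
    have \<theta>f: "F.D.inverse_arrows (\<eta> (Dom C f)) (\<theta> (Dom C f))"
      "F.D.inverse_arrows (\<eta> (Cod C f)) (\<theta> (Cod C f))" using \<theta> f by simp_all
    note \<theta>f = \<theta>f \<theta>f[THEN F.D.inverse_arrowsD(1)] \<theta>f[THEN F.D.inverse_arrowsD(2)]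
      \<theta>f[THEN F.D.inverse_arrowsD(3)] \<theta>f[THEN F.D.inverse_arrowsD(4)]
    have "\<theta> (Cod C f) \<cdot>\<^bsub>D\<^esub> (on_arr G f \<cdot>\<^bsub>D\<^esub> \<eta> (Dom C f)) \<cdot>\<^bsub>D\<^esub> \<theta> (Dom C f)
        = \<theta> (Cod C f) \<cdot>\<^bsub>D\<^esub> (\<eta> (Cod C f) \<cdot>\<^bsub>D\<^esub> on_arr F f) \<cdot>\<^bsub>D\<^esub> \<theta> (Dom C f)"
      using nat[OF f] by simp
    then show "\<theta> (Cod C f) \<cdot>\<^bsub>D\<^esub> on_arr G f = on_arr F f \<cdot>\<^bsub>D\<^esub> \<theta> (Dom C f)"
      using f \<theta>f dom[of "Dom C f"] dom[of "Cod C f"] by simp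
  qed
  then show ?thesis by blast
qed

lemma cat_functor_id: "category C \<Longrightarrow> cat_functor C C id_fctr"
  by (rule cat_functorI) (auto simp: id_fctr_def)

lemma cat_functor_comp:
  assumes "cat_functor C D F" "cat_functor D E G"
  shows "cat_functor C E (comp_fctr G F)"
proof -
  interpret F: cat_functor C D F by (rule assms)
  interpret G: cat_functor D E G by (rule assms)
  show ?thesis by (rule cat_functorI)
     (auto simp: comp_fctr_def F.C.category_axioms G.D.category_axioms)
qed

lemma equivalent_categories_sym:
  assumes "C \<simeq> D"
  shows "D \<simeq> C"
proof -
  obtain F G \<eta> \<epsilon> where F: "cat_functor C D F" and G: "cat_functor D C G"
    and \<eta>: "nat_iso C C id_fctr (comp_fctr G F) \<eta>" and \<epsilon>: "nat_iso D D (comp_fctr F G) id_fctr \<epsilon>"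
    using assms unfolding equivalent_categories_def equivalence_functor_def by blast
  have C: "category C" and D: "category D" using F by (auto simp: cat_functor_def)
  obtain \<eta>' \<epsilon>' where "nat_iso C C (comp_fctr G F) id_fctr \<eta>'" "nat_iso D D id_fctr (comp_fctr F G) \<epsilon>'"
    using nat_iso_inverse[OF cat_functor_id[OF C] cat_functor_comp[OF F G] \<eta>]
      nat_iso_inverse[OF cat_functor_comp[OF G F] cat_functor_id[OF D] \<epsilon>] by blast
  with F G show ?thesis
    unfolding equivalent_categories_def equivalence_functor_def by blast
qed

text \<open>By naturality \<open>f\<close> followed by \<open>\<eta>\<close> is
  \<open>\<eta>\<close> followed by \<open>G (F f)\<close>, so \<open>F f = F g\<close> makes
  \<open>f\<close> and \<open>g\<close> agree after composition with the isomorphism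
  \<open>\<eta>\<close>. The same statement shows that a quasi-inverse is faithful, by means of the
  inverse of the counit.\<close>

lemma nat_iso_id_faithful:
  assumes F: "cat_functor C D F" and \<eta>: "nat_iso C C id_fctr (comp_fctr G F) \<eta>"
    and f: "f \<in> Arr C" "g \<in> Arr C" "Dom C f = Dom C g" "Cod C f = Cod C g"
    and eq: "on_arr F f = on_arr F g"
  shows "f = g"
proof -
  interpret F: cat_functor C D F by (rule F)
  have "\<eta> (Cod C f) \<cdot>\<^bsub>C\<^esub> f = on_arr G (on_arr F f) \<cdot>\<^bsub>C\<^esub> \<eta> (Dom C f)"
    "\<eta> (Cod C g) \<cdot>\<^bsub>C\<^esub> g = on_arr G (on_arr F g) \<cdot>\<^bsub>C\<^esub> \<eta> (Dom C g)"
    using \<eta> f by (auto simp: nat_iso_def id_fctr_def comp_fctr_def)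
  moreover have "is_iso C (\<eta> (Cod C f))" "Dom C (\<eta> (Cod C f)) = Cod C f"
    using \<eta> f by (auto simp: nat_iso_def id_fctr_def comp_fctr_def Hom_def)
  ultimately show ?thesis
    by (intro F.C.is_iso_cancel_left[of "\<eta> (Cod C f)" f g]) (use f eq in simp_all)
qed

lemma equivalence_functor_imp_weak:
  assumes "equivalence_functor C D F"
  shows "weak_equivalence C D F"
proof -
  obtain G \<eta> \<epsilon> where F: "cat_functor C D F" and G: "cat_functor D C G"
    and \<eta>: "nat_iso C C id_fctr (comp_fctr G F) \<eta>" and \<epsilon>: "nat_iso D D (comp_fctr F G) id_fctr \<epsilon>"
    using assms unfolding equivalence_functor_def by blast
  interpret F: cat_functor C D F by (rule F)
  interpret G: cat_functor D C G by (rule G)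
  obtain \<epsilon>' where \<epsilon>': "nat_iso D D id_fctr (comp_fctr F G) \<epsilon>'"
    using nat_iso_inverse[OF cat_functor_comp[OF G F] cat_functor_id \<epsilon>] F.D.category_axioms by blast
  have \<eta>A: "\<eta> A \<in> Arr C" "Dom C (\<eta> A) = A" "Cod C (\<eta> A) = on_obj G (on_obj F A)"
    "is_iso C (\<eta> A)" if "A \<in> Obj C" for A
    using \<eta> that by (auto simp: nat_iso_def id_fctr_def comp_fctr_def Hom_def)
  have nat: "\<eta> (Cod C f) \<cdot>\<^bsub>C\<^esub> f = on_arr G (on_arr F f) \<cdot>\<^bsub>C\<^esub> \<eta> (Dom C f)" if "f \<in> Arr C" for f
    using \<eta> that by (auto simp: nat_iso_def id_fctr_def comp_fctr_def)
  have full: "\<exists>f \<in> Hom C A B. on_arr F f = h"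
    if A: "A \<in> Obj C" "B \<in> Obj C" and h: "h \<in> Hom D (on_obj F A) (on_obj F B)" for A B h
  proof -
    note h = HomD[OF h]
    obtain t where t: "F.C.inverse_arrows (\<eta> B) t"
      using \<eta>A(4)[OF A(2)] F.C.is_iso_iff_inverse by blast
    note t' = F.C.inverse_arrowsD[OF t] \<eta>A[OF A(1)] \<eta>A[OF A(2)]
    \<comment> \<open>Naturality of \<open>\<eta>\<close> forces this choice: a preimage of
      \<open>h\<close> must satisfy \<open>\<eta> B \<cdot> f = G h \<cdot> \<eta> A\<close>.
      Conversely the choice gives \<open>G (F f) = G h\<close>, and faithfulness of \<open>G\<close>
      removes \<open>G\<close>.\<close>
    define f where "f = t \<cdot>\<^bsub>C\<^esub> on_arr G h \<cdot>\<^bsub>C\<^esub> \<eta> A"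
    have f: "f \<in> Arr C" "Dom C f = A" "Cod C f = B"
      unfolding f_def using A h t' by simp_all
    have "on_arr G (on_arr F f) \<cdot>\<^bsub>C\<^esub> \<eta> A = \<eta> B \<cdot>\<^bsub>C\<^esub> f" using nat[OF f(1)] f by simp
    also have "\<dots> = on_arr G h \<cdot>\<^bsub>C\<^esub> \<eta> A"
      unfolding f_def using A h t t' by simp
    finally have "on_arr G (on_arr F f) = on_arr G h"
      by (intro F.C.is_iso_cancel_right[of "\<eta> A" "on_arr G (on_arr F f)" "on_arr G h"])
         (use f A h t' in simp_all)
    then have "on_arr F f = h"
      by (intro nat_iso_id_faithful[OF G \<epsilon>']) (use f h in simp_all)
    with f show ?thesis by (auto intro: HomI)
  qed
  have eso: "\<exists>A \<in> Obj C. \<exists>e \<in> Hom D (on_obj F A) B. is_iso D e" if "B \<in> Obj D" for B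
    using \<epsilon> that G.on_obj_Obj[OF that]
    by (intro bexI[of _ "on_obj G B"] bexI[of _ "\<epsilon> B"])
       (auto simp: nat_iso_def id_fctr_def comp_fctr_def)
  show ?thesis
    unfolding weak_equivalence_def
    by (intro conjI ballI impI F full eso) (rule nat_iso_id_faithful[OF F \<eta>])
qed

text \<open>Choice selects for each \<open>B\<close> an object \<open>G0 B\<close> with an
  isomorphism \<open>\<epsilon> B\<close> from its image to \<open>B\<close>. An arrow
  \<open>h\<close> goes to a preimage of its conjugate by \<open>\<epsilon>\<close>. Every equation
  in \<open>C\<close>, whether functoriality of \<open>G\<close>, naturality of the unit or its
  invertibility, is verified after applying the faithful \<open>F\<close>, where it becomes a
  cancellation of \<open>\<epsilon>\<close> against its inverse.\<close>

lemma weak_equivalence_imp_equivalence: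
  assumes "weak_equivalence C D F"
  shows "equivalence_functor C D F"
proof -
  note W = weak_equivalenceD[OF assms]
  interpret F: cat_functor C D F by (rule W(1))
  \<comment> \<open>Object, isomorphism and inverse are bundled in a triple so that one use of
    choice fixes all three together.\<close>
  have "\<forall>B \<in> Obj D. \<exists>p. case p of (A, e, e') \<Rightarrow> A \<in> Obj C \<and> e \<in> Arr D \<and>
      Dom D e = on_obj F A \<and> Cod D e = B \<and> e' \<in> Arr D \<and> Dom D e' = B \<and>
      Cod D e' = on_obj F A \<and> F.D.inverse_arrows e e'"
  proof
    fix B assume "B \<in> Obj D"
    then obtain A e where A: "A \<in> Obj C" "e \<in> Arr D" "Dom D e = on_obj F A" "Cod D e = B"
      and "is_iso D e" using W(4) by blast
    then obtain e' where e': "F.D.inverse_arrows e e'" using F.D.is_iso_iff_inverse by blast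
    show "\<exists>p. case p of (A, e, e') \<Rightarrow> A \<in> Obj C \<and> e \<in> Arr D \<and>
      Dom D e = on_obj F A \<and> Cod D e = B \<and> e' \<in> Arr D \<and> Dom D e' = B \<and>
      Cod D e' = on_obj F A \<and> F.D.inverse_arrows e e'"
      by (rule exI[of _ "(A, e, e')"]) (use A e' F.D.inverse_arrowsD(1-4)[OF e'] in simp)
  qed
  from bchoice[OF this] obtain c where "\<forall>B \<in> Obj D. case c B of (A, e, e') \<Rightarrow>
      A \<in> Obj C \<and> e \<in> Arr D \<and> Dom D e = on_obj F A \<and> Cod D e = B \<and> e' \<in> Arr D \<and>
      Dom D e' = B \<and> Cod D e' = on_obj F A \<and> F.D.inverse_arrows e e'" ..
  note c = this[THEN bspec]
  define G0 \<epsilon> \<epsilon>' where "G0 B = fst (c B)" and "\<epsilon> B = fst (snd (c B))" and "\<epsilon>' B = snd (snd (c B))"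
    for B
  note c = c[unfolded case_prod_beta, folded G0_def \<epsilon>_def \<epsilon>'_def]
  have G0: "\<And>B. B \<in> Obj D \<Longrightarrow> G0 B \<in> Obj C"
    and \<epsilon>: "\<And>B. B \<in> Obj D \<Longrightarrow> \<epsilon> B \<in> Arr D" "\<And>B. B \<in> Obj D \<Longrightarrow> Dom D (\<epsilon> B) = on_obj F (G0 B)"
      "\<And>B. B \<in> Obj D \<Longrightarrow> Cod D (\<epsilon> B) = B"
    and \<epsilon>': "\<And>B. B \<in> Obj D \<Longrightarrow> \<epsilon>' B \<in> Arr D" "\<And>B. B \<in> Obj D \<Longrightarrow> Dom D (\<epsilon>' B) = B"
      "\<And>B. B \<in> Obj D \<Longrightarrow> Cod D (\<epsilon>' B) = on_obj F (G0 B)"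
    and inv: "\<And>B. B \<in> Obj D \<Longrightarrow> F.D.inverse_arrows (\<epsilon> B) (\<epsilon>' B)"
    using c by simp_all
  have "\<forall>h \<in> Arr D. \<exists>f. f \<in> Arr C \<and> Dom C f = G0 (Dom D h) \<and> Cod C f = G0 (Cod D h) \<and>
      on_arr F f = \<epsilon>' (Cod D h) \<cdot>\<^bsub>D\<^esub> h \<cdot>\<^bsub>D\<^esub> \<epsilon> (Dom D h)"
    using G0 \<epsilon> \<epsilon>' by (intro ballI W(3)) simp_all
  from bchoice[OF this] obtain G1 where G1: "\<And>h. h \<in> Arr D \<Longrightarrow> G1 h \<in> Arr C"
    "\<And>h. h \<in> Arr D \<Longrightarrow> Dom C (G1 h) = G0 (Dom D h)"
    "\<And>h. h \<in> Arr D \<Longrightarrow> Cod C (G1 h) = G0 (Cod D h)"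
    "\<And>h. h \<in> Arr D \<Longrightarrow> on_arr F (G1 h) = \<epsilon>' (Cod D h) \<cdot>\<^bsub>D\<^esub> h \<cdot>\<^bsub>D\<^esub> \<epsilon> (Dom D h)"
    by auto
  define G where "G = \<lparr>on_obj = G0, on_arr = G1\<rparr>"
  have [simp]: "on_obj G = G0" "on_arr G = G1" by (simp_all add: G_def)
  have G: "cat_functor D C G"
  proof (rule cat_functorI)
    fix B assume B: "B \<in> Obj D"
    show "on_arr G (Idn D B) = Idn C (on_obj G B)"
      by (rule W(2)) (use B G0 G1 \<epsilon> \<epsilon>' F.D.inverse_arrowsD(5)[OF inv] in simp_all)
  next
    fix f g assume f: "f \<in> Arr D" "g \<in> Arr D" "Dom D g = Cod D f"
    show "on_arr G (g \<cdot>\<^bsub>D\<^esub> f) = on_arr G g \<cdot>\<^bsub>C\<^esub> on_arr G f"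
      by (rule W(2)) (use f G0 G1 \<epsilon> \<epsilon>' F.D.inverse_arrows_cancel(2)[OF inv] in simp_all)
  qed (use G0 G1 F.C.category_axioms F.D.category_axioms in auto)
  \<comment> \<open>The inverse counit at \<open>F A\<close> runs from \<open>F A\<close> to
    \<open>F (G0 (F A))\<close>; its preimage is the unit at \<open>A\<close>.\<close>
  have "\<forall>A \<in> Obj C. \<exists>t. t \<in> Arr C \<and> Dom C t = A \<and> Cod C t = G0 (on_obj F A) \<and>
      on_arr F t = \<epsilon>' (on_obj F A)"
    using G0 \<epsilon> \<epsilon>' by (intro ballI W(3)) simp_all
  from bchoice[OF this] obtain \<eta> where \<eta>: "\<And>A. A \<in> Obj C \<Longrightarrow> \<eta> A \<in> Arr C" "\<And>A. A \<in> Obj C \<Longrightarrow> Dom C (\<eta> A) = A"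
    "\<And>A. A \<in> Obj C \<Longrightarrow> Cod C (\<eta> A) = G0 (on_obj F A)"
    "\<And>A. A \<in> Obj C \<Longrightarrow> on_arr F (\<eta> A) = \<epsilon>' (on_obj F A)" by auto
  have \<eta>_iso: "is_iso C (\<eta> A)" if A: "A \<in> Obj C" for A
  proof -
    have "\<exists>t. t \<in> Arr C \<and> Dom C t = G0 (on_obj F A) \<and> Cod C t = A \<and> on_arr F t = \<epsilon> (on_obj F A)"
      using A G0 \<epsilon> \<epsilon>' by (intro W(3)) simp_all
    then obtain t where t: "t \<in> Arr C" "Dom C t = G0 (on_obj F A)" "Cod C t = A"
      "on_arr F t = \<epsilon> (on_obj F A)" by blast
    have "t \<cdot>\<^bsub>C\<^esub> \<eta> A = Idn C A"
      by (rule W(2)) (use A t \<eta> \<epsilon> \<epsilon>' F.D.inverse_arrowsD(6)[OF inv] in simp_all)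
    moreover have "\<eta> A \<cdot>\<^bsub>C\<^esub> t = Idn C (G0 (on_obj F A))"
      by (rule W(2)) (use A t G0 \<eta> \<epsilon> \<epsilon>' F.D.inverse_arrowsD(5)[OF inv] in simp_all)
    ultimately show ?thesis
      unfolding F.C.is_iso_iff_inverse F.C.inverse_arrows_def using A t \<eta> by auto
  qed
  have "nat_iso C C id_fctr (comp_fctr G F) \<eta>"
    unfolding nat_iso_def
  proof (intro conjI ballI)
    fix f assume f: "f \<in> Arr C"
    have "\<eta> (Cod C f) \<cdot>\<^bsub>C\<^esub> f = G1 (on_arr F f) \<cdot>\<^bsub>C\<^esub> \<eta> (Dom C f)"
      by (rule W(2)) (use f G0 G1 \<eta> \<epsilon> \<epsilon>' F.D.inverse_arrowsD(6)[OF inv] in simp_all)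
    then show "\<eta> (Cod C f) \<cdot>\<^bsub>C\<^esub> on_arr id_fctr f = on_arr (comp_fctr G F) f \<cdot>\<^bsub>C\<^esub> \<eta> (Dom C f)"
      by (simp add: id_fctr_def comp_fctr_def)
  qed (use \<eta> \<eta>_iso in \<open>auto simp: id_fctr_def comp_fctr_def Hom_def\<close>)
  moreover have "is_iso D (\<epsilon> B)" if "B \<in> Obj D" for B
    unfolding F.D.is_iso_iff_inverse using inv[OF that] by blast
  then have "nat_iso D D (comp_fctr F G) id_fctr \<epsilon>"
    unfolding nat_iso_def
    using \<epsilon> \<epsilon>' G1 F.D.inverse_arrows_cancel(2)[OF inv]
    by (auto simp: id_fctr_def comp_fctr_def Hom_def)
  ultimately show ?thesis
    unfolding equivalence_functor_def using F.cat_functor_axioms G by blast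
qed

lemma weak_equivalence_imp_equivalent: "weak_equivalence C D F \<Longrightarrow> C \<simeq> D"
  unfolding equivalent_categories_def using weak_equivalence_imp_equivalence by blast

lemma weak_equivalence_comp:
  assumes F: "weak_equivalence C D F" and G: "weak_equivalence D E G"
  shows "weak_equivalence C E (comp_fctr G F)"
proof -
  note F' = weak_equivalenceD[OF F] and G' = weak_equivalenceD[OF G]
  interpret F: cat_functor C D F by (rule F')
  interpret G: cat_functor D E G by (rule G')
  show ?thesis
    unfolding weak_equivalence_def
  proof (intro conjI ballI impI)
    show "cat_functor C E (comp_fctr G F)" by (rule cat_functor_comp[OF F'(1) G'(1)])
  next
    fix f g assume f: "f \<in> Arr C" "g \<in> Arr C" "Dom C f = Dom C g" "Cod C f = Cod C g"
      "on_arr (comp_fctr G F) f = on_arr (comp_fctr G F) g"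
    then have "on_arr F f = on_arr F g"
      by (intro G'(2)) (simp_all add: comp_fctr_def)
    with f show "f = g" by (intro F'(2))
  next
    fix A B h
    assume A: "A \<in> Obj C" "B \<in> Obj C" and "h \<in> Hom E (on_obj (comp_fctr G F) A) (on_obj (comp_fctr G F) B)"
    then have h: "h \<in> Arr E" "Dom E h = on_obj G (on_obj F A)" "Cod E h = on_obj G (on_obj F B)"
      by (auto simp: comp_fctr_def Hom_def)
    obtain k where k: "k \<in> Arr D" "Dom D k = on_obj F A" "Cod D k = on_obj F B" "on_arr G k = h"
      using G'(3)[OF _ _ h] A by auto
    obtain f where "f \<in> Arr C" "Dom C f = A" "Cod C f = B" "on_arr F f = k"
      using F'(3)[OF A k(1-3)] by auto
    with k show "\<exists>f \<in> Hom C A B. on_arr (comp_fctr G F) f = h"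
      by (auto simp: comp_fctr_def Hom_def)
  next
    fix X assume "X \<in> Obj E"
    then obtain B e where B: "B \<in> Obj D" "e \<in> Arr E" "Dom E e = on_obj G B" "Cod E e = X" "is_iso E e"
      using G'(4) by blast
    then obtain A d where A: "A \<in> Obj C" "d \<in> Arr D" "Dom D d = on_obj F A" "Cod D d = B" "is_iso D d"
      using F'(4) by blast
    obtain e' d' where "G.D.inverse_arrows e e'" "F.D.inverse_arrows d d'"
      using A B G.D.is_iso_iff_inverse F.D.is_iso_iff_inverse by blast
    then have "G.D.inverse_arrows (e \<cdot>\<^bsub>E\<^esub> on_arr G d) (on_arr G d' \<cdot>\<^bsub>E\<^esub> e')"
      using A B by (intro G.D.inverse_arrows_Cmp G.on_arr_inverse) simp_all
    then have "is_iso E (e \<cdot>\<^bsub>E\<^esub> on_arr G d)" using G.D.is_iso_iff_inverse by blast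
    with A B show "\<exists>A \<in> Obj C. \<exists>e \<in> Hom E (on_obj (comp_fctr G F) A) X. is_iso E e"
      by (intro bexI[of _ A] bexI[of _ "e \<cdot>\<^bsub>E\<^esub> on_arr G d"]) (auto simp: comp_fctr_def Hom_def)
  qed
qed

text \<open>Passing through weak equivalences replaces the pasting of two quasi-inverses with their
  units by arguments about single objects and arrows.\<close>

lemma equivalent_categories_trans: "\<lbrakk>C \<simeq> D; D \<simeq> E\<rbrakk> \<Longrightarrow> C \<simeq> E"
  unfolding equivalent_categories_def
  by (elim exE) (rule exI, rule weak_equivalence_imp_equivalence, rule weak_equivalence_comp;
    erule equivalence_functor_imp_weak)

section \<open>Semigroup objects\<close>

text \<open>A bifunctor with a natural associator: the structure on which \<open>SGrp\<close> and
  its transport are built. \<open>Bond\<close> obtains it from its monoidal structure,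
  \<open>SupCat\<close> from the universal property of the tensor, and \<open>BackDiag Rel\<close>
  by transport.\<close>

locale semigroupal_category = category C
  for C :: "('o, 'm, 'z) cat_scheme" (structure) +
  fixes T :: "('o, 'm) tensor"
  assumes tobj_Obj [simp]: "\<lbrakk>A \<in> Obj C; B \<in> Obj C\<rbrakk> \<Longrightarrow> A \<boxtimes>\<^bsub>T\<^esub> B \<in> Obj C"
    and tarr_Arr [simp]: "\<lbrakk>f \<in> Arr C; g \<in> Arr C\<rbrakk> \<Longrightarrow> f \<otimes>\<^bsub>T\<^esub> g \<in> Arr C"
    and tarr_Dom [simp]: "\<lbrakk>f \<in> Arr C; g \<in> Arr C\<rbrakk> \<Longrightarrow> Dom C (f \<otimes>\<^bsub>T\<^esub> g) = Dom C f \<boxtimes>\<^bsub>T\<^esub> Dom C g"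
    and tarr_Cod [simp]: "\<lbrakk>f \<in> Arr C; g \<in> Arr C\<rbrakk> \<Longrightarrow> Cod C (f \<otimes>\<^bsub>T\<^esub> g) = Cod C f \<boxtimes>\<^bsub>T\<^esub> Cod C g"
    and tarr_Idn' [simp]: "\<lbrakk>A \<in> Obj C; B \<in> Obj C\<rbrakk>
          \<Longrightarrow> Idn C A \<otimes>\<^bsub>T\<^esub> Idn C B = Idn C (A \<boxtimes>\<^bsub>T\<^esub> B)"
    and tarr_Cmp': "\<lbrakk>f \<in> Arr C; f' \<in> Arr C; g \<in> Arr C; g' \<in> Arr C;
            Dom C f' = Cod C f; Dom C g' = Cod C g\<rbrakk>
          \<Longrightarrow> (f' \<cdot> f) \<otimes>\<^bsub>T\<^esub> (g' \<cdot> g) = (f' \<otimes>\<^bsub>T\<^esub> g') \<cdot> (f \<otimes>\<^bsub>T\<^esub> g)"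
    and assoc_Arr [simp]: "\<lbrakk>A \<in> Obj C; B \<in> Obj C; D \<in> Obj C\<rbrakk> \<Longrightarrow> assoc T A B D \<in> Arr C"
    and assoc_Dom [simp]: "\<lbrakk>A \<in> Obj C; B \<in> Obj C; D \<in> Obj C\<rbrakk>
          \<Longrightarrow> Dom C (assoc T A B D) = (A \<boxtimes>\<^bsub>T\<^esub> B) \<boxtimes>\<^bsub>T\<^esub> D"
    and assoc_Cod [simp]: "\<lbrakk>A \<in> Obj C; B \<in> Obj C; D \<in> Obj C\<rbrakk>
          \<Longrightarrow> Cod C (assoc T A B D) = A \<boxtimes>\<^bsub>T\<^esub> (B \<boxtimes>\<^bsub>T\<^esub> D)"
    and assoc_nat: "\<lbrakk>f \<in> Arr C; g \<in> Arr C; h \<in> Arr C\<rbrakk>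
          \<Longrightarrow> assoc T (Cod C f) (Cod C g) (Cod C h) \<cdot> ((f \<otimes>\<^bsub>T\<^esub> g) \<otimes>\<^bsub>T\<^esub> h)
            = (f \<otimes>\<^bsub>T\<^esub> (g \<otimes>\<^bsub>T\<^esub> h)) \<cdot> assoc T (Dom C f) (Dom C g) (Dom C h)"

lemma (in monoidal_category) semigroupal: "semigroupal_category C T"
proof (unfold_locales)
  fix f g assume *: "f \<in> Arr C" "g \<in> Arr C"
  then have "f \<otimes>\<^bsub>T\<^esub> g \<in> Hom C (Dom C f \<boxtimes>\<^bsub>T\<^esub> Dom C g) (Cod C f \<boxtimes>\<^bsub>T\<^esub> Cod C g)"
    by (intro tarr_in HomI) auto
  then show "f \<otimes>\<^bsub>T\<^esub> g \<in> Arr C" "Dom C (f \<otimes>\<^bsub>T\<^esub> g) = Dom C f \<boxtimes>\<^bsub>T\<^esub> Dom C g"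
    "Cod C (f \<otimes>\<^bsub>T\<^esub> g) = Cod C f \<boxtimes>\<^bsub>T\<^esub> Cod C g" by (auto dest: HomD)
next
  fix f f' g g' assume "f \<in> Arr C" "f' \<in> Arr C" "g \<in> Arr C" "g' \<in> Arr C"
    "Dom C f' = Cod C f" "Dom C g' = Cod C g"
  then show "(f' \<cdot> f) \<otimes>\<^bsub>T\<^esub> (g' \<cdot> g) = (f' \<otimes>\<^bsub>T\<^esub> g') \<cdot> (f \<otimes>\<^bsub>T\<^esub> g)"
    by (intro tarr_Cmp HomI) auto
next
  fix A B D assume "A \<in> Obj C" "B \<in> Obj C" "D \<in> Obj C"
  from HomD[OF assoc_in[OF this]]
  show "assoc T A B D \<in> Arr C" "Dom C (assoc T A B D) = (A \<boxtimes>\<^bsub>T\<^esub> B) \<boxtimes>\<^bsub>T\<^esub> D"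
    "Cod C (assoc T A B D) = A \<boxtimes>\<^bsub>T\<^esub> (B \<boxtimes>\<^bsub>T\<^esub> D)" by auto
next
  fix f g h assume "f \<in> Arr C" "g \<in> Arr C" "h \<in> Arr C"
  then show "assoc T (Cod C f) (Cod C g) (Cod C h) \<cdot> ((f \<otimes>\<^bsub>T\<^esub> g) \<otimes>\<^bsub>T\<^esub> h)
    = (f \<otimes>\<^bsub>T\<^esub> (g \<otimes>\<^bsub>T\<^esub> h)) \<cdot> assoc T (Dom C f) (Dom C g) (Dom C h)"
    by (intro assoc_natural HomI) auto
qed (auto simp: tobj_in tarr_Idn)

definition semigroup_hom ::
  "('o, 'm, 'z) cat_scheme \<Rightarrow> ('o, 'm) tensor \<Rightarrow> 'o \<times> 'm \<Rightarrow> 'o \<times> 'm \<Rightarrow> 'm \<Rightarrow> bool" where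
  "semigroup_hom C T X Y f \<longleftrightarrow> f \<in> Arr C \<and> Dom C f = fst X \<and> Cod C f = fst Y \<and>
     f \<cdot>\<^bsub>C\<^esub> snd X = snd Y \<cdot>\<^bsub>C\<^esub> (f \<otimes>\<^bsub>T\<^esub> f)"

lemma SGrp_Obj [simp]: "X \<in> Obj (SGrp C T) \<longleftrightarrow> semigroup_object C T X"
  by (simp add: SGrp_def)

lemma SGrp_Arr: "F \<in> Arr (SGrp C T) \<longleftrightarrow> semigroup_object C T (adom F) \<and>
    semigroup_object C T (acod F) \<and> semigroup_hom C T (adom F) (acod F) (adat F)"
  by (cases F) (auto simp: SGrp_def semigroup_hom_def Hom_def)

lemma SGrp_simps [simp]:
  "Dom (SGrp C T) = adom" "Cod (SGrp C T) = acod"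
  "Idn (SGrp C T) X = \<lparr>adom = X, acod = X, adat = Idn C (fst X)\<rparr>"
  "Cmp (SGrp C T) G F = \<lparr>adom = adom F, acod = acod G, adat = adat G \<cdot>\<^bsub>C\<^esub> adat F\<rparr>"
  by (simp_all add: SGrp_def)

lemma arrow_eqI:
  fixes f g :: "('a, 'b) arrow"
  assumes "adom f = adom g" "acod f = acod g" "adat f = adat g"
  shows "f = g"
  using assms by simp

context semigroupal_category
begin

lemma semigroup_objectI:
  assumes "A \<in> Obj C" "m \<in> Arr C" "Dom C m = A \<boxtimes>\<^bsub>T\<^esub> A" "Cod C m = A"
    and "m \<cdot> (m \<otimes>\<^bsub>T\<^esub> Idn C A) = m \<cdot> (Idn C A \<otimes>\<^bsub>T\<^esub> m) \<cdot> assoc T A A A"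
  shows "semigroup_object C T (A, m)"
  using assms by (simp add: semigroup_object_def Hom_def Let_def)

lemma semigroup_objectD:
  assumes "semigroup_object C T X"
  shows "fst X \<in> Obj C" "snd X \<in> Arr C" "Dom C (snd X) = fst X \<boxtimes>\<^bsub>T\<^esub> fst X"
    "Cod C (snd X) = fst X"
    "snd X \<cdot> (snd X \<otimes>\<^bsub>T\<^esub> Idn C (fst X))
       = snd X \<cdot> (Idn C (fst X) \<otimes>\<^bsub>T\<^esub> snd X) \<cdot> assoc T (fst X) (fst X) (fst X)"
  using assms by (auto simp: semigroup_object_def Hom_def Let_def)

lemma semigroup_hom_Idn:
  assumes "semigroup_object C T X"
  shows "semigroup_hom C T X X (Idn C (fst X))"
  using semigroup_objectD[OF assms] by (simp add: semigroup_hom_def)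

lemma semigroup_hom_Cmp:
  assumes X: "semigroup_object C T X" and Y: "semigroup_object C T Y"
    and Z: "semigroup_object C T Z"
    and f: "semigroup_hom C T X Y f" and g: "semigroup_hom C T Y Z g"
  shows "semigroup_hom C T X Z (g \<cdot> f)"
proof -
  note X = semigroup_objectD(1-4)[OF X] and Y = semigroup_objectD(1-4)[OF Y]
    and Z = semigroup_objectD(1-4)[OF Z]
  have f: "f \<in> Arr C" "Dom C f = fst X" "Cod C f = fst Y" "f \<cdot> snd X = snd Y \<cdot> (f \<otimes>\<^bsub>T\<^esub> f)"
    and g: "g \<in> Arr C" "Dom C g = fst Y" "Cod C g = fst Z" "g \<cdot> snd Y = snd Z \<cdot> (g \<otimes>\<^bsub>T\<^esub> g)"
    using f g by (auto simp: semigroup_hom_def)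
  have "(g \<cdot> f) \<cdot> snd X = (g \<cdot> snd Y) \<cdot> (f \<otimes>\<^bsub>T\<^esub> f)"
    using X Y f(1-3) g(1-3) by (simp add: f(4))
  also have "\<dots> = snd Z \<cdot> ((g \<cdot> f) \<otimes>\<^bsub>T\<^esub> (g \<cdot> f))"
    unfolding g(4) using X Y Z f(1-3) g(1-3) by (simp add: tarr_Cmp')
  finally show ?thesis
    unfolding semigroup_hom_def using f(1-3) g(1-3) by simp
qed

lemma category_SGrp: "category (SGrp C T)"
proof
  fix X assume "X \<in> Obj (SGrp C T)"
  then show "Idn (SGrp C T) X \<in> Hom (SGrp C T) X X"
    by (simp add: Hom_def SGrp_Arr semigroup_hom_Idn)
next
  fix f g X Y Z assume "f \<in> Hom (SGrp C T) X Y" "g \<in> Hom (SGrp C T) Y Z"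
  then show "g \<cdot>\<^bsub>SGrp C T\<^esub> f \<in> Hom (SGrp C T) X Z"
    by (auto simp: Hom_def SGrp_Arr intro: semigroup_hom_Cmp)
qed (auto simp: Hom_def SGrp_Arr semigroup_hom_def intro!: arrow_eqI)

text \<open>The inverse \<open>g\<close> respects the multiplications automatically: insert
  \<open>(f \<otimes> f) \<cdot> (g \<otimes> g)\<close>, which is an identity, after the
  multiplication of \<open>Y\<close>, use the equation for \<open>f\<close>, and cancel
  \<open>g \<cdot> f\<close>.\<close>

lemma inverse_arrows_SGrp:
  assumes X: "semigroup_object C T X" and Y: "semigroup_object C T Y"
    and f: "semigroup_hom C T X Y f" and fg: "inverse_arrows f g"
  shows "is_iso (SGrp C T) \<lparr>adom = X, acod = Y, adat = f\<rparr>"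
proof -
  interpret S: category "SGrp C T" by (rule category_SGrp)
  note X' = semigroup_objectD(1-4)[OF X] and Y' = semigroup_objectD(1-4)[OF Y]
    and fg' = inverse_arrowsD(1-4)[OF fg]
  have f': "Dom C f = fst X" "Cod C f = fst Y" "f \<cdot> snd X = snd Y \<cdot> (f \<otimes>\<^bsub>T\<^esub> f)"
    using f by (auto simp: semigroup_hom_def)
  have "g \<cdot> snd Y = g \<cdot> (snd Y \<cdot> (f \<otimes>\<^bsub>T\<^esub> f)) \<cdot> (g \<otimes>\<^bsub>T\<^esub> g)"
    using X' Y' fg fg' f'(1,2) by (simp add: tarr_Cmp'[symmetric])
  also have "\<dots> = snd X \<cdot> (g \<otimes>\<^bsub>T\<^esub> g)"
    unfolding f'(3)[symmetric] using X' Y' fg fg' f'(1,2) by simp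
  finally have g: "semigroup_hom C T Y X g"
    unfolding semigroup_hom_def using fg' f' by simp
  have "S.inverse_arrows \<lparr>adom = X, acod = Y, adat = f\<rparr> \<lparr>adom = Y, acod = X, adat = g\<rparr>"
    unfolding S.inverse_arrows_def using X Y f g fg fg' f' by (simp add: SGrp_Arr)
  then show ?thesis unfolding S.is_iso_iff_inverse by blast
qed

end

section \<open>Transport of semigroup objects along strong monoidal functors\<close>

definition SGrp_fctr ::
  "('p, 'n, 'z) cat_scheme \<Rightarrow> ('o, 'm, 'p, 'n) fctr \<Rightarrow> ('o \<Rightarrow> 'o \<Rightarrow> 'n) \<Rightarrow>
   ('o \<times> 'm, ('o \<times> 'm, 'm) arrow, 'p \<times> 'n, ('p \<times> 'n, 'n) arrow) fctr" where
  "SGrp_fctr D F \<phi> =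
    (let ob = \<lambda>X. (on_obj F (fst X), on_arr F (snd X) \<cdot>\<^bsub>D\<^esub> \<phi> (fst X) (fst X))
     in \<lparr>on_obj = ob,
         on_arr = \<lambda>f. \<lparr>adom = ob (adom f), acod = ob (acod f), adat = on_arr F (adat f)\<rparr>\<rparr>)"

lemma SGrp_fctr_simps [simp]:
  "on_obj (SGrp_fctr D F \<phi>) X = (on_obj F (fst X), on_arr F (snd X) \<cdot>\<^bsub>D\<^esub> \<phi> (fst X) (fst X))"
  "on_arr (SGrp_fctr D F \<phi>) f = \<lparr>adom = on_obj (SGrp_fctr D F \<phi>) (adom f),
     acod = on_obj (SGrp_fctr D F \<phi>) (acod f), adat = on_arr F (adat f)\<rparr>"
  by (simp_all add: SGrp_fctr_def)

locale strong_semigroupal_functor = C: semigroupal_category C S + D: semigroupal_category D T +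
    cat_functor C D F
  for C :: "('o, 'm, 'y) cat_scheme" and S :: "('o, 'm) tensor"
    and D :: "('p, 'n, 'z) cat_scheme" and T :: "('p, 'n) tensor"
    and F :: "('o, 'm, 'p, 'n) fctr" +
  fixes \<phi> :: "'o \<Rightarrow> 'o \<Rightarrow> 'n"
  assumes phi_arr [simp]:
      "\<lbrakk>A \<in> Obj C; B \<in> Obj C\<rbrakk> \<Longrightarrow> \<phi> A B \<in> Arr D"
      "\<lbrakk>A \<in> Obj C; B \<in> Obj C\<rbrakk> \<Longrightarrow> Dom D (\<phi> A B) = on_obj F A \<boxtimes>\<^bsub>T\<^esub> on_obj F B"
      "\<lbrakk>A \<in> Obj C; B \<in> Obj C\<rbrakk> \<Longrightarrow> Cod D (\<phi> A B) = on_obj F (A \<boxtimes>\<^bsub>S\<^esub> B)"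
    and phi_iso: "\<lbrakk>A \<in> Obj C; B \<in> Obj C\<rbrakk> \<Longrightarrow> is_iso D (\<phi> A B)"
    and phi_nat: "\<lbrakk>f \<in> Arr C; g \<in> Arr C\<rbrakk>
          \<Longrightarrow> \<phi> (Cod C f) (Cod C g) \<cdot>\<^bsub>D\<^esub> (on_arr F f \<otimes>\<^bsub>T\<^esub> on_arr F g)
            = on_arr F (f \<otimes>\<^bsub>S\<^esub> g) \<cdot>\<^bsub>D\<^esub> \<phi> (Dom C f) (Dom C g)"
    and phi_assoc: "\<lbrakk>A \<in> Obj C; B \<in> Obj C; E \<in> Obj C\<rbrakk>
          \<Longrightarrow> on_arr F (assoc S A B E) \<cdot>\<^bsub>D\<^esub> \<phi> (A \<boxtimes>\<^bsub>S\<^esub> B) E \<cdot>\<^bsub>D\<^esub> (\<phi> A B \<otimes>\<^bsub>T\<^esub> Idn D (on_obj F E))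
            = \<phi> A (B \<boxtimes>\<^bsub>S\<^esub> E) \<cdot>\<^bsub>D\<^esub> (Idn D (on_obj F A) \<otimes>\<^bsub>T\<^esub> \<phi> B E)
                \<cdot>\<^bsub>D\<^esub> assoc T (on_obj F A) (on_obj F B) (on_obj F E)"
begin

definition transported_mul :: "'o \<Rightarrow> 'm \<Rightarrow> 'n" where
  "transported_mul A m = on_arr F m \<cdot>\<^bsub>D\<^esub> \<phi> A A"

text \<open>Naturality of \<open>\<phi>\<close> with a trailing arrow \<open>k\<close>, the shape in
  which it occurs inside composites normalised to the right.\<close>

lemma phi_nat_Cmp:
  assumes "f \<in> Arr C" "g \<in> Arr C" "k \<in> Arr D" "Cod D k = on_obj F (Dom C f) \<boxtimes>\<^bsub>T\<^esub> on_obj F (Dom C g)"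
    and "Cod C f = A" "Cod C g = B"
  shows "\<phi> A B \<cdot>\<^bsub>D\<^esub> (on_arr F f \<otimes>\<^bsub>T\<^esub> on_arr F g) \<cdot>\<^bsub>D\<^esub> k
      = on_arr F (f \<otimes>\<^bsub>S\<^esub> g) \<cdot>\<^bsub>D\<^esub> \<phi> (Dom C f) (Dom C g) \<cdot>\<^bsub>D\<^esub> k"
proof -
  have "(\<phi> A B \<cdot>\<^bsub>D\<^esub> (on_arr F f \<otimes>\<^bsub>T\<^esub> on_arr F g)) \<cdot>\<^bsub>D\<^esub> k
      = (on_arr F (f \<otimes>\<^bsub>S\<^esub> g) \<cdot>\<^bsub>D\<^esub> \<phi> (Dom C f) (Dom C g)) \<cdot>\<^bsub>D\<^esub> k"
    using phi_nat[of f g] assms by simp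
  moreover have "A \<in> Obj C" "B \<in> Obj C" using assms by auto
  ultimately show ?thesis using assms by simp
qed

text \<open>The two sides of the associativity law for the transported multiplication are the
  \<open>F\<close>-images of the two sides for \<open>m\<close>, followed by the same isomorphism
  \<open>p\<close>. So the law is preserved by transport, and for faithful \<open>F\<close> it is
  also reflected, by cancelling \<open>p\<close>. Naturality of \<open>\<phi>\<close> moves
  \<open>F\<close> outwards, and its coherence with the associators treats the second side.\<close>

lemma transported_assoc:
  assumes A: "A \<in> Obj C" and m: "m \<in> Arr C" "Dom C m = A \<boxtimes>\<^bsub>S\<^esub> A" "Cod C m = A"
  defines "n \<equiv> transported_mul A m" and "I \<equiv> Idn D (on_obj F A)"
  defines "p \<equiv> \<phi> (A \<boxtimes>\<^bsub>S\<^esub> A) A \<cdot>\<^bsub>D\<^esub> (\<phi> A A \<otimes>\<^bsub>T\<^esub> I)"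
  shows "n \<cdot>\<^bsub>D\<^esub> (n \<otimes>\<^bsub>T\<^esub> I) = on_arr F (m \<cdot>\<^bsub>C\<^esub> (m \<otimes>\<^bsub>S\<^esub> Idn C A)) \<cdot>\<^bsub>D\<^esub> p"
    and "n \<cdot>\<^bsub>D\<^esub> (I \<otimes>\<^bsub>T\<^esub> n) \<cdot>\<^bsub>D\<^esub> assoc T (on_obj F A) (on_obj F A) (on_obj F A)
       = on_arr F (m \<cdot>\<^bsub>C\<^esub> (Idn C A \<otimes>\<^bsub>S\<^esub> m) \<cdot>\<^bsub>C\<^esub> assoc S A A A) \<cdot>\<^bsub>D\<^esub> p"
    and "is_iso D p" "p \<in> Arr D" "Cod D p = on_obj F ((A \<boxtimes>\<^bsub>S\<^esub> A) \<boxtimes>\<^bsub>S\<^esub> A)"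
proof -
  have n: "n \<otimes>\<^bsub>T\<^esub> I = (on_arr F m \<otimes>\<^bsub>T\<^esub> I) \<cdot>\<^bsub>D\<^esub> (\<phi> A A \<otimes>\<^bsub>T\<^esub> I)"
    "I \<otimes>\<^bsub>T\<^esub> n = (I \<otimes>\<^bsub>T\<^esub> on_arr F m) \<cdot>\<^bsub>D\<^esub> (I \<otimes>\<^bsub>T\<^esub> \<phi> A A)"
    using D.tarr_Cmp'[of "\<phi> A A" "on_arr F m" I I] D.tarr_Cmp'[of I I "\<phi> A A" "on_arr F m"] A m
    by (simp_all add: n_def transported_mul_def I_def)
  show "n \<cdot>\<^bsub>D\<^esub> (n \<otimes>\<^bsub>T\<^esub> I) = on_arr F (m \<cdot>\<^bsub>C\<^esub> (m \<otimes>\<^bsub>S\<^esub> Idn C A)) \<cdot>\<^bsub>D\<^esub> p"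
    using phi_nat_Cmp[of m "Idn C A" "\<phi> A A \<otimes>\<^bsub>T\<^esub> I" A A] A m
    unfolding n unfolding n_def transported_mul_def p_def by (simp add: I_def)
  show "n \<cdot>\<^bsub>D\<^esub> (I \<otimes>\<^bsub>T\<^esub> n) \<cdot>\<^bsub>D\<^esub> assoc T (on_obj F A) (on_obj F A) (on_obj F A)
       = on_arr F (m \<cdot>\<^bsub>C\<^esub> (Idn C A \<otimes>\<^bsub>S\<^esub> m) \<cdot>\<^bsub>C\<^esub> assoc S A A A) \<cdot>\<^bsub>D\<^esub> p"
    using phi_nat_Cmp[of "Idn C A" m "(I \<otimes>\<^bsub>T\<^esub> \<phi> A A) \<cdot>\<^bsub>D\<^esub> assoc T (on_obj F A) (on_obj F A) (on_obj F A)" A A]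
      phi_assoc[OF A A A] A m
    unfolding n unfolding n_def transported_mul_def p_def by (simp add: I_def)
  obtain p1 p2 where p12: "D.inverse_arrows (\<phi> (A \<boxtimes>\<^bsub>S\<^esub> A) A) p1" "D.inverse_arrows (\<phi> A A) p2"
    using phi_iso A D.is_iso_iff_inverse by (meson C.tobj_Obj)
  have "D.inverse_arrows (\<phi> A A \<otimes>\<^bsub>T\<^esub> I) (p2 \<otimes>\<^bsub>T\<^esub> I)"
    unfolding D.inverse_arrows_def
    using D.inverse_arrowsD(1-4)[OF p12(2)] p12(2) A
    by (simp add: I_def D.tarr_Cmp'[symmetric])
  then have "D.inverse_arrows p ((p2 \<otimes>\<^bsub>T\<^esub> I) \<cdot>\<^bsub>D\<^esub> p1)"
    unfolding p_def by (rule D.inverse_arrows_Cmp) (use p12 A in \<open>simp_all add: I_def\<close>)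
  then show "is_iso D p" using D.is_iso_iff_inverse by blast
  show "p \<in> Arr D" "Cod D p = on_obj F ((A \<boxtimes>\<^bsub>S\<^esub> A) \<boxtimes>\<^bsub>S\<^esub> A)"
    using A by (simp_all add: p_def I_def)
qed

lemma transported_semigroup_object:
  assumes "semigroup_object C S (A, m)"
  shows "semigroup_object D T (on_obj F A, transported_mul A m)"
proof -
  note m = C.semigroup_objectD[OF assms, unfolded fst_conv snd_conv]
  show ?thesis
  proof (rule D.semigroup_objectI)
    show "transported_mul A m \<cdot>\<^bsub>D\<^esub> (transported_mul A m \<otimes>\<^bsub>T\<^esub> Idn D (on_obj F A))
      = transported_mul A m \<cdot>\<^bsub>D\<^esub> (Idn D (on_obj F A) \<otimes>\<^bsub>T\<^esub> transported_mul A m) \<cdot>\<^bsub>D\<^esub>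
          assoc T (on_obj F A) (on_obj F A) (on_obj F A)"
      unfolding transported_assoc(1)[OF m(1-4)] transported_assoc(2)[OF m(1-4)] m(5) ..
  qed (use m in \<open>simp_all add: transported_mul_def\<close>)
qed

text \<open>Both sides of the homomorphism equation are again \<open>F\<close>-images followed by
  one isomorphism, here \<open>\<phi> A A\<close>, so the equation can be carried in either
  direction.\<close>

lemma transported_semigroup_hom:
  assumes A: "semigroup_object C S (A, m)" and B: "semigroup_object C S (B, n)"
    and f: "f \<in> Arr C" "Dom C f = A" "Cod C f = B"
  shows "on_arr F f \<cdot>\<^bsub>D\<^esub> transported_mul A m = on_arr F (f \<cdot>\<^bsub>C\<^esub> m) \<cdot>\<^bsub>D\<^esub> \<phi> A A"
    and "transported_mul B n \<cdot>\<^bsub>D\<^esub> (on_arr F f \<otimes>\<^bsub>T\<^esub> on_arr F f)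
       = on_arr F (n \<cdot>\<^bsub>C\<^esub> (f \<otimes>\<^bsub>S\<^esub> f)) \<cdot>\<^bsub>D\<^esub> \<phi> A A"
  using C.semigroup_objectD(1-4)[OF A] C.semigroup_objectD(1-4)[OF B] f phi_nat[of f f]
  by (simp_all add: transported_mul_def)

lemma SGrp_fctr_functor: "cat_functor (SGrp C S) (SGrp D T) (SGrp_fctr D F \<phi>)"
proof (rule cat_functorI)
  show "category (SGrp C S)" by (rule C.category_SGrp)
  show "category (SGrp D T)" by (rule D.category_SGrp)
next
  fix X assume "X \<in> Obj (SGrp C S)"
  then show "on_obj (SGrp_fctr D F \<phi>) X \<in> Obj (SGrp D T)"
    "on_arr (SGrp_fctr D F \<phi>) (Idn (SGrp C S) X) = Idn (SGrp D T) (on_obj (SGrp_fctr D F \<phi>) X)"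
    using transported_semigroup_object[of "fst X" "snd X"] C.semigroup_objectD(1)[of X]
    by (simp_all add: transported_mul_def)
next
  fix f assume f: "f \<in> Arr (SGrp C S)"
  then show "on_arr (SGrp_fctr D F \<phi>) f \<in> Arr (SGrp D T)"
    using transported_semigroup_object[of "fst (adom f)" "snd (adom f)"]
      transported_semigroup_object[of "fst (acod f)" "snd (acod f)"]
      transported_semigroup_hom[of "fst (adom f)" "snd (adom f)" "fst (acod f)" "snd (acod f)" "adat f"]
    by (simp add: SGrp_Arr semigroup_hom_def transported_mul_def)
next
  fix f g assume "f \<in> Arr (SGrp C S)" "g \<in> Arr (SGrp C S)" "Dom (SGrp C S) g = Cod (SGrp C S) f"
  then show "on_arr (SGrp_fctr D F \<phi>) (g \<cdot>\<^bsub>SGrp C S\<^esub> f)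
      = on_arr (SGrp_fctr D F \<phi>) g \<cdot>\<^bsub>SGrp D T\<^esub> on_arr (SGrp_fctr D F \<phi>) f"
    by (simp add: SGrp_Arr semigroup_hom_def)
qed simp_all

text \<open>Fullness: the preimage under \<open>F\<close> of the underlying arrow is a homomorphism
  once \<open>\<phi>\<close> is cancelled and faithfulness is applied. Essential surjectivity: the
  multiplication of the given object is pulled back along an isomorphism from an object in the image
  of \<open>F\<close>, and then lifted to \<open>C\<close>.\<close>

lemma SGrp_fctr_weak_equivalence:
  assumes W: "weak_equivalence C D F"
  shows "weak_equivalence (SGrp C S) (SGrp D T) (SGrp_fctr D F \<phi>)"
proof -
  note faithful = weak_equivalence_faithful[OF W] and full = weak_equivalence_full[OF W]
    and eso = weak_equivalence_eso[OF W]
  show ?thesis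
    unfolding weak_equivalence_def
  proof (intro conjI ballI impI SGrp_fctr_functor)
    fix f g assume "f \<in> Arr (SGrp C S)" "g \<in> Arr (SGrp C S)"
      "Dom (SGrp C S) f = Dom (SGrp C S) g" "Cod (SGrp C S) f = Cod (SGrp C S) g"
      "on_arr (SGrp_fctr D F \<phi>) f = on_arr (SGrp_fctr D F \<phi>) g"
    then show "f = g"
      by (intro arrow_eqI faithful) (auto simp: SGrp_Arr semigroup_hom_def)
  next
    fix X Y h assume X: "X \<in> Obj (SGrp C S)" and Y: "Y \<in> Obj (SGrp C S)"
      and h: "h \<in> Hom (SGrp D T) (on_obj (SGrp_fctr D F \<phi>) X) (on_obj (SGrp_fctr D F \<phi>) Y)"
    obtain A m B n where XY: "X = (A, m)" "Y = (B, n)" by fastforce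
    have A: "semigroup_object C S (A, m)" and B: "semigroup_object C S (B, n)" using X Y XY by auto
    note A' = C.semigroup_objectD(1-4)[OF A, unfolded fst_conv snd_conv]
      and B' = C.semigroup_objectD(1-4)[OF B, unfolded fst_conv snd_conv]
    have h: "h \<in> Arr (SGrp D T)" "adom h = (on_obj F A, transported_mul A m)"
        "acod h = (on_obj F B, transported_mul B n)"
      using h XY by (auto simp: Hom_def transported_mul_def)
    have hd: "adat h \<in> Arr D" "Dom D (adat h) = on_obj F A" "Cod D (adat h) = on_obj F B"
      "adat h \<cdot>\<^bsub>D\<^esub> transported_mul A m = transported_mul B n \<cdot>\<^bsub>D\<^esub> (adat h \<otimes>\<^bsub>T\<^esub> adat h)"
      using h(1) by (auto simp: SGrp_Arr h semigroup_hom_def)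
    obtain f where f: "f \<in> Arr C" "Dom C f = A" "Cod C f = B" "on_arr F f = adat h"
      using full[OF A'(1) B'(1) hd(1-3)] by blast
    have "on_arr F (f \<cdot>\<^bsub>C\<^esub> m) \<cdot>\<^bsub>D\<^esub> \<phi> A A = on_arr F (n \<cdot>\<^bsub>C\<^esub> (f \<otimes>\<^bsub>S\<^esub> f)) \<cdot>\<^bsub>D\<^esub> \<phi> A A"
      using transported_semigroup_hom[OF A B f(1-3)] hd(4) f(4) by simp
    then have "on_arr F (f \<cdot>\<^bsub>C\<^esub> m) = on_arr F (n \<cdot>\<^bsub>C\<^esub> (f \<otimes>\<^bsub>S\<^esub> f))"
      by (rule D.is_iso_cancel_right[OF phi_iso, rotated -1]) (use A' B' f(1-3) in simp_all)
    then have "f \<cdot>\<^bsub>C\<^esub> m = n \<cdot>\<^bsub>C\<^esub> (f \<otimes>\<^bsub>S\<^esub> f)"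
      by (rule faithful[rotated -1]) (use A' B' f(1-3) in simp_all)
    then have "\<lparr>adom = X, acod = Y, adat = f\<rparr> \<in> Hom (SGrp C S) X Y"
      using A B f XY by (simp add: Hom_def SGrp_Arr semigroup_hom_def)
    moreover have "on_arr (SGrp_fctr D F \<phi>) \<lparr>adom = X, acod = Y, adat = f\<rparr> = h"
      by (rule arrow_eqI) (use h f XY in \<open>simp_all add: transported_mul_def\<close>)
    ultimately show "\<exists>f \<in> Hom (SGrp C S) X Y. on_arr (SGrp_fctr D F \<phi>) f = h" by blast
  next
    fix Y assume Y: "Y \<in> Obj (SGrp D T)"
    obtain B n where Yeq: "Y = (B, n)" by fastforce
    have sB: "semigroup_object D T (B, n)" using Y Yeq by auto
    note B = D.semigroup_objectD[OF sB, unfolded fst_conv snd_conv]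
    obtain A e where A: "A \<in> Obj C" and e: "e \<in> Arr D" "Dom D e = on_obj F A" "Cod D e = B"
      and "is_iso D e" using eso[OF B(1)] by blast
    then obtain e' where ee': "D.inverse_arrows e e'" using D.is_iso_iff_inverse by blast
    have e': "e' \<in> Arr D" "Dom D e' = B" "Cod D e' = on_obj F A"
      using D.inverse_arrowsD[OF ee'] e by simp_all
    obtain q where q: "D.inverse_arrows (\<phi> A A) q" using phi_iso A D.is_iso_iff_inverse by blast
    have q': "q \<in> Arr D" "Dom D q = on_obj F (A \<boxtimes>\<^bsub>S\<^esub> A)" "Cod D q = on_obj F A \<boxtimes>\<^bsub>T\<^esub> on_obj F A"
      using D.inverse_arrowsD[OF q] A by simp_all
    \<comment> \<open>The multiplication of \<open>B\<close> conjugated by \<open>e\<close>: the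
      only one on \<open>F A\<close> for which \<open>e\<close> is a homomorphism to
      \<open>B\<close>.\<close>
    define n' where "n' = e' \<cdot>\<^bsub>D\<^esub> n \<cdot>\<^bsub>D\<^esub> (e \<otimes>\<^bsub>T\<^esub> e)"
    have n': "n' \<in> Arr D" "Dom D n' = on_obj F A \<boxtimes>\<^bsub>T\<^esub> on_obj F A" "Cod D n' = on_obj F A"
      unfolding n'_def using B e e' by simp_all
    \<comment> \<open>Composing with the inverse of \<open>\<phi> A A\<close> before lifting makes
      the transported multiplication of \<open>m\<close> equal to \<open>n'\<close> itself.\<close>
    obtain m where m: "m \<in> Arr C" "Dom C m = A \<boxtimes>\<^bsub>S\<^esub> A" "Cod C m = A" "on_arr F m = n' \<cdot>\<^bsub>D\<^esub> q"
      using full[of "A \<boxtimes>\<^bsub>S\<^esub> A" A "n' \<cdot>\<^bsub>D\<^esub> q"] A n' q' by auto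
    have mn: "transported_mul A m = n'"
      unfolding transported_mul_def m(4) using A n' q q' by simp
    let ?I = "Idn D (on_obj F A)"
    have en: "e \<cdot>\<^bsub>D\<^esub> n' = n \<cdot>\<^bsub>D\<^esub> (e \<otimes>\<^bsub>T\<^esub> e)"
      unfolding n'_def using B(1-4) e e' ee' by simp
    have enA: "e \<cdot>\<^bsub>D\<^esub> n' \<cdot>\<^bsub>D\<^esub> k = n \<cdot>\<^bsub>D\<^esub> (e \<otimes>\<^bsub>T\<^esub> e) \<cdot>\<^bsub>D\<^esub> k"
      if "k \<in> Arr D" "Cod D k = on_obj F A \<boxtimes>\<^bsub>T\<^esub> on_obj F A" for k
    proof -
      have "(e \<cdot>\<^bsub>D\<^esub> n') \<cdot>\<^bsub>D\<^esub> k = (n \<cdot>\<^bsub>D\<^esub> (e \<otimes>\<^bsub>T\<^esub> e)) \<cdot>\<^bsub>D\<^esub> k" unfolding en ..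
      then show ?thesis using that n' e B(1-4) by simp
    qed
    have eL: "(e \<otimes>\<^bsub>T\<^esub> e) \<cdot>\<^bsub>D\<^esub> (n' \<otimes>\<^bsub>T\<^esub> ?I) = (n \<otimes>\<^bsub>T\<^esub> Idn D B) \<cdot>\<^bsub>D\<^esub> ((e \<otimes>\<^bsub>T\<^esub> e) \<otimes>\<^bsub>T\<^esub> e)"
      using A B(1-4) e n' en by (simp add: D.tarr_Cmp'[symmetric])
    have eR: "(e \<otimes>\<^bsub>T\<^esub> e) \<cdot>\<^bsub>D\<^esub> (?I \<otimes>\<^bsub>T\<^esub> n') = (Idn D B \<otimes>\<^bsub>T\<^esub> n) \<cdot>\<^bsub>D\<^esub> (e \<otimes>\<^bsub>T\<^esub> (e \<otimes>\<^bsub>T\<^esub> e))"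
      using A B(1-4) e n' en by (simp add: D.tarr_Cmp'[symmetric])
    let ?a = "assoc T (on_obj F A) (on_obj F A) (on_obj F A)"
    \<comment> \<open>Associativity of \<open>n'\<close> is checked after composition with
      \<open>e\<close>. Pushing \<open>e\<close> to the right turns both copies of \<open>n'\<close>
      into copies of \<open>n\<close>; there the law for \<open>B\<close> and the naturality of the
      associator apply, and \<open>e\<close> is pulled back out.\<close>
    have "e \<cdot>\<^bsub>D\<^esub> (n' \<cdot>\<^bsub>D\<^esub> (n' \<otimes>\<^bsub>T\<^esub> ?I)) = n \<cdot>\<^bsub>D\<^esub> ((e \<otimes>\<^bsub>T\<^esub> e) \<cdot>\<^bsub>D\<^esub> (n' \<otimes>\<^bsub>T\<^esub> ?I))"
      using A n' enA by simp
    also have "\<dots> = (n \<cdot>\<^bsub>D\<^esub> (n \<otimes>\<^bsub>T\<^esub> Idn D B)) \<cdot>\<^bsub>D\<^esub> ((e \<otimes>\<^bsub>T\<^esub> e) \<otimes>\<^bsub>T\<^esub> e)"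
      unfolding eL using B(1-4) e by simp
    also have "\<dots> = n \<cdot>\<^bsub>D\<^esub> (Idn D B \<otimes>\<^bsub>T\<^esub> n) \<cdot>\<^bsub>D\<^esub> (assoc T B B B \<cdot>\<^bsub>D\<^esub> ((e \<otimes>\<^bsub>T\<^esub> e) \<otimes>\<^bsub>T\<^esub> e))"
      unfolding B(5) using B(1-4) e by simp
    also have "\<dots> = n \<cdot>\<^bsub>D\<^esub> ((Idn D B \<otimes>\<^bsub>T\<^esub> n) \<cdot>\<^bsub>D\<^esub> (e \<otimes>\<^bsub>T\<^esub> (e \<otimes>\<^bsub>T\<^esub> e))) \<cdot>\<^bsub>D\<^esub> ?a"
      using D.assoc_nat[of e e e] A B(1-4) e by simp
    also have "\<dots> = n \<cdot>\<^bsub>D\<^esub> (e \<otimes>\<^bsub>T\<^esub> e) \<cdot>\<^bsub>D\<^esub> (?I \<otimes>\<^bsub>T\<^esub> n') \<cdot>\<^bsub>D\<^esub> ?a"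
      unfolding eR[symmetric] using A n' B(1-4) e by simp
    also have "\<dots> = e \<cdot>\<^bsub>D\<^esub> (n' \<cdot>\<^bsub>D\<^esub> (?I \<otimes>\<^bsub>T\<^esub> n') \<cdot>\<^bsub>D\<^esub> ?a)"
      using A n' enA by simp
    finally have n'_assoc: "n' \<cdot>\<^bsub>D\<^esub> (n' \<otimes>\<^bsub>T\<^esub> ?I) = n' \<cdot>\<^bsub>D\<^esub> (?I \<otimes>\<^bsub>T\<^esub> n') \<cdot>\<^bsub>D\<^esub> ?a"
      by (rule D.is_iso_cancel_left[OF \<open>is_iso D e\<close>, rotated -1]) (use A n' e in simp_all)
    note ta = transported_assoc[OF A m(1-3), unfolded mn]
    \<comment> \<open>Associativity is reflected from \<open>n'\<close> to \<open>m\<close>: the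
      common isomorphism is cancelled, and faithfulness then removes \<open>F\<close>.\<close>
    have "on_arr F (m \<cdot>\<^bsub>C\<^esub> (m \<otimes>\<^bsub>S\<^esub> Idn C A)) = on_arr F (m \<cdot>\<^bsub>C\<^esub> (Idn C A \<otimes>\<^bsub>S\<^esub> m) \<cdot>\<^bsub>C\<^esub> assoc S A A A)"
    proof (rule D.is_iso_cancel_right[OF ta(3), rotated -1])
      show "on_arr F (m \<cdot>\<^bsub>C\<^esub> (m \<otimes>\<^bsub>S\<^esub> Idn C A)) \<cdot>\<^bsub>D\<^esub> (\<phi> (A \<boxtimes>\<^bsub>S\<^esub> A) A \<cdot>\<^bsub>D\<^esub> (\<phi> A A \<otimes>\<^bsub>T\<^esub> ?I))
          = on_arr F (m \<cdot>\<^bsub>C\<^esub> (Idn C A \<otimes>\<^bsub>S\<^esub> m) \<cdot>\<^bsub>C\<^esub> assoc S A A A) \<cdot>\<^bsub>D\<^esub>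
              (\<phi> (A \<boxtimes>\<^bsub>S\<^esub> A) A \<cdot>\<^bsub>D\<^esub> (\<phi> A A \<otimes>\<^bsub>T\<^esub> ?I))"
        unfolding ta(1)[symmetric] ta(2)[symmetric] by (rule n'_assoc)
    qed (use A m(1-3) in simp_all)
    then have "m \<cdot>\<^bsub>C\<^esub> (m \<otimes>\<^bsub>S\<^esub> Idn C A) = m \<cdot>\<^bsub>C\<^esub> (Idn C A \<otimes>\<^bsub>S\<^esub> m) \<cdot>\<^bsub>C\<^esub> assoc S A A A"
      by (rule faithful[rotated -1]) (use A m in simp_all)
    then have sA: "semigroup_object C S (A, m)" by (intro C.semigroup_objectI A m)
    have sF: "semigroup_object D T (on_obj F A, n')"
      using transported_semigroup_object[OF sA] mn by simp
    have "semigroup_hom D T (on_obj F A, n') (B, n) e"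
      using e en by (simp add: semigroup_hom_def)
    then have "is_iso (SGrp D T) \<lparr>adom = (on_obj F A, n'), acod = (B, n), adat = e\<rparr>"
      "\<lparr>adom = (on_obj F A, n'), acod = (B, n), adat = e\<rparr> \<in> Hom (SGrp D T) (on_obj F A, n') Y"
      using D.inverse_arrows_SGrp[OF sF sB _ ee'] sF sB Yeq by (simp_all add: Hom_def SGrp_Arr)
    moreover have "on_obj (SGrp_fctr D F \<phi>) (A, m) = (on_obj F A, n')"
      using mn by (simp add: transported_mul_def)
    ultimately show "\<exists>X \<in> Obj (SGrp C S). \<exists>e \<in> Hom (SGrp D T) (on_obj (SGrp_fctr D F \<phi>) X) Y. is_iso (SGrp D T) e"
      using sA by (metis SGrp_Obj)
  qed
qed

end

text \<open>The coherence of a strong monoidal functor with tensor and associator makes it a strong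
  semigroupal functor. The target is taken in semigroupal form, the one established for
  \<open>SupCat\<close>.\<close>

lemma strong_monoidal_equivalence_SGrp:
  assumes C: "monoidal_category C S" and D: "semigroupal_category D T"
    and F: "strong_monoidal_equivalence C S D T F \<phi> \<phi>0"
  shows "SGrp C S \<simeq> SGrp D T"
proof -
  interpret C: monoidal_category C S by (rule C)
  interpret C': semigroupal_category C S by (rule C.semigroupal)
  interpret D: semigroupal_category D T by (rule D)
  have F': "strong_monoidal_functor C S D T F \<phi> \<phi>0" and E: "equivalence_functor C D F"
    using F by (auto simp: strong_monoidal_equivalence_def)
  have "cat_functor C D F" using E by (simp add: equivalence_functor_def)
  then interpret F: cat_functor C D F .
  interpret strong_semigroupal_functor C S D T F \<phi>
    by unfold_locales (use F' in \<open>auto simp: strong_monoidal_functor_def Hom_def\<close>)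
  show ?thesis
    using SGrp_fctr_weak_equivalence equivalence_functor_imp_weak[OF E]
      weak_equivalence_imp_equivalent by blast
qed

section \<open>Complete lattices\<close>

lemma sup_in_carrier: "\<lbrakk>complete_lattice L; A \<subseteq> carrier L\<rbrakk> \<Longrightarrow> \<Squnion>\<^bsub>L\<^esub> A \<in> carrier L"
  by (rule weak_complete_lattice.sup_closed)
    (simp_all add: complete_lattice_def complete_lattice_axioms_def weak_complete_lattice_def
      weak_complete_lattice_axioms_def partial_order_def)

lemma sup_le_iff:
  assumes "complete_lattice L" "A \<subseteq> carrier L" "u \<in> carrier L"
  shows "\<Squnion>\<^bsub>L\<^esub> A \<sqsubseteq>\<^bsub>L\<^esub> u \<longleftrightarrow> (\<forall>a \<in> A. a \<sqsubseteq>\<^bsub>L\<^esub> u)"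
proof -
  interpret complete_lattice L by (rule assms)
  show ?thesis
  proof (intro iffI ballI)
    fix a assume "\<Squnion>\<^bsub>L\<^esub> A \<sqsubseteq>\<^bsub>L\<^esub> u" "a \<in> A"
    with assms(2,3) show "a \<sqsubseteq>\<^bsub>L\<^esub> u"
      by (intro le_trans[OF sup_upper[OF assms(2)], of a u]) auto
  qed (use assms sup_least in auto)
qed

text \<open>An element is determined by its upper bounds. Combined with \<open>sup_le_iff\<close>
  this turns an equation between suprema into an equivalence of inequalities against an arbitrary
  \<open>u\<close>, the pattern of most lattice proofs below.\<close>

lemma le_eqI:
  assumes "complete_lattice L" "a \<in> carrier L" "b \<in> carrier L"
    and "\<And>u. u \<in> carrier L \<Longrightarrow> a \<sqsubseteq>\<^bsub>L\<^esub> u \<longleftrightarrow> b \<sqsubseteq>\<^bsub>L\<^esub> u"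
  shows "a = b"
proof -
  interpret complete_lattice L by (rule assms)
  show ?thesis using assms(2-4) le_antisym le_refl by blast
qed

lemma sup_eqI:
  assumes "complete_lattice L" "A \<subseteq> carrier L" "s \<in> carrier L"
    and "\<And>u. u \<in> carrier L \<Longrightarrow> s \<sqsubseteq>\<^bsub>L\<^esub> u \<longleftrightarrow> (\<forall>a \<in> A. a \<sqsubseteq>\<^bsub>L\<^esub> u)"
  shows "\<Squnion>\<^bsub>L\<^esub> A = s"
  by (rule le_eqI[OF assms(1)]) (simp_all add: assms sup_in_carrier sup_le_iff)

text \<open>Suprema suffice, because the infimum of \<open>A\<close> is the supremum of its lower
  bounds. The supremum is requested in the form of an equivalence on upper bounds, which closure
  systems provide directly.\<close>

lemma complete_lattice_from_sups:
  fixes L (structure)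
  assumes eq: "eq L = (=)"
    and refl: "\<And>x. x \<in> carrier L \<Longrightarrow> x \<sqsubseteq> x"
    and antisym: "\<And>x y. \<lbrakk>x \<in> carrier L; y \<in> carrier L; x \<sqsubseteq> y; y \<sqsubseteq> x\<rbrakk> \<Longrightarrow> x = y"
    and trans: "\<And>x y z. \<lbrakk>x \<in> carrier L; y \<in> carrier L; z \<in> carrier L; x \<sqsubseteq> y; y \<sqsubseteq> z\<rbrakk> \<Longrightarrow> x \<sqsubseteq> z"
    and sups: "\<And>A. A \<subseteq> carrier L \<Longrightarrow> \<exists>s \<in> carrier L. \<forall>u \<in> carrier L. s \<sqsubseteq> u \<longleftrightarrow> (\<forall>a \<in> A. a \<sqsubseteq> u)"
  shows "complete_lattice L"
proof -
  interpret partial_order L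
    by unfold_locales (simp_all add: eq refl antisym, metis trans)
  show ?thesis
  proof (rule complete_latticeI)
    fix A assume A: "A \<subseteq> carrier L"
    obtain s where "s \<in> carrier L" "\<forall>u \<in> carrier L. s \<sqsubseteq> u \<longleftrightarrow> (\<forall>a \<in> A. a \<sqsubseteq> u)"
      using sups[OF A] by blast
    then have "least L s (Upper L A)" using A refl by (auto simp: least_def Upper_def)
    then show "\<exists>s. least L s (Upper L A)" ..
    obtain i where i: "i \<in> carrier L" "\<forall>u \<in> carrier L. i \<sqsubseteq> u \<longleftrightarrow> (\<forall>a \<in> Lower L A. a \<sqsubseteq> u)"
      using sups[of "Lower L A"] by auto
    then have "greatest L i (Lower L A)" using A refl by (auto simp: greatest_def Lower_def)
    then show "\<exists>i. greatest L i (Lower L A)" ..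
  qed
qed

lemma complete_lattice_leD:
  assumes "complete_lattice L"
  shows "x \<in> carrier L \<Longrightarrow> x \<sqsubseteq>\<^bsub>L\<^esub> x"
    and "\<lbrakk>x \<sqsubseteq>\<^bsub>L\<^esub> y; y \<sqsubseteq>\<^bsub>L\<^esub> x; x \<in> carrier L; y \<in> carrier L\<rbrakk> \<Longrightarrow> x = y"
    and "\<lbrakk>x \<sqsubseteq>\<^bsub>L\<^esub> y; y \<sqsubseteq>\<^bsub>L\<^esub> z; x \<in> carrier L; y \<in> carrier L; z \<in> carrier L\<rbrakk> \<Longrightarrow> x \<sqsubseteq>\<^bsub>L\<^esub> z"
    and "eq L = (=)"
proof -
  interpret complete_lattice L by (rule assms)
  show "x \<in> carrier L \<Longrightarrow> x \<sqsubseteq>\<^bsub>L\<^esub> x"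
    "\<lbrakk>x \<sqsubseteq>\<^bsub>L\<^esub> y; y \<sqsubseteq>\<^bsub>L\<^esub> x; x \<in> carrier L; y \<in> carrier L\<rbrakk> \<Longrightarrow> x = y"
    "\<lbrakk>x \<sqsubseteq>\<^bsub>L\<^esub> y; y \<sqsubseteq>\<^bsub>L\<^esub> z; x \<in> carrier L; y \<in> carrier L; z \<in> carrier L\<rbrakk> \<Longrightarrow> x \<sqsubseteq>\<^bsub>L\<^esub> z"
    "eq L = (=)"
    using le_refl le_antisym le_trans eq_is_equal by blast+
qed

text \<open>The two records may have different extensions; this relates a quantale to its underlying
  order.\<close>

lemma complete_lattice_cong:
  assumes "carrier L = carrier M" "eq L = eq M" "le L = le M"
  shows "complete_lattice L \<longleftrightarrow> complete_lattice M"
  unfolding complete_lattice_def complete_lattice_axioms_def partial_order_def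
    partial_order_axioms_def weak_partial_order_def weak_partial_order_axioms_def
    equivalence_def least_def greatest_def Upper_def Lower_def
  by (simp add: assms)

lemma lattice_sup_cong:
  assumes "carrier L = carrier M" "le L = le M"
  shows "\<Squnion>\<^bsub>L\<^esub> A = \<Squnion>\<^bsub>M\<^esub> A"
  unfolding sup_def least_def Upper_def by (simp add: assms)

section \<open>Closure systems\<close>

text \<open>Intersecting with \<open>X\<close> lets the empty family produce \<open>X\<close>, so
  that every subset has a closure. The instances are the extents of a context and the sets of pairs
  closed under suprema in each variable.\<close>

locale closure_system =
  fixes X :: "'a set" and \<C> :: "'a set set"
  assumes closed_subset: "A \<in> \<C> \<Longrightarrow> A \<subseteq> X"
    and closed_Inter: "\<F> \<subseteq> \<C> \<Longrightarrow> X \<inter> \<Inter>\<F> \<in> \<C>"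
begin

definition cl :: "'a set \<Rightarrow> 'a set" where
  "cl A = X \<inter> \<Inter>{C \<in> \<C>. A \<subseteq> C}"

lemma cl_closed [simp]: "cl A \<in> \<C>"
  unfolding cl_def by (rule closed_Inter) blast

lemma cl_subset_iff: "\<lbrakk>A \<subseteq> X; C \<in> \<C>\<rbrakk> \<Longrightarrow> cl A \<subseteq> C \<longleftrightarrow> A \<subseteq> C"
  unfolding cl_def by blast

lemma subset_cl: "A \<subseteq> X \<Longrightarrow> A \<subseteq> cl A"
  unfolding cl_def by blast

end

text \<open>A closed set is a set, but an element of a lattice has to be a value of type
  \<open>'u\<close>; the injection \<open>e\<close> names each closed set by such a value. Both the
  tensor product and the lattice of extents arise as \<open>lat\<close>.\<close>

locale encoded_closure_system = closure_system X \<C>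
  for X :: "'a set" and \<C> :: "'a set set" +
  fixes e :: "'a set \<Rightarrow> 'u"
  assumes inj_e: "inj_on e \<C>" and small_closed: "\<C> \<prec> (UNIV :: 'u set)"
begin

text \<open>The order asks for closed sets with the given codes instead of decoding its arguments,
  so it relates elements of the carrier only, as \<open>small_complete_lattice\<close>
  demands.\<close>

definition lat :: "'u gorder" where
  "lat = \<lparr>carrier = e ` \<C>, eq = (=),
     le = \<lambda>x y. \<exists>A \<in> \<C>. \<exists>B \<in> \<C>. x = e A \<and> y = e B \<and> A \<subseteq> B\<rparr>"

definition dec :: "'u \<Rightarrow> 'a set" where
  "dec = inv_into \<C> e"

lemma carrier_lat: "carrier lat = e ` \<C>"
  by (simp add: lat_def)

lemma e_carrier [simp]: "A \<in> \<C> \<Longrightarrow> e A \<in> carrier lat"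
  by (simp add: carrier_lat)

lemma dec_e [simp]: "A \<in> \<C> \<Longrightarrow> dec (e A) = A"
  unfolding dec_def by (rule inv_into_f_f[OF inj_e])

lemma dec_closed [simp]: "x \<in> carrier lat \<Longrightarrow> dec x \<in> \<C>"
  by (auto simp: carrier_lat)

lemma e_dec [simp]: "x \<in> carrier lat \<Longrightarrow> e (dec x) = x"
  by (auto simp: carrier_lat)

lemma le_lat: "\<lbrakk>A \<in> \<C>; B \<in> \<C>\<rbrakk> \<Longrightarrow> e A \<sqsubseteq>\<^bsub>lat\<^esub> e B \<longleftrightarrow> A \<subseteq> B"
  unfolding lat_def using inj_e by (auto simp: inj_on_eq_iff)

lemma le_lat_dec: "\<lbrakk>x \<in> carrier lat; y \<in> carrier lat\<rbrakk> \<Longrightarrow> x \<sqsubseteq>\<^bsub>lat\<^esub> y \<longleftrightarrow> dec x \<subseteq> dec y"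
  using le_lat[of "dec x" "dec y"] by simp

lemma sup_lat_iff:
  assumes "A \<subseteq> carrier lat" "u \<in> carrier lat"
  shows "e (cl (\<Union>(dec ` A))) \<sqsubseteq>\<^bsub>lat\<^esub> u \<longleftrightarrow> (\<forall>a \<in> A. a \<sqsubseteq>\<^bsub>lat\<^esub> u)"
proof -
  have "\<Union>(dec ` A) \<subseteq> X" using assms closed_subset[OF dec_closed] by blast
  moreover have "\<And>a. a \<in> A \<Longrightarrow> a \<sqsubseteq>\<^bsub>lat\<^esub> u \<longleftrightarrow> dec a \<subseteq> dec u"
    using assms le_lat_dec by blast
  ultimately show ?thesis using assms le_lat_dec[of "e (cl (\<Union>(dec ` A)))" u]
    by (simp add: cl_subset_iff UN_subset_iff)
qed

lemma complete_lattice_lat: "complete_lattice lat"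
proof (rule complete_lattice_from_sups)
  fix A assume "A \<subseteq> carrier lat"
  then show "\<exists>s \<in> carrier lat. \<forall>u \<in> carrier lat. s \<sqsubseteq>\<^bsub>lat\<^esub> u \<longleftrightarrow> (\<forall>a \<in> A. a \<sqsubseteq>\<^bsub>lat\<^esub> u)"
    using sup_lat_iff by (intro bexI[of _ "e (cl (\<Union>(dec ` A)))"]) auto
next
  fix x y assume "x \<in> carrier lat" "y \<in> carrier lat" "x \<sqsubseteq>\<^bsub>lat\<^esub> y" "y \<sqsubseteq>\<^bsub>lat\<^esub> x"
  then show "x = y" by (metis le_lat_dec subset_antisym e_dec)
qed (auto simp: le_lat_dec, simp add: lat_def)

lemma small_complete_lattice_lat: "small_complete_lattice lat"
proof -
  have "e ` \<C> \<prec> (UNIV :: 'u set)"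
    using small_closed image_lepoll lesspoll_trans1 by blast
  then show ?thesis
    unfolding small_complete_lattice_def small_def
    using complete_lattice_lat by (auto simp: lat_def)
qed

lemma sup_lat: "A \<subseteq> carrier lat \<Longrightarrow> \<Squnion>\<^bsub>lat\<^esub> A = e (cl (\<Union>(dec ` A)))"
  by (rule sup_eqI[OF complete_lattice_lat]) (auto simp: sup_lat_iff)

end

section \<open>Small sets\<close>

text \<open>The \<open>itself\<close> parameter carries the type \<open>'u\<close>, which lets the
  size hypothesis of the theorem serve as a locale assumption.\<close>

locale strong_limit =
  fixes univ :: "'u itself"
  assumes small_Pow: "small (A :: 'u set) \<Longrightarrow> Pow A \<prec> (UNIV :: 'u set)"
begin

text \<open>If \<open>'u\<close> had \<open>n + 1\<close> elements, a subset with \<open>n\<close>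
  elements would be small, so its power set would have fewer than \<open>n + 1\<close> elements,
  against \<open>n < 2 ^ n\<close>.\<close>

lemma infinite_univ: "infinite (UNIV :: 'u set)"
proof
  assume fin: "finite (UNIV :: 'u set)"
  define A where "A = (UNIV :: 'u set) - {undefined}"
  have "card A < card (UNIV :: 'u set)"
    unfolding A_def using fin by (intro psubset_card_mono) auto
  then have "small A"
    unfolding small_def using fin finite_subset[OF subset_UNIV fin]
    by (metis eqpoll_iff_card lesspoll_def nat_neq_iff subset_UNIV subset_imp_lepoll)
  then have "Pow A \<prec> (UNIV :: 'u set)" by (rule small_Pow)
  then have "card (Pow A) < card (UNIV :: 'u set)"
    using fin by (metis eqpoll_iff_card finite_Pow_iff finite_subset lepoll_iff_card_le lesspoll_def
        le_neq_implies_less subset_UNIV)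
  then have "2 ^ card A < card (UNIV :: 'u set)"
    using fin by (simp add: card_Pow finite_subset[OF subset_UNIV fin])
  moreover have "card (UNIV :: 'u set) = Suc (card A)"
    unfolding A_def using fin by (metis UNIV_I card.remove)
  ultimately show False using less_exp[of "card A"] by linarith
qed

text \<open>The assumption concerns subsets of \<open>'u\<close>. An injection into
  \<open>'u\<close> extends it to sets of any type, in particular to sets of pairs.\<close>

lemma small_Pow': 
  assumes "(A :: 'a set) \<prec> (UNIV :: 'u set)"
  shows "Pow A \<prec> (UNIV :: 'u set)"
proof -
  obtain f :: "'a \<Rightarrow> 'u" where f: "inj_on f A" using assms by (auto simp: lesspoll_def lepoll_def)
  have "f ` A \<prec> (UNIV :: 'u set)" using image_lepoll assms lesspoll_trans1 by blast
  then have "Pow (f ` A) \<prec> (UNIV :: 'u set)" using small_Pow small_def by blast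
  moreover have "Pow A \<lesssim> Pow (f ` A)"
    unfolding lepoll_def using inj_on_image_Pow[OF f] by (intro exI[of _ "image f"]) auto
  ultimately show ?thesis using lesspoll_trans1 by blast
qed

text \<open>The product embeds into the square of the union. The union of two small sets is small
  because the universe is infinite, and an infinite set is equipollent to its square.\<close>

lemma small_Times:
  assumes "small (A :: 'u set)" "small (B :: 'u set)"
  shows "A \<times> B \<prec> (UNIV :: 'u set)"
proof -
  \<comment> \<open>Strict domination is matched with the strict order of cardinals, for which the
    bound on unions is stated.\<close>
  have *: "C \<prec> (UNIV :: 'u set) \<longleftrightarrow> ordLess2 (card_of C) (card_of (UNIV :: 'u set))" for C :: "'u set"
    unfolding card_of_ordLess[symmetric] lesspoll_def
    by (metis UNIV_I card_of_ordLess card_of_ordLeq eqpoll_iff_card_of_ordIso lepoll_antisym lepoll_def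
        ordIso_iff_ordLeq ordLess_imp_ordLeq subset_UNIV)
  have C: "A \<union> B \<prec> (UNIV :: 'u set)"
    using assms infinite_univ unfolding small_def * by (intro card_of_Un_ordLess_infinite) auto
  have "A \<times> B \<lesssim> (A \<union> B) \<times> (A \<union> B)" by (intro subset_imp_lepoll) blast
  also have "(A \<union> B) \<times> (A \<union> B) \<prec> (UNIV :: 'u set)"
  proof (cases "finite (A \<union> B)")
    case True
    then show ?thesis using infinite_univ
      by (metis finite_cartesian_product finite_lesspoll_infinite)
  next
    case False
    then have "(A \<union> B) \<times> (A \<union> B) \<approx> A \<union> B"
      using card_of_Times_same_infinite eqpoll_iff_card_of_ordIso by blast
    with C show ?thesis using eqpoll_imp_lepoll lesspoll_trans1 by blast
  qed
  finally show ?thesis .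
qed

lemma encoding_exists:
  assumes "(X :: 'a set) \<prec> (UNIV :: 'u set)" "\<C> \<subseteq> Pow X"
  shows "\<exists>e :: 'a set \<Rightarrow> 'u. inj_on e \<C>" "\<C> \<prec> (UNIV :: 'u set)"
proof -
  show "\<C> \<prec> (UNIV :: 'u set)"
    using small_Pow'[OF assms(1)] subset_imp_lepoll[OF assms(2)] lesspoll_trans1 by blast
  then show "\<exists>e :: 'a set \<Rightarrow> 'u. inj_on e \<C>" by (auto simp: lesspoll_def lepoll_def)
qed

end

section \<open>Sup-preserving maps\<close>

lemma scl_complete [simp]: "small_complete_lattice L \<Longrightarrow> complete_lattice L"
  by (simp add: small_complete_lattice_def)

lemma sup_mapD:
  assumes "sup_map L M f"
  shows "f \<in> extensional (carrier L)" "x \<in> carrier L \<Longrightarrow> f x \<in> carrier M"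
    "A \<subseteq> carrier L \<Longrightarrow> f (\<Squnion>\<^bsub>L\<^esub> A) = \<Squnion>\<^bsub>M\<^esub> (f ` A)"
    "complete_lattice L" "complete_lattice M"
  using assms by (auto simp: sup_map_def sup_pres_def PiE_def)

lemma sup_mapI:
  assumes "complete_lattice L" "complete_lattice M" "f \<in> extensional (carrier L)"
    and "\<And>x. x \<in> carrier L \<Longrightarrow> f x \<in> carrier M"
    and "\<And>A. A \<subseteq> carrier L \<Longrightarrow> f (\<Squnion>\<^bsub>L\<^esub> A) = \<Squnion>\<^bsub>M\<^esub> (f ` A)"
  shows "sup_map L M f"
  using assms by (auto simp: sup_map_def sup_pres_def PiE_def)

lemma sup_map_Idn: "complete_lattice L \<Longrightarrow> sup_map L L (\<lambda>x \<in> carrier L. x)"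
proof (rule sup_mapI)
  assume L: "complete_lattice L"
  fix A assume A: "A \<subseteq> carrier L"
  then have "(\<lambda>x \<in> carrier L. x) ` A = (\<lambda>x. x) ` A" by (intro image_cong) auto
  then show "(\<lambda>x \<in> carrier L. x) (\<Squnion>\<^bsub>L\<^esub> A) = \<Squnion>\<^bsub>L\<^esub> ((\<lambda>x \<in> carrier L. x) ` A)"
    using sup_in_carrier[OF L A] by simp
qed auto

lemma sup_map_compose:
  assumes f: "sup_map L M f" and g: "sup_map M N g"
  shows "sup_map L N (compose (carrier L) g f)"
proof (rule sup_mapI)
  fix A assume A: "A \<subseteq> carrier L"
  then have "f ` A \<subseteq> carrier M" using sup_mapD(2)[OF f] by auto
  moreover have "compose (carrier L) g f ` A = g ` f ` A"
    unfolding image_image by (rule image_cong) (use A in \<open>auto simp: compose_eq\<close>)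
  ultimately show "compose (carrier L) g f (\<Squnion>\<^bsub>L\<^esub> A) = \<Squnion>\<^bsub>N\<^esub> (compose (carrier L) g f ` A)"
    using A sup_mapD[OF f] sup_mapD[OF g] by (simp add: compose_eq sup_in_carrier)
qed (use sup_mapD[OF f] sup_mapD[OF g] in \<open>auto simp: compose_eq\<close>)

text \<open>For \<open>x\<close> below \<open>y\<close> the supremum of \<open>{x, y}\<close> is
  \<open>y\<close>, hence \<open>f y\<close> is the supremum of \<open>{f x, f y}\<close>.\<close>

lemma sup_map_mono:
  assumes f: "sup_map L M f" and xy: "x \<in> carrier L" "y \<in> carrier L" "x \<sqsubseteq>\<^bsub>L\<^esub> y"
  shows "f x \<sqsubseteq>\<^bsub>M\<^esub> f y"
proof -
  note L = complete_lattice_leD[OF sup_mapD(4)[OF f]] and M = complete_lattice_leD[OF sup_mapD(5)[OF f]]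
  have "\<Squnion>\<^bsub>L\<^esub> {x, y} = y"
    by (rule sup_eqI[OF sup_mapD(4)[OF f]]) (use xy L(3)[OF xy(3)] in auto)
  then have "f y = \<Squnion>\<^bsub>M\<^esub> {f x, f y}" using sup_mapD(3)[OF f, of "{x, y}"] xy by simp
  then show ?thesis
    using sup_le_iff[OF sup_mapD(5)[OF f], of "{f x, f y}" "f y"] xy sup_mapD(2)[OF f] M(1) by simp
qed

lemma sup_map_le_iff:
  assumes f: "sup_map L M f" and A: "A \<subseteq> carrier L" and u: "u \<in> carrier M"
  shows "f (\<Squnion>\<^bsub>L\<^esub> A) \<sqsubseteq>\<^bsub>M\<^esub> u \<longleftrightarrow> (\<forall>a \<in> A. f a \<sqsubseteq>\<^bsub>M\<^esub> u)"
proof -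
  have "f ` A \<subseteq> carrier M" using A sup_mapD(2)[OF f] by auto
  then show ?thesis
    unfolding sup_mapD(3)[OF f A] by (subst sup_le_iff[OF sup_mapD(5)[OF f] _ u]) auto
qed

text \<open>Suprema commute with suprema, so sup-maps are closed under pointwise suprema. In the
  construction of the associator this makes a supremum of maps comparable with another sup-map on
  pure tensors.\<close>

lemma sup_map_pointwise:
  assumes L: "complete_lattice L" and M: "complete_lattice M"
    and G: "\<And>g. g \<in> G \<Longrightarrow> sup_map L M g"
  shows "sup_map L M (\<lambda>x \<in> carrier L. \<Squnion>\<^bsub>M\<^esub> ((\<lambda>g. g x) ` G))"
proof (rule sup_mapI[OF L M])
  have mem: "(\<lambda>g. g x) ` G \<subseteq> carrier M" if "x \<in> carrier L" for x
    using sup_mapD(2)[OF G that] by auto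
  then show "\<And>x. x \<in> carrier L \<Longrightarrow> (\<lambda>x \<in> carrier L. \<Squnion>\<^bsub>M\<^esub> ((\<lambda>g. g x) ` G)) x \<in> carrier M"
    using M by (simp add: sup_in_carrier)
  fix A assume A: "A \<subseteq> carrier L"
  let ?h = "\<lambda>x \<in> carrier L. \<Squnion>\<^bsub>M\<^esub> ((\<lambda>g. g x) ` G)"
  have hA: "?h ` A \<subseteq> carrier M" using A mem M by (auto simp: sup_in_carrier)
  have "\<Squnion>\<^bsub>M\<^esub> ((\<lambda>g. g (\<Squnion>\<^bsub>L\<^esub> A)) ` G) = \<Squnion>\<^bsub>M\<^esub> (?h ` A)"
  proof (rule sup_eqI[OF M])
    fix u assume u: "u \<in> carrier M"
    have "\<Squnion>\<^bsub>M\<^esub> (?h ` A) \<sqsubseteq>\<^bsub>M\<^esub> u \<longleftrightarrow> (\<forall>a \<in> A. \<forall>g \<in> G. g a \<sqsubseteq>\<^bsub>M\<^esub> u)"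
    proof -
      have "?h a \<sqsubseteq>\<^bsub>M\<^esub> u \<longleftrightarrow> (\<forall>g \<in> G. g a \<sqsubseteq>\<^bsub>M\<^esub> u)" if "a \<in> A" for a
        using sup_le_iff[OF M mem u, of a] A that by auto
      then show ?thesis unfolding sup_le_iff[OF M hA u] by blast
    qed
    also have "\<dots> \<longleftrightarrow> (\<forall>g \<in> G. g (\<Squnion>\<^bsub>L\<^esub> A) \<sqsubseteq>\<^bsub>M\<^esub> u)"
      using sup_map_le_iff[OF G A u] by blast
    finally show "\<Squnion>\<^bsub>M\<^esub> (?h ` A) \<sqsubseteq>\<^bsub>M\<^esub> u \<longleftrightarrow> (\<forall>a \<in> (\<lambda>g. g (\<Squnion>\<^bsub>L\<^esub> A)) ` G. a \<sqsubseteq>\<^bsub>M\<^esub> u)" by simp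
  qed (use hA mem[OF sup_in_carrier[OF L A]] M in \<open>auto simp: sup_in_carrier\<close>)
  then show "?h (\<Squnion>\<^bsub>L\<^esub> A) = \<Squnion>\<^bsub>M\<^esub> (?h ` A)" using sup_in_carrier[OF L A] by simp
qed simp

lemma SupCat_Obj [simp]: "L \<in> Obj SupCat \<longleftrightarrow> small_complete_lattice L"
  by (simp add: SupCat_def)

lemma SupCat_Arr: "F \<in> Arr SupCat \<longleftrightarrow> small_complete_lattice (adom F) \<and>
    small_complete_lattice (acod F) \<and> sup_map (adom F) (acod F) (adat F)"
  by (cases F) (auto simp: SupCat_def)

lemma SupCat_simps [simp]:
  "Dom SupCat = adom" "Cod SupCat = acod"
  "Idn SupCat L = \<lparr>adom = L, acod = L, adat = \<lambda>x \<in> carrier L. x\<rparr>"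
  "Cmp SupCat G F = \<lparr>adom = adom F, acod = acod G, adat = compose (carrier (adom F)) (adat G) (adat F)\<rparr>"
  by (simp_all add: SupCat_def)

lemma category_SupCat: "category SupCat"
proof
  fix f :: "('u gorder, 'u \<Rightarrow> 'u) arrow" and g A B D
  assume "f \<in> Hom SupCat A B" "g \<in> Hom SupCat B D"
  then show "g \<cdot>\<^bsub>SupCat\<^esub> f \<in> Hom SupCat A D"
    by (auto simp: Hom_def SupCat_Arr intro: sup_map_compose)
next
  fix f :: "('u gorder, 'u \<Rightarrow> 'u) arrow" and g h :: "('u gorder, 'u \<Rightarrow> 'u) arrow" and A B D E
  assume "f \<in> Hom SupCat A B" "g \<in> Hom SupCat B D" "h \<in> Hom SupCat D E"
  then have "adat f \<in> carrier A \<rightarrow> carrier B" "adom f = A" "adom g = B"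
    using sup_mapD(2)[of A B "adat f"] by (auto simp: Hom_def SupCat_Arr)
  then show "(h \<cdot>\<^bsub>SupCat\<^esub> g) \<cdot>\<^bsub>SupCat\<^esub> f = h \<cdot>\<^bsub>SupCat\<^esub> (g \<cdot>\<^bsub>SupCat\<^esub> f)"
    by (simp add: compose_assoc)
next
  fix f :: "('u gorder, 'u \<Rightarrow> 'u) arrow" and A B
  assume f: "f \<in> Hom SupCat A B"
  then have "adat f \<in> carrier A \<rightarrow> carrier B" "adat f \<in> extensional (carrier A)"
    using sup_mapD(1,2)[of A B "adat f"] by (auto simp: Hom_def SupCat_Arr)
  then have "compose (carrier A) (\<lambda>x \<in> carrier B. x) (adat f) = adat f"
    "compose (carrier A) (adat f) (\<lambda>x \<in> carrier A. x) = adat f"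
    by (rule Id_compose compose_Id)+
  with f show "Idn SupCat B \<cdot>\<^bsub>SupCat\<^esub> f = f" "f \<cdot>\<^bsub>SupCat\<^esub> Idn SupCat A = f"
    by (auto simp: Hom_def intro!: arrow_eqI)
qed (auto simp: Hom_def SupCat_Arr sup_map_Idn)

section \<open>The tensor product of sup-lattices\<close>

lemma bimorphismD:
  assumes "bimorphism L M N t"
  shows "\<lbrakk>a \<in> carrier L; b \<in> carrier M\<rbrakk> \<Longrightarrow> t a b \<in> carrier N"
    and "\<lbrakk>A \<subseteq> carrier L; b \<in> carrier M\<rbrakk> \<Longrightarrow> t (\<Squnion>\<^bsub>L\<^esub> A) b = \<Squnion>\<^bsub>N\<^esub> ((\<lambda>a. t a b) ` A)"
    and "\<lbrakk>a \<in> carrier L; B \<subseteq> carrier M\<rbrakk> \<Longrightarrow> t a (\<Squnion>\<^bsub>M\<^esub> B) = \<Squnion>\<^bsub>N\<^esub> (t a ` B)"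
  using assms by (auto simp: bimorphism_def sup_pres_def)

lemma bimorphismI:
  assumes "complete_lattice L" "complete_lattice M" "complete_lattice N"
    and "t \<in> carrier L \<rightarrow>\<^sub>E carrier M \<rightarrow>\<^sub>E carrier N"
    and "\<And>A b. \<lbrakk>A \<subseteq> carrier L; b \<in> carrier M\<rbrakk> \<Longrightarrow> t (\<Squnion>\<^bsub>L\<^esub> A) b = \<Squnion>\<^bsub>N\<^esub> ((\<lambda>a. t a b) ` A)"
    and "\<And>a B. \<lbrakk>a \<in> carrier L; B \<subseteq> carrier M\<rbrakk> \<Longrightarrow> t a (\<Squnion>\<^bsub>M\<^esub> B) = \<Squnion>\<^bsub>N\<^esub> (t a ` B)"
  shows "bimorphism L M N t"
  using assms by (auto simp: bimorphism_def sup_pres_def)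

text \<open>Bimorphisms have to be extensional in both arguments. The restriction is dealt with once
  here, and the laws may be checked for the plain function \<open>t\<close>.\<close>

lemma bimorphism_restrictI:
  assumes L: "complete_lattice L" and M: "complete_lattice M" and N: "complete_lattice N"
    and t: "\<And>a b. \<lbrakk>a \<in> carrier L; b \<in> carrier M\<rbrakk> \<Longrightarrow> t a b \<in> carrier N"
    and "\<And>A b. \<lbrakk>A \<subseteq> carrier L; b \<in> carrier M\<rbrakk> \<Longrightarrow> t (\<Squnion>\<^bsub>L\<^esub> A) b = \<Squnion>\<^bsub>N\<^esub> ((\<lambda>a. t a b) ` A)"
    and "\<And>a B. \<lbrakk>a \<in> carrier L; B \<subseteq> carrier M\<rbrakk> \<Longrightarrow> t a (\<Squnion>\<^bsub>M\<^esub> B) = \<Squnion>\<^bsub>N\<^esub> (t a ` B)"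
  shows "bimorphism L M N (\<lambda>a \<in> carrier L. \<lambda>b \<in> carrier M. t a b)"
proof (rule bimorphismI[OF L M N])
  fix A b assume A: "A \<subseteq> carrier L" "b \<in> carrier M"
  then have "(\<lambda>a. (\<lambda>a \<in> carrier L. \<lambda>b \<in> carrier M. t a b) a b) ` A = (\<lambda>a. t a b) ` A"
    by (auto simp: image_iff subset_iff)
  with A show "(\<lambda>a \<in> carrier L. \<lambda>b \<in> carrier M. t a b) (\<Squnion>\<^bsub>L\<^esub> A) b
      = \<Squnion>\<^bsub>N\<^esub> ((\<lambda>a. (\<lambda>a \<in> carrier L. \<lambda>b \<in> carrier M. t a b) a b) ` A)"
    using assms(5)[OF A] sup_in_carrier[OF L A(1)] by simp
next
  fix a B assume B: "a \<in> carrier L" "B \<subseteq> carrier M"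
  then have "(\<lambda>a \<in> carrier L. \<lambda>b \<in> carrier M. t a b) a ` B = t a ` B"
    by (auto simp: image_iff subset_iff)
  with B show "(\<lambda>a \<in> carrier L. \<lambda>b \<in> carrier M. t a b) a (\<Squnion>\<^bsub>M\<^esub> B)
      = \<Squnion>\<^bsub>N\<^esub> ((\<lambda>a \<in> carrier L. \<lambda>b \<in> carrier M. t a b) a ` B)"
    using assms(6)[OF B] sup_in_carrier[OF M B(2)] by simp
qed (use t in auto)

text \<open>The equivalences do more than ask for closure under suprema. Read from left to right,
  with \<open>A = {a, a'}\<close> and \<open>a\<close> below \<open>a'\<close>, they make
  \<open>I\<close> a down-set in each variable; with empty \<open>A\<close> or \<open>B\<close> they
  force every pair with a bottom component into \<open>I\<close>.\<close>

definition tensor_closed :: "('u, 'y) gorder_scheme \<Rightarrow> ('u, 'z) gorder_scheme \<Rightarrow> ('u \<times> 'u) set \<Rightarrow> bool" where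
  "tensor_closed L M I \<longleftrightarrow> I \<subseteq> carrier L \<times> carrier M \<and>
     (\<forall>A b. A \<subseteq> carrier L \<longrightarrow> b \<in> carrier M \<longrightarrow> ((\<Squnion>\<^bsub>L\<^esub> A, b) \<in> I \<longleftrightarrow> (\<forall>a \<in> A. (a, b) \<in> I))) \<and>
     (\<forall>a B. a \<in> carrier L \<longrightarrow> B \<subseteq> carrier M \<longrightarrow> ((a, \<Squnion>\<^bsub>M\<^esub> B) \<in> I \<longleftrightarrow> (\<forall>b \<in> B. (a, b) \<in> I)))"

lemma tensor_closed_system:
  assumes "complete_lattice L" "complete_lattice M"
  shows "closure_system (carrier L \<times> carrier M) {I. tensor_closed L M I}"
proof
  fix \<F> assume F: "\<F> \<subseteq> {I. tensor_closed L M I}"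
  have "(\<Squnion>\<^bsub>L\<^esub> A, b) \<in> carrier L \<times> carrier M \<inter> \<Inter>\<F> \<longleftrightarrow> (\<forall>a \<in> A. (a, b) \<in> carrier L \<times> carrier M \<inter> \<Inter>\<F>)"
    if A: "A \<subseteq> carrier L" "b \<in> carrier M" for A b
  proof -
    have "(\<Squnion>\<^bsub>L\<^esub> A, b) \<in> I \<longleftrightarrow> (\<forall>a \<in> A. (a, b) \<in> I)" if "I \<in> \<F>" for I
      using F that A by (auto simp: tensor_closed_def)
    then show ?thesis using sup_in_carrier[OF assms(1) A(1)] A by auto
  qed
  moreover have "(a, \<Squnion>\<^bsub>M\<^esub> B) \<in> carrier L \<times> carrier M \<inter> \<Inter>\<F> \<longleftrightarrow> (\<forall>b \<in> B. (a, b) \<in> carrier L \<times> carrier M \<inter> \<Inter>\<F>)"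
    if B: "a \<in> carrier L" "B \<subseteq> carrier M" for a B
  proof -
    have "(a, \<Squnion>\<^bsub>M\<^esub> B) \<in> I \<longleftrightarrow> (\<forall>b \<in> B. (a, b) \<in> I)" if "I \<in> \<F>" for I
      using F that B by (auto simp: tensor_closed_def)
    then show ?thesis using sup_in_carrier[OF assms(2) B(2)] B by auto
  qed
  ultimately show "carrier L \<times> carrier M \<inter> \<Inter>\<F> \<in> {I. tensor_closed L M I}"
    unfolding tensor_closed_def by simp
qed (auto simp: tensor_closed_def)

text \<open>As a function of \<open>n\<close>, this closed set will be the right adjoint of the map
  that classifies \<open>s\<close>.\<close>

lemma tensor_closed_bimorphism:
  assumes s: "bimorphism L M N s" and N: "complete_lattice N" and n: "n \<in> carrier N"
    and L: "complete_lattice L" and M: "complete_lattice M"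
  shows "tensor_closed L M {(a, b). a \<in> carrier L \<and> b \<in> carrier M \<and> s a b \<sqsubseteq>\<^bsub>N\<^esub> n}"
  unfolding tensor_closed_def
proof (intro conjI allI impI)
  fix A b assume A: "A \<subseteq> carrier L" "b \<in> carrier M"
  then have "(\<lambda>a. s a b) ` A \<subseteq> carrier N" using bimorphismD(1)[OF s] by blast
  then show "(\<Squnion>\<^bsub>L\<^esub> A, b) \<in> {(a, b). a \<in> carrier L \<and> b \<in> carrier M \<and> s a b \<sqsubseteq>\<^bsub>N\<^esub> n} \<longleftrightarrow>
      (\<forall>a \<in> A. (a, b) \<in> {(a, b). a \<in> carrier L \<and> b \<in> carrier M \<and> s a b \<sqsubseteq>\<^bsub>N\<^esub> n})"
    using A n sup_in_carrier[OF L] by (auto simp: bimorphismD(2)[OF s] sup_le_iff[OF N])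
next
  fix a B assume B: "a \<in> carrier L" "B \<subseteq> carrier M"
  then have "s a ` B \<subseteq> carrier N" using bimorphismD(1)[OF s] by blast
  then show "(a, \<Squnion>\<^bsub>M\<^esub> B) \<in> {(a, b). a \<in> carrier L \<and> b \<in> carrier M \<and> s a b \<sqsubseteq>\<^bsub>N\<^esub> n} \<longleftrightarrow>
      (\<forall>b \<in> B. (a, b) \<in> {(a, b). a \<in> carrier L \<and> b \<in> carrier M \<and> s a b \<sqsubseteq>\<^bsub>N\<^esub> n})"
    using B n sup_in_carrier[OF M] by (auto simp: bimorphismD(3)[OF s] sup_le_iff[OF N])
qed auto

section \<open>Existence of the tensor product\<close>

context strong_limit
begin

text \<open>The pure tensor of \<open>a\<close> and \<open>b\<close> is the closed set generated by
  \<open>(a, b)\<close>. A bimorphism \<open>s\<close> induces the map sending a closed set to the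
  supremum of the values of \<open>s\<close> on its pairs.\<close>

lemma universal_bimorphism_exists:
  assumes "small_complete_lattice (L :: 'u gorder)" "small_complete_lattice (M :: 'u gorder)"
  shows "\<exists>P t. universal_bimorphism L M P t"
proof -
  have L: "complete_lattice L" and M: "complete_lattice M"
    and "small (carrier L)" "small (carrier M)"
    using assms by (auto simp: small_complete_lattice_def)
  let ?X = "carrier L \<times> carrier M"
  define \<C> where "\<C> = {I. tensor_closed L M I}"
  interpret closure_system ?X \<C> unfolding \<C>_def by (rule tensor_closed_system[OF L M])
  have X: "?X \<prec> (UNIV :: 'u set)"
    by (rule small_Times) fact+
  have "\<C> \<subseteq> Pow ?X" using closed_subset by blast
  from encoding_exists[OF X this] obtain e :: "('u \<times> 'u) set \<Rightarrow> 'u"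
    where e: "inj_on e \<C>" and sm: "\<C> \<prec> (UNIV :: 'u set)" by blast
  interpret encoded_closure_system ?X \<C> e by unfold_locales (rule e, rule sm)
  define t where "t = (\<lambda>a \<in> carrier L. \<lambda>b \<in> carrier M. e (cl {(a, b)}))"
  have t: "t a b = e (cl {(a, b)})" if "a \<in> carrier L" "b \<in> carrier M" for a b
    using that by (simp add: t_def)
  \<comment> \<open>The closure in a pure tensor disappears against a closed set: lying below
    \<open>x\<close> is membership of the pair in \<open>x\<close>. Hence \<open>t\<close> preserves
    suprema in each variable exactly because closed sets respect them.\<close>
  have t_le: "t a b \<sqsubseteq>\<^bsub>lat\<^esub> x \<longleftrightarrow> (a, b) \<in> dec x"
    if "a \<in> carrier L" "b \<in> carrier M" "x \<in> carrier lat" for a b x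
    using that le_lat_dec[of "t a b" x] cl_subset_iff[of "{(a, b)}" "dec x"] by (simp add: t)
  have closed: "tensor_closed L M (dec x)" if "x \<in> carrier lat" for x
    using dec_closed[OF that] by (simp add: \<C>_def)
  have bi: "bimorphism L M lat t"
    unfolding t_def
  proof (rule bimorphism_restrictI[OF L M complete_lattice_lat])
    fix A b assume A: "A \<subseteq> carrier L" "b \<in> carrier M"
    show "e (cl {(\<Squnion>\<^bsub>L\<^esub> A, b)}) = \<Squnion>\<^bsub>lat\<^esub> ((\<lambda>a. e (cl {(a, b)})) ` A)"
    proof (rule sup_eqI[OF complete_lattice_lat, symmetric])
      fix u assume u: "u \<in> carrier lat"
      have "e (cl {(\<Squnion>\<^bsub>L\<^esub> A, b)}) \<sqsubseteq>\<^bsub>lat\<^esub> u \<longleftrightarrow> (\<forall>a \<in> A. (a, b) \<in> dec u)"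
        using t_le[of "\<Squnion>\<^bsub>L\<^esub> A" b u] closed[OF u] A u sup_in_carrier[OF L A(1)]
        by (simp add: t tensor_closed_def)
      then show "e (cl {(\<Squnion>\<^bsub>L\<^esub> A, b)}) \<sqsubseteq>\<^bsub>lat\<^esub> u \<longleftrightarrow> (\<forall>x \<in> (\<lambda>a. e (cl {(a, b)})) ` A. x \<sqsubseteq>\<^bsub>lat\<^esub> u)"
        using t_le[of _ b u] A u by (auto simp: t subset_iff)
    qed auto
  next
    fix a B assume B: "a \<in> carrier L" "B \<subseteq> carrier M"
    show "e (cl {(a, \<Squnion>\<^bsub>M\<^esub> B)}) = \<Squnion>\<^bsub>lat\<^esub> ((\<lambda>b. e (cl {(a, b)})) ` B)"
    proof (rule sup_eqI[OF complete_lattice_lat, symmetric])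
      fix u assume u: "u \<in> carrier lat"
      have "e (cl {(a, \<Squnion>\<^bsub>M\<^esub> B)}) \<sqsubseteq>\<^bsub>lat\<^esub> u \<longleftrightarrow> (\<forall>b \<in> B. (a, b) \<in> dec u)"
        using t_le[of a "\<Squnion>\<^bsub>M\<^esub> B" u] closed[OF u] B u sup_in_carrier[OF M B(2)]
        by (simp add: t tensor_closed_def)
      then show "e (cl {(a, \<Squnion>\<^bsub>M\<^esub> B)}) \<sqsubseteq>\<^bsub>lat\<^esub> u \<longleftrightarrow> (\<forall>x \<in> (\<lambda>b. e (cl {(a, b)})) ` B. x \<sqsubseteq>\<^bsub>lat\<^esub> u)"
        using t_le[of a _ u] B u by (auto simp: t subset_iff)
    qed auto
  qed auto
  have tX: "(\<lambda>(a, b). t a b) ` dec x \<subseteq> carrier lat" if "x \<in> carrier lat" for x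
    using closed_subset[OF dec_closed[OF that]] bimorphismD(1)[OF bi] by auto
  \<comment> \<open>Pure tensors generate: a closed set is the supremum of the pure tensors of its
    pairs. Uniqueness of the induced map follows.\<close>
  have x_sup: "x = \<Squnion>\<^bsub>lat\<^esub> ((\<lambda>(a, b). t a b) ` dec x)" if x: "x \<in> carrier lat" for x
  proof (rule sup_eqI[OF complete_lattice_lat tX[OF x] x, symmetric])
    fix u assume u: "u \<in> carrier lat"
    have "\<And>a b. (a, b) \<in> dec x \<Longrightarrow> t a b \<sqsubseteq>\<^bsub>lat\<^esub> u \<longleftrightarrow> (a, b) \<in> dec u"
      using t_le u closed_subset[OF dec_closed[OF x]] by blast
    then show "x \<sqsubseteq>\<^bsub>lat\<^esub> u \<longleftrightarrow> (\<forall>a \<in> (\<lambda>(a, b). t a b) ` dec x. a \<sqsubseteq>\<^bsub>lat\<^esub> u)"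
      using le_lat_dec[OF x u] by auto
  qed
  have univ: "\<exists>!f. sup_map lat N f \<and> (\<forall>a \<in> carrier L. \<forall>b \<in> carrier M. f (t a b) = s a b)"
    if N: "small_complete_lattice N" and s: "bimorphism L M N s" for N s
  proof (rule ex_ex1I)
    have N': "complete_lattice N" using N by simp
    define f where "f = (\<lambda>x \<in> carrier lat. \<Squnion>\<^bsub>N\<^esub> ((\<lambda>(a, b). s a b) ` dec x))"
    have sX: "(\<lambda>(a, b). s a b) ` dec x \<subseteq> carrier N" if "x \<in> carrier lat" for x
      using closed_subset[OF dec_closed[OF that]] bimorphismD(1)[OF s] by auto
    have fN: "f x \<in> carrier N" if "x \<in> carrier lat" for x
      using sup_in_carrier[OF N' sX[OF that]] that by (simp add: f_def)
    define K where "K n = {(a, b). a \<in> carrier L \<and> b \<in> carrier M \<and> s a b \<sqsubseteq>\<^bsub>N\<^esub> n}" for n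
    have K: "K n \<in> \<C>" if "n \<in> carrier N" for n
      unfolding K_def \<C>_def using tensor_closed_bimorphism[OF s N' that L M] by simp
    \<comment> \<open>This adjunction between \<open>f\<close> and
      \<open>n \<mapsto> e (K n)\<close> yields both that \<open>f\<close> preserves suprema and,
      applied to a pure tensor, that \<open>f\<close> extends \<open>s\<close>.\<close>
    have f_le: "f x \<sqsubseteq>\<^bsub>N\<^esub> n \<longleftrightarrow> x \<sqsubseteq>\<^bsub>lat\<^esub> e (K n)" if "x \<in> carrier lat" "n \<in> carrier N" for x n
    proof -
      have "f x \<sqsubseteq>\<^bsub>N\<^esub> n \<longleftrightarrow> (\<forall>(a, b) \<in> dec x. s a b \<sqsubseteq>\<^bsub>N\<^esub> n)"
        using that sup_le_iff[OF N' sX] by (auto simp: f_def)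
      also have "\<dots> \<longleftrightarrow> dec x \<subseteq> K n"
        using closed_subset[OF dec_closed[OF that(1)]] by (auto simp: K_def)
      also have "\<dots> \<longleftrightarrow> x \<sqsubseteq>\<^bsub>lat\<^esub> e (K n)" using le_lat_dec[of x "e (K n)"] K that by simp
      finally show ?thesis .
    qed
    have "sup_map lat N f"
    proof (rule sup_mapI[OF complete_lattice_lat N'])
      fix A assume A: "A \<subseteq> carrier lat"
      show "f (\<Squnion>\<^bsub>lat\<^esub> A) = \<Squnion>\<^bsub>N\<^esub> (f ` A)"
      proof (rule sup_eqI[OF N', symmetric])
        fix u assume u: "u \<in> carrier N"
        have "f (\<Squnion>\<^bsub>lat\<^esub> A) \<sqsubseteq>\<^bsub>N\<^esub> u \<longleftrightarrow> (\<forall>a \<in> A. a \<sqsubseteq>\<^bsub>lat\<^esub> e (K u))"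
          using f_le[OF sup_in_carrier[OF complete_lattice_lat A] u]
            sup_le_iff[OF complete_lattice_lat A] K[OF u] by simp
        moreover have "f a \<sqsubseteq>\<^bsub>N\<^esub> u \<longleftrightarrow> a \<sqsubseteq>\<^bsub>lat\<^esub> e (K u)" if "a \<in> A" for a
          by (rule f_le[OF _ u]) (use A that in auto)
        ultimately show "f (\<Squnion>\<^bsub>lat\<^esub> A) \<sqsubseteq>\<^bsub>N\<^esub> u \<longleftrightarrow> (\<forall>a \<in> f ` A. a \<sqsubseteq>\<^bsub>N\<^esub> u)"
          by simp
      qed (use A fN sup_in_carrier[OF complete_lattice_lat A] in auto)
    qed (use fN in \<open>simp_all add: f_def\<close>)
    moreover have "f (t a b) = s a b" if ab: "a \<in> carrier L" "b \<in> carrier M" for a b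
    proof (rule le_eqI[OF N'])
      fix u assume u: "u \<in> carrier N"
      show "f (t a b) \<sqsubseteq>\<^bsub>N\<^esub> u \<longleftrightarrow> s a b \<sqsubseteq>\<^bsub>N\<^esub> u"
        using f_le[OF bimorphismD(1)[OF bi ab] u] t_le[OF ab e_carrier[OF K[OF u]]] K[OF u] ab
        by (simp add: K_def)
    qed (use ab fN bimorphismD(1)[OF bi] bimorphismD(1)[OF s] in auto)
    ultimately show "\<exists>f. sup_map lat N f \<and> (\<forall>a \<in> carrier L. \<forall>b \<in> carrier M. f (t a b) = s a b)"
      by blast
  next
    fix f g
    assume f: "sup_map lat N f \<and> (\<forall>a \<in> carrier L. \<forall>b \<in> carrier M. f (t a b) = s a b)"
      and g: "sup_map lat N g \<and> (\<forall>a \<in> carrier L. \<forall>b \<in> carrier M. g (t a b) = s a b)"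
    show "f = g"
    proof (rule extensionalityI[of _ "carrier lat"])
      fix x assume x: "x \<in> carrier lat"
      have "f ` (\<lambda>(a, b). t a b) ` dec x = g ` (\<lambda>(a, b). t a b) ` dec x"
        unfolding image_image
        by (rule image_cong) (use f g closed_subset[OF dec_closed[OF x]] in auto)
      then show "f x = g x"
        using sup_mapD(3)[of lat N f, OF _ tX[OF x]] sup_mapD(3)[of lat N g, OF _ tX[OF x]] f g
          x_sup[OF x] by simp
    qed (use f g sup_mapD(1) in auto)
  qed
  have "universal_bimorphism L M lat t"
    unfolding universal_bimorphism_def using bi univ small_complete_lattice_lat by blast
  then show ?thesis by blast
qed

lemma universal_pure:
  assumes "small_complete_lattice (L :: 'u gorder)" "small_complete_lattice (M :: 'u gorder)"
  shows "universal_bimorphism L M (lattice_tensor L M) (pure L M)"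
proof -
  have "\<exists>p. universal_bimorphism L M (fst p) (snd p)"
    using universal_bimorphism_exists[OF assms] by auto
  then show ?thesis
    unfolding lattice_tensor_def pure_def chosen_bimorphism_def by (rule someI_ex)
qed

end

context strong_limit
begin

context
  fixes L M :: "'u gorder"
  assumes L: "small_complete_lattice L" and M: "small_complete_lattice M"
begin

lemma scl_tensor [simp]: "small_complete_lattice (lattice_tensor L M)"
  using universal_pure[OF L M] by (simp add: universal_bimorphism_def)

lemma bimorphism_pure: "bimorphism L M (lattice_tensor L M) (pure L M)"
  using universal_pure[OF L M] by (simp add: universal_bimorphism_def)

lemma pure_carrier [simp]:
  "\<lbrakk>a \<in> carrier L; b \<in> carrier M\<rbrakk> \<Longrightarrow> pure L M a b \<in> carrier (lattice_tensor L M)"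
  by (rule bimorphismD(1)[OF bimorphism_pure])

lemma tensor_lift_ex1:
  assumes "small_complete_lattice N" "bimorphism L M N s"
  shows "\<exists>!f. sup_map (lattice_tensor L M) N f \<and>
    (\<forall>a \<in> carrier L. \<forall>b \<in> carrier M. f (pure L M a b) = s a b)"
  using universal_pure[OF L M] assms by (simp add: universal_bimorphism_def)

lemma bimorphism_comp_pure:
  assumes f: "sup_map (lattice_tensor L M) N f"
  shows "bimorphism L M N (\<lambda>a \<in> carrier L. \<lambda>b \<in> carrier M. f (pure L M a b))"
proof (rule bimorphism_restrictI)
  fix A b assume A: "A \<subseteq> carrier L" "b \<in> carrier M"
  then have "(\<lambda>a. pure L M a b) ` A \<subseteq> carrier (lattice_tensor L M)" by auto
  then show "f (pure L M (\<Squnion>\<^bsub>L\<^esub> A) b) = \<Squnion>\<^bsub>N\<^esub> ((\<lambda>a. f (pure L M a b)) ` A)"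
    using sup_mapD(3)[OF f] bimorphismD(2)[OF bimorphism_pure A] by (simp add: image_image)
next
  fix a B assume B: "a \<in> carrier L" "B \<subseteq> carrier M"
  then have "pure L M a ` B \<subseteq> carrier (lattice_tensor L M)" by auto
  then show "f (pure L M a (\<Squnion>\<^bsub>M\<^esub> B)) = \<Squnion>\<^bsub>N\<^esub> ((\<lambda>b. f (pure L M a b)) ` B)"
    using sup_mapD(3)[OF f] bimorphismD(3)[OF bimorphism_pure B] by (simp add: image_image)
qed (use L M sup_mapD[OF f] in auto)

text \<open>Both maps classify the bimorphism sending \<open>(a, b)\<close> to
  \<open>f (pure L M a b)\<close>, so the uniqueness part of the universal property identifies
  them.\<close>

lemma tensor_ext:
  assumes N: "small_complete_lattice (N :: 'u gorder)"
    and f: "sup_map (lattice_tensor L M) N f" and g: "sup_map (lattice_tensor L M) N g"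
    and eq: "\<And>a b. \<lbrakk>a \<in> carrier L; b \<in> carrier M\<rbrakk> \<Longrightarrow> f (pure L M a b) = g (pure L M a b)"
  shows "f = g"
proof (rule ex1E[OF tensor_lift_ex1[OF N bimorphism_comp_pure[OF f]]])
  fix h
  assume h: "\<forall>f'. sup_map (lattice_tensor L M) N f' \<and>
    (\<forall>a \<in> carrier L. \<forall>b \<in> carrier M. f' (pure L M a b)
       = (\<lambda>a \<in> carrier L. \<lambda>b \<in> carrier M. f (pure L M a b)) a b) \<longrightarrow> f' = h"
  have "f = h" using h f by simp
  moreover have "g = h" using h g eq by simp
  ultimately show "f = g" by simp
qed

definition tensor_lift :: "'u gorder \<Rightarrow> ('u \<Rightarrow> 'u \<Rightarrow> 'u) \<Rightarrow> 'u \<Rightarrow> 'u" where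
  "tensor_lift N s = (THE f. sup_map (lattice_tensor L M) N f \<and>
    (\<forall>a \<in> carrier L. \<forall>b \<in> carrier M. f (pure L M a b) = s a b))"

lemma tensor_lift:
  assumes "small_complete_lattice N" "bimorphism L M N s"
  shows "sup_map (lattice_tensor L M) N (tensor_lift N s)"
    and "\<lbrakk>a \<in> carrier L; b \<in> carrier M\<rbrakk> \<Longrightarrow> tensor_lift N s (pure L M a b) = s a b"
  using theI'[OF tensor_lift_ex1[OF assms]] by (auto simp: tensor_lift_def)

lemma bimorphism_tensor_arrows:
  assumes f: "sup_map L L' f" and g: "sup_map M M' g"
    and L': "small_complete_lattice L'" and M': "small_complete_lattice M'"
    and t: "bimorphism L' M' N t" and N: "complete_lattice N"
  shows "bimorphism L M N (\<lambda>a \<in> carrier L. \<lambda>b \<in> carrier M. t (f a) (g b))"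
proof (rule bimorphism_restrictI)
  fix A b assume A: "A \<subseteq> carrier L" "b \<in> carrier M"
  then have "f ` A \<subseteq> carrier L'" using sup_mapD(2)[OF f] by auto
  then show "t (f (\<Squnion>\<^bsub>L\<^esub> A)) (g b) = \<Squnion>\<^bsub>N\<^esub> ((\<lambda>a. t (f a) (g b)) ` A)"
    using A sup_mapD(2)[OF g] by (simp add: sup_mapD(3)[OF f] bimorphismD(2)[OF t] image_image)
next
  fix a B assume B: "a \<in> carrier L" "B \<subseteq> carrier M"
  then have "g ` B \<subseteq> carrier M'" using sup_mapD(2)[OF g] by auto
  then show "t (f a) (g (\<Squnion>\<^bsub>M\<^esub> B)) = \<Squnion>\<^bsub>N\<^esub> ((\<lambda>b. t (f a) (g b)) ` B)"
    using B sup_mapD(2)[OF f] by (simp add: sup_mapD(3)[OF g] bimorphismD(3)[OF t] image_image)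
qed (use L M N sup_mapD(2)[OF f] sup_mapD(2)[OF g] bimorphismD(1)[OF t] in auto)

end

lemma sup_map_pure_left:
  assumes L: "small_complete_lattice (L :: 'u gorder)" and M: "small_complete_lattice (M :: 'u gorder)"
    and f: "sup_map (lattice_tensor L M) (N :: 'u gorder) f" and b: "b \<in> carrier M"
  shows "sup_map L N (\<lambda>a \<in> carrier L. f (pure L M a b))"
proof -
  note t = bimorphism_comp_pure[OF L M f]
  have "(\<lambda>a \<in> carrier L. f (pure L M a b)) = (\<lambda>a \<in> carrier L. (\<lambda>a \<in> carrier L. \<lambda>b \<in> carrier M. f (pure L M a b)) a b)"
    using b by auto
  moreover have "sup_map L N \<dots>"
  proof (rule sup_mapI)
    fix A assume A: "A \<subseteq> carrier L"
    let ?t = "\<lambda>a \<in> carrier L. \<lambda>b \<in> carrier M. f (pure L M a b)"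
    have "(\<lambda>a \<in> carrier L. ?t a b) ` A = (\<lambda>a. ?t a b) ` A" by (rule image_cong) (use A in auto)
    then show "(\<lambda>a \<in> carrier L. ?t a b) (\<Squnion>\<^bsub>L\<^esub> A) = \<Squnion>\<^bsub>N\<^esub> ((\<lambda>a \<in> carrier L. ?t a b) ` A)"
      using bimorphismD(2)[OF t A b] sup_in_carrier[OF scl_complete[OF L] A] by simp
  qed (use L sup_mapD[OF f] bimorphismD(1)[OF t _ b] in auto)
  ultimately show ?thesis by simp
qed

text \<open>Uniqueness is used twice: with \<open>c\<close> fixed, both maps become sup-maps on
  \<open>lattice_tensor L M\<close> that agree on pure tensors, hence they agree on
  \<open>pure t c\<close> for every \<open>t\<close>.\<close>

lemma tensor_ext3:
  assumes L: "small_complete_lattice (L :: 'u gorder)" and M: "small_complete_lattice (M :: 'u gorder)"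
    and N: "small_complete_lattice (N :: 'u gorder)" and P: "small_complete_lattice (P :: 'u gorder)"
    and f: "sup_map (lattice_tensor (lattice_tensor L M) N) P f"
    and g: "sup_map (lattice_tensor (lattice_tensor L M) N) P g"
    and eq: "\<And>a b c. \<lbrakk>a \<in> carrier L; b \<in> carrier M; c \<in> carrier N\<rbrakk> \<Longrightarrow>
      f (pure (lattice_tensor L M) N (pure L M a b) c) = g (pure (lattice_tensor L M) N (pure L M a b) c)"
  shows "f = g"
proof (rule tensor_ext[OF scl_tensor[OF L M] N P f g])
  fix t c assume t: "t \<in> carrier (lattice_tensor L M)" and c: "c \<in> carrier N"
  let ?LM = "lattice_tensor L M"
  have "(\<lambda>t \<in> carrier ?LM. f (pure ?LM N t c)) = (\<lambda>t \<in> carrier ?LM. g (pure ?LM N t c))"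
    by (rule tensor_ext[OF L M P sup_map_pure_left[OF scl_tensor[OF L M] N f c]
          sup_map_pure_left[OF scl_tensor[OF L M] N g c]])
       (use c eq pure_carrier[OF L M] in simp)
  from fun_cong[OF this, of t] t
  show "f (pure ?LM N t c) = g (pure ?LM N t c)" by simp
qed

section \<open>The tensor of arrows and the associator of sup-lattices\<close>

lemma sup_tensor_simps [simp]:
  "tobj sup_tensor = lattice_tensor"
  by (simp add: sup_tensor_def)

text \<open>The \<open>THE\<close> in \<open>sup_tensor\<close> denotes: an arrow with the required
  values is obtained by lifting a bimorphism, and it is unique since pure tensors determine
  it.\<close>

lemma sup_tensor_tarr:
  fixes f g :: "('u gorder, 'u \<Rightarrow> 'u) arrow"
  assumes f: "f \<in> Arr SupCat" and g: "g \<in> Arr SupCat"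
  shows "f \<otimes>\<^bsub>sup_tensor\<^esub> g \<in> Arr SupCat"
    "adom (f \<otimes>\<^bsub>sup_tensor\<^esub> g) = lattice_tensor (adom f) (adom g)"
    "acod (f \<otimes>\<^bsub>sup_tensor\<^esub> g) = lattice_tensor (acod f) (acod g)"
    "\<lbrakk>a \<in> carrier (adom f); b \<in> carrier (adom g)\<rbrakk> \<Longrightarrow>
      adat (f \<otimes>\<^bsub>sup_tensor\<^esub> g) (pure (adom f) (adom g) a b)
        = pure (acod f) (acod g) (adat f a) (adat g b)"
proof -
  have L: "small_complete_lattice (adom f)" "small_complete_lattice (adom g)"
    "small_complete_lattice (acod f)" "small_complete_lattice (acod g)"
    and fg: "sup_map (adom f) (acod f) (adat f)" "sup_map (adom g) (acod g) (adat g)"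
    using f g by (auto simp: SupCat_Arr)
  let ?P = "lattice_tensor (adom f) (adom g)" and ?Q = "lattice_tensor (acod f) (acod g)"
  note P = scl_tensor[OF L(1,2)] and Q = scl_tensor[OF L(3,4)]
  let ?s = "\<lambda>a \<in> carrier (adom f). \<lambda>b \<in> carrier (adom g). pure (acod f) (acod g) (adat f a) (adat g b)"
  have s: "bimorphism (adom f) (adom g) ?Q ?s"
    by (rule bimorphism_tensor_arrows[OF L(1,2) fg L(3,4) bimorphism_pure[OF L(3,4)]]) (simp add: Q)
  define P where "P h \<longleftrightarrow> h \<in> Hom SupCat ?P ?Q \<and>
    (\<forall>a \<in> carrier (adom f). \<forall>b \<in> carrier (adom g).
      adat h (pure (adom f) (adom g) a b) = pure (acod f) (acod g) (adat f a) (adat g b))" for h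
  have "\<exists>!h. P h"
  proof (rule ex_ex1I)
    have "P \<lparr>adom = ?P, acod = ?Q, adat = tensor_lift (adom f) (adom g) ?Q ?s\<rparr>"
      unfolding P_def using tensor_lift[OF L(1,2) Q s] P Q by (simp add: Hom_def SupCat_Arr)
    then show "\<exists>h. P h" ..
  next
    fix h k assume hk: "P h" "P k"
    show "h = k"
    proof (rule arrow_eqI)
      show "adat h = adat k"
        by (rule tensor_ext[OF L(1,2) Q]) (use hk in \<open>auto simp: P_def Hom_def SupCat_Arr\<close>)
    qed (use hk in \<open>auto simp: P_def Hom_def\<close>)
  qed
  moreover have "f \<otimes>\<^bsub>sup_tensor\<^esub> g = (THE h. P h)" by (simp add: sup_tensor_def P_def)
  ultimately have "P (f \<otimes>\<^bsub>sup_tensor\<^esub> g)" using theI'[of P] by simp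
  then show "f \<otimes>\<^bsub>sup_tensor\<^esub> g \<in> Arr SupCat"
    "adom (f \<otimes>\<^bsub>sup_tensor\<^esub> g) = lattice_tensor (adom f) (adom g)"
    "acod (f \<otimes>\<^bsub>sup_tensor\<^esub> g) = lattice_tensor (acod f) (acod g)"
    "\<lbrakk>a \<in> carrier (adom f); b \<in> carrier (adom g)\<rbrakk> \<Longrightarrow>
      adat (f \<otimes>\<^bsub>sup_tensor\<^esub> g) (pure (adom f) (adom g) a b)
        = pure (acod f) (acod g) (adat f a) (adat g b)"
    by (auto simp: P_def Hom_def)
qed

text \<open>The associator is built by currying. For fixed \<open>c\<close> the assignment of
  \<open>a \<otimes> (b \<otimes> c)\<close> to \<open>(a, b)\<close> is a bimorphism, classified by
  a sup-map \<open>g c\<close> on the tensor of \<open>L\<close> and \<open>M\<close>. The values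
  \<open>g c t\<close> then form a bimorphism in \<open>t\<close> and \<open>c\<close>, whose
  classifying map is the associator.\<close>

lemma sup_tensor_assoc:
  assumes L: "small_complete_lattice (L :: 'u gorder)" and M: "small_complete_lattice (M :: 'u gorder)"
    and N: "small_complete_lattice (N :: 'u gorder)"
  shows "assoc sup_tensor L M N \<in> Arr SupCat"
    "adom (assoc sup_tensor L M N) = lattice_tensor (lattice_tensor L M) N"
    "acod (assoc sup_tensor L M N) = lattice_tensor L (lattice_tensor M N)"
    "\<lbrakk>a \<in> carrier L; b \<in> carrier M; c \<in> carrier N\<rbrakk> \<Longrightarrow>
      adat (assoc sup_tensor L M N) (pure (lattice_tensor L M) N (pure L M a b) c)
        = pure L (lattice_tensor M N) a (pure M N b c)"
proof -
  let ?LM = "lattice_tensor L M" and ?MN = "lattice_tensor M N"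
  note LM = scl_tensor[OF L M] and MN = scl_tensor[OF M N]
  let ?P = "lattice_tensor ?LM N" and ?Q = "lattice_tensor L ?MN"
  note P = scl_tensor[OF LM N] and Q = scl_tensor[OF L MN]
  note bMN = bimorphism_pure[OF M N] and bQ = bimorphism_pure[OF L MN]
  note cMN = pure_carrier[OF M N] and cQ = pure_carrier[OF L MN]
  define s where "s c = (\<lambda>a \<in> carrier L. \<lambda>b \<in> carrier M. pure L ?MN a (pure M N b c))" for c
  have s_bi: "bimorphism L M ?Q (s c)" if c: "c \<in> carrier N" for c
    unfolding s_def
  proof (rule bimorphism_restrictI)
    fix A b assume "A \<subseteq> carrier L" "b \<in> carrier M"
    then show "pure L ?MN (\<Squnion>\<^bsub>L\<^esub> A) (pure M N b c) = \<Squnion>\<^bsub>?Q\<^esub> ((\<lambda>a. pure L ?MN a (pure M N b c)) ` A)"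
      using c cMN by (simp add: bimorphismD(2)[OF bQ])
  next
    fix a B assume B: "a \<in> carrier L" "B \<subseteq> carrier M"
    then have "(\<lambda>b. pure M N b c) ` B \<subseteq> carrier ?MN" using c cMN by auto
    then show "pure L ?MN a (pure M N (\<Squnion>\<^bsub>M\<^esub> B) c) = \<Squnion>\<^bsub>?Q\<^esub> ((\<lambda>b. pure L ?MN a (pure M N b c)) ` B)"
      using B c by (simp add: bimorphismD(2)[OF bMN] bimorphismD(3)[OF bQ] image_image)
  qed (use L M Q c cMN cQ in auto)
  define g where "g c = tensor_lift L M ?Q (s c)" for c
  have g: "sup_map ?LM ?Q (g c)" if "c \<in> carrier N" for c
    unfolding g_def by (rule tensor_lift(1)[OF L M Q s_bi[OF that]])
  have g_pure: "g c (pure L M a b) = pure L ?MN a (pure M N b c)"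
    if "a \<in> carrier L" "b \<in> carrier M" "c \<in> carrier N" for a b c
    unfolding g_def using tensor_lift(2)[OF L M Q s_bi[OF that(3)]] that by (simp add: s_def)
  \<comment> \<open>The delicate point is preservation of suprema in \<open>c\<close> at an
    arbitrary \<open>t\<close>, where \<open>g c t\<close> has no explicit value. Since the
    pointwise supremum on the right is itself a sup-map, comparison on pure tensors is
    enough.\<close>
  have g_sup: "g (\<Squnion>\<^bsub>N\<^esub> C) = (\<lambda>t \<in> carrier ?LM. \<Squnion>\<^bsub>?Q\<^esub> ((\<lambda>h. h t) ` g ` C))"
    if C: "C \<subseteq> carrier N" for C
  proof (rule tensor_ext[OF L M Q])
    have C': "\<Squnion>\<^bsub>N\<^esub> C \<in> carrier N" using sup_in_carrier[OF scl_complete[OF N] C] .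
    then show "sup_map ?LM ?Q (g (\<Squnion>\<^bsub>N\<^esub> C))" by (rule g)
    show "sup_map ?LM ?Q (\<lambda>t \<in> carrier ?LM. \<Squnion>\<^bsub>?Q\<^esub> ((\<lambda>h. h t) ` g ` C))"
      by (rule sup_map_pointwise) (use LM Q C g in auto)
    fix a b assume ab: "a \<in> carrier L" "b \<in> carrier M"
    have "pure M N b ` C \<subseteq> carrier ?MN" using C cMN ab by auto
    then have "g (\<Squnion>\<^bsub>N\<^esub> C) (pure L M a b) = \<Squnion>\<^bsub>?Q\<^esub> ((\<lambda>c. pure L ?MN a (pure M N b c)) ` C)"
      using ab C C' by (simp add: g_pure bimorphismD(3)[OF bMN] bimorphismD(3)[OF bQ] image_image)
    also have "(\<lambda>c. pure L ?MN a (pure M N b c)) ` C = (\<lambda>c. g c (pure L M a b)) ` C"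
      by (rule image_cong) (use ab C g_pure in auto)
    finally show "g (\<Squnion>\<^bsub>N\<^esub> C) (pure L M a b)
        = (\<lambda>t \<in> carrier ?LM. \<Squnion>\<^bsub>?Q\<^esub> ((\<lambda>h. h t) ` g ` C)) (pure L M a b)"
      using ab pure_carrier[OF L M] by (simp add: image_image)
  qed
  define s' where "s' = (\<lambda>t \<in> carrier ?LM. \<lambda>c \<in> carrier N. g c t)"
  have s': "bimorphism ?LM N ?Q s'"
    unfolding s'_def
  proof (rule bimorphism_restrictI)
    fix t C assume "t \<in> carrier ?LM" "C \<subseteq> carrier N"
    then show "g (\<Squnion>\<^bsub>N\<^esub> C) t = \<Squnion>\<^bsub>?Q\<^esub> ((\<lambda>c. g c t) ` C)"
      using g_sup by (simp add: image_image)
  qed (use LM N Q sup_mapD(2,3)[OF g] in auto)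
  define P where "P h \<longleftrightarrow> h \<in> Hom SupCat ?P ?Q \<and>
    (\<forall>a \<in> carrier L. \<forall>b \<in> carrier M. \<forall>c \<in> carrier N.
      adat h (pure ?LM N (pure L M a b) c) = pure L ?MN a (pure M N b c))" for h
  have "\<exists>!h. P h"
  proof (rule ex_ex1I)
    have "P \<lparr>adom = ?P, acod = ?Q, adat = tensor_lift ?LM N ?Q s'\<rparr>"
      unfolding P_def using tensor_lift[OF LM N Q s'] P Q pure_carrier[OF L M]
      by (simp add: Hom_def SupCat_Arr s'_def g_pure)
    then show "\<exists>h. P h" ..
  next
    fix h k assume hk: "P h" "P k"
    show "h = k"
    proof (rule arrow_eqI)
      show "adat h = adat k"
        by (rule tensor_ext3[OF L M N Q]) (use hk in \<open>auto simp: P_def Hom_def SupCat_Arr\<close>)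
    qed (use hk in \<open>auto simp: P_def Hom_def\<close>)
  qed
  moreover have "assoc sup_tensor L M N = (THE h. P h)" by (simp add: sup_tensor_def P_def)
  ultimately have "P (assoc sup_tensor L M N)" using theI'[of P] by simp
  then show "assoc sup_tensor L M N \<in> Arr SupCat"
    "adom (assoc sup_tensor L M N) = lattice_tensor (lattice_tensor L M) N"
    "acod (assoc sup_tensor L M N) = lattice_tensor L (lattice_tensor M N)"
    "\<lbrakk>a \<in> carrier L; b \<in> carrier M; c \<in> carrier N\<rbrakk> \<Longrightarrow>
      adat (assoc sup_tensor L M N) (pure (lattice_tensor L M) N (pure L M a b) c)
        = pure L (lattice_tensor M N) a (pure M N b c)"
    by (auto simp: P_def Hom_def)
qed

lemma SupCat_tensor_eqI:
  fixes h k :: "('u gorder, 'u \<Rightarrow> 'u) arrow"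
  assumes "h \<in> Arr SupCat" "k \<in> Arr SupCat"
    and "adom h = lattice_tensor L M" "adom k = lattice_tensor L M" "acod h = acod k"
    and "small_complete_lattice L" "small_complete_lattice M"
    and "\<And>a b. \<lbrakk>a \<in> carrier L; b \<in> carrier M\<rbrakk> \<Longrightarrow> adat h (pure L M a b) = adat k (pure L M a b)"
  shows "h = k"
proof (rule arrow_eqI)
  show "adat h = adat k"
    by (rule tensor_ext[OF assms(6,7)]) (use assms in \<open>auto simp: SupCat_Arr\<close>)
qed (use assms in auto)

lemma SupCat_tensor3_eqI:
  fixes h k :: "('u gorder, 'u \<Rightarrow> 'u) arrow"
  assumes "h \<in> Arr SupCat" "k \<in> Arr SupCat"
    and "adom h = lattice_tensor (lattice_tensor L M) N" "adom k = lattice_tensor (lattice_tensor L M) N"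
    and "acod h = acod k"
    and "small_complete_lattice L" "small_complete_lattice M" "small_complete_lattice N"
    and "\<And>a b c. \<lbrakk>a \<in> carrier L; b \<in> carrier M; c \<in> carrier N\<rbrakk> \<Longrightarrow>
      adat h (pure (lattice_tensor L M) N (pure L M a b) c) = adat k (pure (lattice_tensor L M) N (pure L M a b) c)"
  shows "h = k"
proof (rule arrow_eqI)
  show "adat h = adat k"
    by (rule tensor_ext3[OF assms(6-8)]) (use assms in \<open>auto simp: SupCat_Arr\<close>)
qed (use assms in auto)

lemma SupCat_ArrD:
  assumes "f \<in> Arr SupCat"
  shows "small_complete_lattice (adom f)" "small_complete_lattice (acod f)"
    "x \<in> carrier (adom f) \<Longrightarrow> adat f x \<in> carrier (acod f)"
  using assms sup_mapD(2) by (auto simp: SupCat_Arr)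

text \<open>Each law equates two arrows out of a twofold or threefold tensor. Once both are known to
  be arrows with the same ends, evaluation at pure tensors decides the equation.\<close>

lemma semigroupal_SupCat: "semigroupal_category (SupCat :: ('u gorder, _) cat) sup_tensor"
proof -
  interpret category "SupCat :: ('u gorder, _) cat" by (rule category_SupCat)
  note A = SupCat_ArrD and T = sup_tensor_tarr and \<alpha> = sup_tensor_assoc
    and p = pure_carrier and S = scl_tensor
  show ?thesis
  proof (unfold_locales)
    fix L M :: "'u gorder" assume "L \<in> Obj SupCat" "M \<in> Obj SupCat"
    then have LM: "small_complete_lattice L" "small_complete_lattice M" by auto
    note I = Idn_arr[of L, unfolded SupCat_simps] Idn_arr[of M, unfolded SupCat_simps]
      Idn_arr[of "lattice_tensor L M", unfolded SupCat_simps]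
    show "Idn SupCat L \<otimes>\<^bsub>sup_tensor\<^esub> Idn SupCat M = Idn SupCat (L \<boxtimes>\<^bsub>sup_tensor\<^esub> M)"
      by (rule SupCat_tensor_eqI[of _ _ L M])
        (use LM I T[OF I(1) I(4)] S[OF LM] p[OF LM] in simp_all)
  next
    fix f f' g g' :: "('u gorder, 'u \<Rightarrow> 'u) arrow"
    assume f: "f \<in> Arr SupCat" and f': "f' \<in> Arr SupCat" and g: "g \<in> Arr SupCat"
      and g': "g' \<in> Arr SupCat" and eq: "Dom SupCat f' = Cod SupCat f" "Dom SupCat g' = Cod SupCat g"
    have ff: "f' \<cdot>\<^bsub>SupCat\<^esub> f \<in> Arr SupCat" and gg: "g' \<cdot>\<^bsub>SupCat\<^esub> g \<in> Arr SupCat"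
      using f f' g g' eq by (auto intro!: Cmp_arr simp del: SupCat_simps(4))
    have tt: "(f' \<otimes>\<^bsub>sup_tensor\<^esub> g') \<cdot>\<^bsub>SupCat\<^esub> (f \<otimes>\<^bsub>sup_tensor\<^esub> g) \<in> Arr SupCat"
      by (rule Cmp_arr) (use T(1-3)[OF f g] T(1-3)[OF f' g'] eq in simp_all)
    note T0 = T[OF f g] and T1 = T[OF f' g'] and T2 = T[OF ff gg, simplified]
    show "(f' \<cdot>\<^bsub>SupCat\<^esub> f) \<otimes>\<^bsub>sup_tensor\<^esub> (g' \<cdot>\<^bsub>SupCat\<^esub> g)
        = (f' \<otimes>\<^bsub>sup_tensor\<^esub> g') \<cdot>\<^bsub>SupCat\<^esub> (f \<otimes>\<^bsub>sup_tensor\<^esub> g)"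
      by (rule SupCat_tensor_eqI[OF T(1)[OF ff gg] tt, of "adom f" "adom g"])
        (use T0 T1 T2 A[OF f] A[OF g] p[OF A(1)[OF f] A(1)[OF g]] eq in \<open>simp_all add: compose_eq\<close>)
  next
    fix f g h :: "('u gorder, 'u \<Rightarrow> 'u) arrow"
    assume f: "f \<in> Arr SupCat" and g: "g \<in> Arr SupCat" and h: "h \<in> Arr SupCat"
    note fg = T[OF f g] and gh = T[OF g h]
    note fgh = T[OF fg(1) h, unfolded fg(2,3)] and fgh' = T[OF f gh(1), unfolded gh(2,3)]
    note \<alpha>1 = \<alpha>[OF A(1)[OF f] A(1)[OF g] A(1)[OF h]] and \<alpha>2 = \<alpha>[OF A(2)[OF f] A(2)[OF g] A(2)[OF h]]
    note p1 = p[OF A(1)[OF f] A(1)[OF g]] p[OF A(1)[OF g] A(1)[OF h]]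
      p[OF S[OF A(1)[OF f] A(1)[OF g]] A(1)[OF h]]
    have c1: "assoc sup_tensor (acod f) (acod g) (acod h) \<cdot>\<^bsub>SupCat\<^esub> ((f \<otimes>\<^bsub>sup_tensor\<^esub> g) \<otimes>\<^bsub>sup_tensor\<^esub> h) \<in> Arr SupCat"
      by (rule Cmp_arr) (use fgh \<alpha>2 in simp_all)
    have c2: "(f \<otimes>\<^bsub>sup_tensor\<^esub> (g \<otimes>\<^bsub>sup_tensor\<^esub> h)) \<cdot>\<^bsub>SupCat\<^esub> assoc sup_tensor (adom f) (adom g) (adom h) \<in> Arr SupCat"
      by (rule Cmp_arr) (use fgh' \<alpha>1 in simp_all)
    show "assoc sup_tensor (Cod SupCat f) (Cod SupCat g) (Cod SupCat h) \<cdot>\<^bsub>SupCat\<^esub> ((f \<otimes>\<^bsub>sup_tensor\<^esub> g) \<otimes>\<^bsub>sup_tensor\<^esub> h)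
        = (f \<otimes>\<^bsub>sup_tensor\<^esub> (g \<otimes>\<^bsub>sup_tensor\<^esub> h)) \<cdot>\<^bsub>SupCat\<^esub> assoc sup_tensor (Dom SupCat f) (Dom SupCat g) (Dom SupCat h)"
      unfolding SupCat_simps(1,2)
      by (rule SupCat_tensor3_eqI[OF c1 c2, of "adom f" "adom g" "adom h"])
        (use A[OF f] A[OF g] A[OF h] p1 fg gh fgh fgh' \<alpha>1 \<alpha>2 in \<open>simp_all add: compose_eq\<close>)
  qed (simp_all add: scl_tensor sup_tensor_tarr sup_tensor_assoc)
qed

end

section \<open>Quantales as semigroup objects\<close>

definition sup_part :: "'u quantale \<Rightarrow> 'u gorder" where
  "sup_part Q = \<lparr>carrier = carrier Q, eq = eq Q, le = le Q\<rparr>"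

lemma sup_part_simps [simp]:
  "carrier (sup_part Q) = carrier Q" "eq (sup_part Q) = eq Q" "le (sup_part Q) = le Q"
  by (simp_all add: sup_part_def)

lemma sup_part_sup [simp]: "\<Squnion>\<^bsub>sup_part Q\<^esub> A = \<Squnion>\<^bsub>Q\<^esub> A"
  by (rule lattice_sup_cong) simp_all

lemma sup_part_complete [simp]: "complete_lattice (sup_part Q) \<longleftrightarrow> complete_lattice Q"
  by (rule complete_lattice_cong) simp_all

lemma sup_part_scl [simp]: "small_complete_lattice (sup_part Q) \<longleftrightarrow> small_complete_lattice Q"
  by (simp add: small_complete_lattice_def)

lemma sup_part_sup_map [simp]: "sup_map (sup_part Q) (sup_part P) f \<longleftrightarrow> sup_map Q P f"
  by (simp add: sup_map_def sup_pres_def)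

lemma Quant_Obj [simp]: "Q \<in> Obj Quant \<longleftrightarrow> is_quantale Q"
  by (simp add: Quant_def)

lemma Quant_Arr: "F \<in> Arr Quant \<longleftrightarrow> is_quantale (adom F) \<and> is_quantale (acod F) \<and>
    quantale_map (adom F) (acod F) (adat F)"
  by (cases F) (auto simp: Quant_def)

lemma Quant_simps [simp]:
  "Dom Quant = adom" "Cod Quant = acod"
  "Idn Quant L = \<lparr>adom = L, acod = L, adat = \<lambda>x \<in> carrier L. x\<rparr>"
  "Cmp Quant G F = \<lparr>adom = adom F, acod = acod G, adat = compose (carrier (adom F)) (adat G) (adat F)\<rparr>"
  by (simp_all add: Quant_def)

lemma is_quantaleD:
  assumes "is_quantale Q"
  shows "small_complete_lattice Q" "complete_lattice Q"
    "qmul Q \<in> carrier Q \<rightarrow>\<^sub>E carrier Q \<rightarrow>\<^sub>E carrier Q"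
    "\<lbrakk>a \<in> carrier Q; b \<in> carrier Q\<rbrakk> \<Longrightarrow> qmul Q a b \<in> carrier Q"
    "\<lbrakk>a \<in> carrier Q; b \<in> carrier Q; c \<in> carrier Q\<rbrakk> \<Longrightarrow> qmul Q (qmul Q a b) c = qmul Q a (qmul Q b c)"
    "\<lbrakk>A \<subseteq> carrier Q; b \<in> carrier Q\<rbrakk> \<Longrightarrow> qmul Q (\<Squnion>\<^bsub>Q\<^esub> A) b = \<Squnion>\<^bsub>Q\<^esub> ((\<lambda>a. qmul Q a b) ` A)"
    "\<lbrakk>A \<subseteq> carrier Q; b \<in> carrier Q\<rbrakk> \<Longrightarrow> qmul Q b (\<Squnion>\<^bsub>Q\<^esub> A) = \<Squnion>\<^bsub>Q\<^esub> ((\<lambda>a. qmul Q b a) ` A)"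
  using assms by (auto simp: is_quantale_def)

lemma quantale_mapD:
  assumes "quantale_map Q P f"
  shows "sup_map Q P f" "\<lbrakk>a \<in> carrier Q; b \<in> carrier Q\<rbrakk> \<Longrightarrow> f (qmul Q a b) = qmul P (f a) (f b)"
  using assms by (auto simp: quantale_map_def)

lemma quantale_map_Idn: "is_quantale Q \<Longrightarrow> quantale_map Q Q (\<lambda>x \<in> carrier Q. x)"
  by (simp add: quantale_map_def sup_map_Idn is_quantaleD)

lemma quantale_map_compose:
  assumes "is_quantale Q" "quantale_map Q P f" "quantale_map P R g"
  shows "quantale_map Q R (compose (carrier Q) g f)"
  using assms is_quantaleD(4)[OF assms(1)] sup_mapD(2)[OF quantale_mapD(1)[OF assms(2)]]
  by (simp add: quantale_map_def sup_map_compose[of Q P f R g] compose_eq)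

lemma category_Quant: "category Quant"
proof
  fix f :: "('u quantale, 'u \<Rightarrow> 'u) arrow" and g A B D
  assume "f \<in> Hom Quant A B" "g \<in> Hom Quant B D"
  then show "g \<cdot>\<^bsub>Quant\<^esub> f \<in> Hom Quant A D"
    by (auto simp: Hom_def Quant_Arr intro: quantale_map_compose)
next
  fix f :: "('u quantale, 'u \<Rightarrow> 'u) arrow" and g h :: "('u quantale, 'u \<Rightarrow> 'u) arrow" and A B D E
  assume "f \<in> Hom Quant A B" "g \<in> Hom Quant B D" "h \<in> Hom Quant D E"
  then have "adat f \<in> carrier A \<rightarrow> carrier B" "adom f = A" "adom g = B"
    using sup_mapD(2)[OF quantale_mapD(1), of A B "adat f"] by (auto simp: Hom_def Quant_Arr)
  then show "(h \<cdot>\<^bsub>Quant\<^esub> g) \<cdot>\<^bsub>Quant\<^esub> f = h \<cdot>\<^bsub>Quant\<^esub> (g \<cdot>\<^bsub>Quant\<^esub> f)"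
    by (simp add: compose_assoc)
next
  fix f :: "('u quantale, 'u \<Rightarrow> 'u) arrow" and A B
  assume f: "f \<in> Hom Quant A B"
  then have "adat f \<in> carrier A \<rightarrow> carrier B" "adat f \<in> extensional (carrier A)"
    using sup_mapD(1,2)[OF quantale_mapD(1), of A B "adat f"] by (auto simp: Hom_def Quant_Arr)
  then have "compose (carrier A) (\<lambda>x \<in> carrier B. x) (adat f) = adat f"
    "compose (carrier A) (adat f) (\<lambda>x \<in> carrier A. x) = adat f"
    by (rule Id_compose compose_Id)+
  with f show "Idn Quant B \<cdot>\<^bsub>Quant\<^esub> f = f" "f \<cdot>\<^bsub>Quant\<^esub> Idn Quant A = f"
    by (auto simp: Hom_def intro!: arrow_eqI)
qed (auto simp: Hom_def Quant_Arr quantale_map_Idn)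

text \<open>\<open>tensor_lift\<close> is used here outside its context: the two factors come before
  the codomain and the bimorphism.\<close>

definition quantale_mul_arrow :: "'u quantale \<Rightarrow> ('u gorder, 'u \<Rightarrow> 'u) arrow" where
  "quantale_mul_arrow Q = (let L = sup_part Q in
     \<lparr>adom = lattice_tensor L L, acod = L, adat = strong_limit.tensor_lift L L L (qmul Q)\<rparr>)"

definition Quant_to_SGrp where
  "Quant_to_SGrp =
    (let ob = \<lambda>Q. (sup_part Q, quantale_mul_arrow Q)
     in \<lparr>on_obj = ob,
         on_arr = \<lambda>f. \<lparr>adom = ob (adom f), acod = ob (acod f),
           adat = \<lparr>adom = sup_part (adom f), acod = sup_part (acod f), adat = adat f\<rparr>\<rparr>\<rparr>)"

lemma Quant_to_SGrp_simps [simp]: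
  "on_obj Quant_to_SGrp Q = (sup_part Q, quantale_mul_arrow Q)"
  "on_arr Quant_to_SGrp f = \<lparr>adom = (sup_part (adom f), quantale_mul_arrow (adom f)),
     acod = (sup_part (acod f), quantale_mul_arrow (acod f)),
     adat = \<lparr>adom = sup_part (adom f), acod = sup_part (acod f), adat = adat f\<rparr>\<rparr>"
  by (simp_all add: Quant_to_SGrp_def)

context strong_limit
begin

text \<open>The two sides of the law are arrows out of a threefold tensor. On threefold pure tensors
  their values are the two bracketings of \<open>\<mu>\<close>, and these values determine the
  arrows.\<close>

lemma semigroup_object_SupCat:
  fixes L :: "'u gorder" and m :: "('u gorder, 'u \<Rightarrow> 'u) arrow"
  assumes L: "small_complete_lattice L"
    and m: "m \<in> Arr SupCat" "adom m = lattice_tensor L L" "acod m = L"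
  defines "\<mu> \<equiv> \<lambda>a b. adat m (pure L L a b)"
  shows "semigroup_object SupCat sup_tensor (L, m) \<longleftrightarrow>
    (\<forall>a \<in> carrier L. \<forall>b \<in> carrier L. \<forall>c \<in> carrier L. \<mu> (\<mu> a b) c = \<mu> a (\<mu> b c))"
proof -
  interpret semigroupal_category "SupCat :: ('u gorder, _) cat" sup_tensor
    by (rule semigroupal_SupCat)
  let ?I = "Idn SupCat L" and ?LL = "lattice_tensor L L"
  have I: "?I \<in> Arr SupCat" "adom ?I = L" "acod ?I = L" "\<And>x. x \<in> carrier L \<Longrightarrow> adat ?I x = x"
    using Idn_arr[of L] L by simp_all
  note LL = scl_tensor[OF L L]
  note mI = sup_tensor_tarr[OF m(1) I(1), unfolded m(2,3) I(2,3)]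
  note Im = sup_tensor_tarr[OF I(1) m(1), unfolded m(2,3) I(2,3)]
  note \<alpha> = sup_tensor_assoc[OF L L L]
  note p = pure_carrier[OF L L] pure_carrier[OF LL L] pure_carrier[OF L LL]
  have mc: "adat m x \<in> carrier L" if "x \<in> carrier ?LL" for x
    using SupCat_ArrD(3)[OF m(1)] m that by simp
  define l r where "l = m \<cdot>\<^bsub>SupCat\<^esub> (m \<otimes>\<^bsub>sup_tensor\<^esub> ?I)"
    and "r = m \<cdot>\<^bsub>SupCat\<^esub> (?I \<otimes>\<^bsub>sup_tensor\<^esub> m) \<cdot>\<^bsub>SupCat\<^esub> assoc sup_tensor L L L"
  have lA: "l \<in> Arr SupCat" unfolding l_def
    by (rule Cmp_arr) (use m mI in simp_all)
  have rA: "r \<in> Arr SupCat" unfolding r_def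
    by (rule Cmp_arr, rule Cmp_arr) (use m Im \<alpha> in simp_all)
  have dom: "adom l = lattice_tensor ?LL L" "acod l = L" "adom r = lattice_tensor ?LL L" "acod r = L"
    unfolding l_def r_def using m mI Im \<alpha> by simp_all
  have l: "adat l (pure ?LL L (pure L L a b) c) = \<mu> (\<mu> a b) c"
    and r: "adat r (pure ?LL L (pure L L a b) c) = \<mu> a (\<mu> b c)"
    if "a \<in> carrier L" "b \<in> carrier L" "c \<in> carrier L" for a b c
    unfolding l_def r_def \<mu>_def using that m mI Im \<alpha> p I by (simp_all add: compose_eq)
  have "l = r \<longleftrightarrow> (\<forall>a \<in> carrier L. \<forall>b \<in> carrier L. \<forall>c \<in> carrier L. \<mu> (\<mu> a b) c = \<mu> a (\<mu> b c))"
  proof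
    assume "\<forall>a \<in> carrier L. \<forall>b \<in> carrier L. \<forall>c \<in> carrier L. \<mu> (\<mu> a b) c = \<mu> a (\<mu> b c)"
    then show "l = r"
      by (intro SupCat_tensor3_eqI[OF lA rA dom(1,3) _ L L L]) (use dom l r in simp_all)
  qed (use l r in metis)
  moreover have "semigroup_object SupCat sup_tensor (L, m) \<longleftrightarrow> l = r"
    using L m by (simp add: semigroup_object_def Hom_def l_def r_def)
  ultimately show ?thesis by simp
qed

lemma semigroup_hom_SupCat:
  fixes L M :: "'u gorder" and m n f :: "('u gorder, 'u \<Rightarrow> 'u) arrow"
  assumes L: "small_complete_lattice L" and M: "small_complete_lattice M"
    and m: "m \<in> Arr SupCat" "adom m = lattice_tensor L L" "acod m = L"
    and n: "n \<in> Arr SupCat" "adom n = lattice_tensor M M" "acod n = M"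
    and f: "f \<in> Arr SupCat" "adom f = L" "acod f = M"
  shows "semigroup_hom SupCat sup_tensor (L, m) (M, n) f \<longleftrightarrow>
    (\<forall>a \<in> carrier L. \<forall>b \<in> carrier L.
       adat f (adat m (pure L L a b)) = adat n (pure M M (adat f a) (adat f b)))"
proof -
  interpret semigroupal_category "SupCat :: ('u gorder, _) cat" sup_tensor
    by (rule semigroupal_SupCat)
  note ff = sup_tensor_tarr[OF f(1) f(1), unfolded f(2,3)]
  note p = pure_carrier[OF L L]
  define l r where "l = f \<cdot>\<^bsub>SupCat\<^esub> m" and "r = n \<cdot>\<^bsub>SupCat\<^esub> (f \<otimes>\<^bsub>sup_tensor\<^esub> f)"
  have lA: "l \<in> Arr SupCat" unfolding l_def
    by (rule Cmp_arr) (use m f in simp_all)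
  have rA: "r \<in> Arr SupCat" unfolding r_def
    by (rule Cmp_arr) (use n ff in simp_all)
  have dom: "adom l = lattice_tensor L L" "acod l = M" "adom r = lattice_tensor L L" "acod r = M"
    unfolding l_def r_def using m n f ff by simp_all
  have l: "adat l (pure L L a b) = adat f (adat m (pure L L a b))"
    and r: "adat r (pure L L a b) = adat n (pure M M (adat f a) (adat f b))"
    if "a \<in> carrier L" "b \<in> carrier L" for a b
    unfolding l_def r_def using that m n f ff p by (simp_all add: compose_eq)
  have "l = r \<longleftrightarrow> (\<forall>a \<in> carrier L. \<forall>b \<in> carrier L.
       adat f (adat m (pure L L a b)) = adat n (pure M M (adat f a) (adat f b)))"
  proof
    assume "\<forall>a \<in> carrier L. \<forall>b \<in> carrier L.
       adat f (adat m (pure L L a b)) = adat n (pure M M (adat f a) (adat f b))"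
    then show "l = r"
      by (intro SupCat_tensor_eqI[OF lA rA dom(1,3) _ L L]) (use dom l r in simp_all)
  qed (use l r in metis)
  moreover have "semigroup_hom SupCat sup_tensor (L, m) (M, n) f \<longleftrightarrow> l = r"
    using f by (simp add: semigroup_hom_def l_def r_def)
  ultimately show ?thesis by simp
qed

lemma bimorphism_qmul:
  assumes "is_quantale Q"
  shows "bimorphism (sup_part Q) (sup_part Q) (sup_part Q) (qmul Q)"
  by (rule bimorphismI) (use is_quantaleD[OF assms] in \<open>simp_all add: image_def\<close>)

lemma quantale_mul_arrow:
  assumes "is_quantale (Q :: 'u quantale)"
  shows "quantale_mul_arrow Q \<in> Arr SupCat"
    "adom (quantale_mul_arrow Q) = lattice_tensor (sup_part Q) (sup_part Q)"
    "acod (quantale_mul_arrow Q) = sup_part Q"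
    "\<lbrakk>a \<in> carrier Q; b \<in> carrier Q\<rbrakk> \<Longrightarrow>
      adat (quantale_mul_arrow Q) (pure (sup_part Q) (sup_part Q) a b) = qmul Q a b"
  using tensor_lift[OF _ _ _ bimorphism_qmul[OF assms]] is_quantaleD(1)[OF assms] scl_tensor
  by (simp_all add: quantale_mul_arrow_def Let_def SupCat_Arr)

lemma semigroup_object_quantale:
  assumes "is_quantale (Q :: 'u quantale)"
  shows "semigroup_object SupCat sup_tensor (sup_part Q, quantale_mul_arrow Q)"
  using semigroup_object_SupCat[OF _ quantale_mul_arrow(1-3)[OF assms]]
    is_quantaleD[OF assms] quantale_mul_arrow(4)[OF assms] by simp

lemma semigroup_hom_quantale:
  assumes Q: "is_quantale (Q :: 'u quantale)" and P: "is_quantale P" and f: "sup_map Q P f"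
  shows "semigroup_hom SupCat sup_tensor (sup_part Q, quantale_mul_arrow Q)
      (sup_part P, quantale_mul_arrow P) \<lparr>adom = sup_part Q, acod = sup_part P, adat = f\<rparr>
    \<longleftrightarrow> quantale_map Q P f"
  by (subst semigroup_hom_SupCat)
    (use quantale_mul_arrow[OF Q] quantale_mul_arrow[OF P] is_quantaleD[OF Q] is_quantaleD[OF P]
      f sup_mapD(2)[OF f] in \<open>simp_all add: SupCat_Arr quantale_map_def\<close>)

text \<open>Semigroup objects are recovered on the nose: the order is copied unchanged, and
  \<open>m\<close> is determined by its values on pure tensors, which become the multiplication.
  Identities therefore witness essential surjectivity.\<close>

lemma semigroup_object_SupCat_quantale:
  fixes L :: "'u gorder"
  assumes "semigroup_object SupCat sup_tensor (L, m)"
  shows "\<exists>Q. is_quantale Q \<and> sup_part Q = L \<and> quantale_mul_arrow Q = m"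
proof -
  interpret semigroupal_category "SupCat :: ('u gorder, _) cat" sup_tensor
    by (rule semigroupal_SupCat)
  note m = semigroup_objectD(1-4)[OF assms, unfolded fst_conv snd_conv, simplified]
  have mm: "sup_map (lattice_tensor L L) L (adat m)" using m by (simp add: SupCat_Arr)
  \<comment> \<open>The restriction makes the multiplication extensional, as
    \<open>is_quantale\<close> requires.\<close>
  define \<mu> where "\<mu> = (\<lambda>a \<in> carrier L. \<lambda>b \<in> carrier L. adat m (pure L L a b))"
  have bi: "bimorphism L L L \<mu>" unfolding \<mu>_def by (rule bimorphism_comp_pure[OF m(1,1) mm])
  define Q :: "'u quantale" where "Q = \<lparr>carrier = carrier L, eq = eq L, le = le L, qmul = \<mu>\<rparr>"
  have QL: "sup_part Q = L" by (simp add: sup_part_def Q_def)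
  have qmul: "qmul Q = \<mu>" and carr: "carrier Q = carrier L" by (simp_all add: Q_def)
  have scl: "small_complete_lattice Q" using sup_part_scl[of Q] m(1) QL by simp
  have sup: "\<Squnion>\<^bsub>Q\<^esub> A = \<Squnion>\<^bsub>L\<^esub> A" for A using sup_part_sup[of Q A] QL by simp
  have "\<mu> (\<mu> a b) c = \<mu> a (\<mu> b c)" if "a \<in> carrier L" "b \<in> carrier L" "c \<in> carrier L" for a b c
    using semigroup_object_SupCat[OF m] assms that bimorphismD(1)[OF bi] by (simp add: \<mu>_def)
  then have Q: "is_quantale Q"
    unfolding is_quantale_def qmul carr sup using scl bi bimorphismD[OF bi]
    by (auto simp: bimorphism_def)
  have "quantale_mul_arrow Q = m"
    by (rule SupCat_tensor_eqI[OF quantale_mul_arrow(1)[OF Q] m(2), of L L])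
      (use m quantale_mul_arrow[OF Q, unfolded QL carr] in \<open>simp_all add: qmul \<mu>_def\<close>)
  with Q QL show ?thesis by blast
qed

lemma Quant_SGrp_SupCat:
  "(Quant :: ('u quantale, _) cat) \<simeq> SGrp (SupCat :: ('u gorder, _) cat) sup_tensor"
proof (rule weak_equivalence_imp_equivalent)
  interpret S: semigroupal_category "SupCat :: ('u gorder, _) cat" sup_tensor
    by (rule semigroupal_SupCat)
  interpret SS: category "SGrp (SupCat :: ('u gorder, _) cat) sup_tensor"
    by (rule S.category_SGrp)
  let ?F = "Quant_to_SGrp"
  show "weak_equivalence (Quant :: ('u quantale, _) cat) (SGrp SupCat sup_tensor) ?F"
    unfolding weak_equivalence_def
  proof (intro conjI ballI impI)
    show "cat_functor (Quant :: ('u quantale, _) cat) (SGrp SupCat sup_tensor) ?F"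
    proof (rule cat_functorI[OF category_Quant S.category_SGrp])
      fix f :: "('u quantale, 'u \<Rightarrow> 'u) arrow" assume "f \<in> Arr Quant"
      then show "on_arr ?F f \<in> Arr (SGrp SupCat sup_tensor)"
        using semigroup_hom_quantale[of "adom f" "acod f" "adat f"] quantale_mapD(1)
        by (auto simp: Quant_Arr SGrp_Arr semigroup_object_quantale)
    qed (auto simp: semigroup_object_quantale)
  next
    fix f g :: "('u quantale, 'u \<Rightarrow> 'u) arrow"
    assume "Dom Quant f = Dom Quant g" "Cod Quant f = Cod Quant g" "on_arr ?F f = on_arr ?F g"
    then show "f = g" by (intro arrow_eqI) simp_all
  next
    fix Q P :: "'u quantale" and h
    assume "Q \<in> Obj Quant" "P \<in> Obj Quant"
    then have Q: "is_quantale Q" and P: "is_quantale P" by auto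
    assume "h \<in> Hom (SGrp SupCat sup_tensor) (on_obj ?F Q) (on_obj ?F P)"
    then have h: "h \<in> Arr (SGrp SupCat sup_tensor)" "adom h = on_obj ?F Q" "acod h = on_obj ?F P"
      by (auto simp: Hom_def)
    define k where "k = adat h"
    have k: "semigroup_hom SupCat sup_tensor (on_obj ?F Q) (on_obj ?F P) k"
      using h by (simp add: SGrp_Arr k_def)
    then have k': "k \<in> Arr SupCat" "adom k = sup_part Q" "acod k = sup_part P"
      by (simp_all add: semigroup_hom_def)
    then have k_eq: "k = \<lparr>adom = sup_part Q, acod = sup_part P, adat = adat k\<rparr>"
      by (intro arrow_eqI) simp_all
    have "sup_map Q P (adat k)" using k' by (simp add: SupCat_Arr)
    then have "quantale_map Q P (adat k)"
      using semigroup_hom_quantale[OF Q P] k k_eq by (metis Quant_to_SGrp_simps(1))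
    then have "\<lparr>adom = Q, acod = P, adat = adat k\<rparr> \<in> Hom Quant Q P"
      using Q P by (simp add: Hom_def Quant_Arr)
    moreover have "on_arr ?F \<lparr>adom = Q, acod = P, adat = adat k\<rparr> = h"
      by (rule arrow_eqI) (use h k_eq in \<open>simp_all add: k_def\<close>)
    ultimately show "\<exists>f \<in> Hom Quant Q P. on_arr ?F f = h" by blast
  next
    fix X :: "'u gorder \<times> ('u gorder, 'u \<Rightarrow> 'u) arrow"
    assume X: "X \<in> Obj (SGrp SupCat sup_tensor)"
    then have "semigroup_object SupCat sup_tensor (fst X, snd X)" by simp
    from semigroup_object_SupCat_quantale[OF this] obtain Q
      where Q: "is_quantale Q" "on_obj ?F Q = X" by auto
    have "is_iso (SGrp SupCat sup_tensor) (Idn (SGrp SupCat sup_tensor) X)"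
      using SS.inverse_arrows_Idn[OF X] unfolding SS.is_iso_iff_inverse by blast
    then show "\<exists>Q \<in> Obj Quant. \<exists>e \<in> Hom (SGrp SupCat sup_tensor) (on_obj ?F Q) X.
        is_iso (SGrp SupCat sup_tensor) e"
      using Q SS.Idn_in[OF X] by (intro bexI[of _ Q] bexI[of _ "Idn (SGrp SupCat sup_tensor) X"]) simp_all
  qed
qed

end

section \<open>Formal contexts and bonds\<close>

lemma up_subset: "up R A \<subseteq> attrs R" and down_subset: "down R B \<subseteq> objs R"
  by (auto simp: up_def down_def)

lemma subset_down_iff: "\<lbrakk>A \<subseteq> objs R; B \<subseteq> attrs R\<rbrakk> \<Longrightarrow> A \<subseteq> down R B \<longleftrightarrow> B \<subseteq> up R A"
  by (auto simp: up_def down_def)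

lemma subset_down_up: "A \<subseteq> objs R \<Longrightarrow> A \<subseteq> down R (up R A)"
  by (auto simp: up_def down_def)

lemma up_down_up [simp]: "A \<subseteq> objs R \<Longrightarrow> up R (down R (up R A)) = up R A"
  by (auto simp: up_def down_def)

lemma down_up_down [simp]: "B \<subseteq> attrs R \<Longrightarrow> down R (up R (down R B)) = down R B"
  by (auto simp: up_def down_def)

lemma extent_down: "B \<subseteq> attrs R \<Longrightarrow> extent R (down R B)"
  by (simp add: extent_def down_subset)

lemma intent_up: "A \<subseteq> objs R \<Longrightarrow> intent R (up R A)"
  by (simp add: intent_def up_subset)

lemma extentD: "extent R A \<Longrightarrow> down R (up R A) = A" "extent R A \<Longrightarrow> A \<subseteq> objs R"
  by (auto simp: extent_def)

lemma intentD: "intent R B \<Longrightarrow> up R (down R B) = B" "intent R B \<Longrightarrow> B \<subseteq> attrs R"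
  by (auto simp: intent_def)

lemma down_up_mono: "A \<subseteq> B \<Longrightarrow> down R (up R A) \<subseteq> down R (up R B)"
  by (auto simp: up_def down_def)

text \<open>An extent above \<open>A\<close> also contains its closure. Later computations drop
  closures by means of this rule, with columns of bonds as the extents.\<close>

lemma down_up_subset_iff:
  assumes "extent R E" "A \<subseteq> objs R"
  shows "down R (up R A) \<subseteq> E \<longleftrightarrow> A \<subseteq> E"
proof
  show "A \<subseteq> E \<Longrightarrow> down R (up R A) \<subseteq> E"
    using down_up_mono[of A E R] extentD(1)[OF assms(1)] by simp
qed (use subset_down_up[OF assms(2)] in blast)

lemma closure_system_extents: "closure_system (objs R) {A. extent R A}"
proof
  fix \<F> assume F: "\<F> \<subseteq> {A. extent R A}"
  let ?I = "objs R \<inter> \<Inter>\<F>"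
  have "down R (up R ?I) \<subseteq> E" if "E \<in> \<F>" for E
  proof -
    have "extent R E" using F that by blast
    moreover have "?I \<subseteq> E" using that by blast
    ultimately show ?thesis by (simp add: down_up_subset_iff)
  qed
  then have "down R (up R ?I) \<subseteq> ?I" by (intro Int_greatest Inf_greatest down_subset)
  moreover have "?I \<subseteq> down R (up R ?I)" by (rule subset_down_up) (rule Int_lower1)
  ultimately have "down R (up R ?I) = ?I" by (rule subset_antisym)
  then show "?I \<in> {A. extent R A}" by (simp add: extent_def)
qed (simp add: extent_def)

lemma extent_Inter: "(\<And>E. E \<in> \<F> \<Longrightarrow> extent R E) \<Longrightarrow> extent R (objs R \<inter> \<Inter>\<F>)"
  using closure_system.closed_Inter[OF closure_system_extents[of R], of \<F>] by auto

section \<open>Bonds and their composition\<close>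

lemma bondD:
  assumes "bond R S b"
  shows "b \<subseteq> objs R \<times> attrs S" "x \<in> objs R \<Longrightarrow> intent S (b `` {x})"
    "w \<in> attrs S \<Longrightarrow> extent R (b\<inverse> `` {w})"
  using assms by (auto simp: bond_def)

lemma bond_row: "\<lbrakk>bond R S b; x \<in> objs R\<rbrakk> \<Longrightarrow> up S (down S (b `` {x})) = b `` {x}"
  by (rule intentD(1)[OF bondD(2)])

text \<open>A row of \<open>R\<close> is the \<open>up\<close> of a single object and a column is
  the \<open>down\<close> of a single attribute, so both are closed.\<close>

lemma bond_inc: 
  assumes "is_fcontext R"
  shows "bond R R (inc R)"
proof -
  have inc: "inc R \<subseteq> objs R \<times> attrs R" using assms by (simp add: is_fcontext_def)
  have "inc R `` {x} = up R {x}" "(inc R)\<inverse> `` {y} = down R {y}" for x y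
    using inc by (auto simp: up_def down_def)
  then show ?thesis using inc by (simp add: bond_def intent_up extent_down)
qed

text \<open>As \<open>c\<close> {z}\<open>is an intent,\<close>(z,
  v)\<open>lies in\<close>c\<open>exactly when\<close>v\<open>is incident with all of\<close>down T
  (c \<open>{z})\<close>. The condition for all \<open>z\<close> at once makes the row the
  \<open>up\<close> of a union of extents.\<close>

lemma bond_comp_row:
  assumes "bond S T c" "x \<in> objs R"
  shows "bond_comp R S T c b `` {x} = up T (\<Union>z \<in> down S (b `` {x}). down T (c `` {z}))"
proof -
  have "(z, v) \<in> c \<longleftrightarrow> (\<forall>t \<in> down T (c `` {z}). (t, v) \<in> inc T)"
    if "z \<in> objs S" "v \<in> attrs T" for z v
  proof -
    have "v \<in> up T (down T (c `` {z})) \<longleftrightarrow> (z, v) \<in> c"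
      unfolding bond_row[OF assms(1) that(1)] by simp
    then show ?thesis using that(2) by (simp add: up_def)
  qed
  then show ?thesis
    using assms(2) down_subset[of S "b `` {x}"]
    by (auto simp: bond_comp_def up_def subset_iff)
qed

lemma bond_bond_comp:
  assumes b: "bond R S b" and c: "bond S T c"
  shows "bond R T (bond_comp R S T c b)"
  unfolding bond_def
proof (intro conjI ballI)
  fix x assume "x \<in> objs R"
  then show "intent T (bond_comp R S T c b `` {x})"
    unfolding bond_comp_row[OF c \<open>x \<in> objs R\<close>] by (intro intent_up UN_least down_subset)
next
  fix v assume v: "v \<in> attrs T"
  let ?E = "up S (c\<inverse> `` {v})"
  have E: "c\<inverse> `` {v} = down S ?E" using extentD(1)[OF bondD(3)[OF c v]] by simp
  have "(bond_comp R S T c b)\<inverse> `` {v} = {x \<in> objs R. down S (b `` {x}) \<subseteq> down S ?E}"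
    using v E by (auto simp: bond_comp_def)
  \<comment> \<open>The Galois connection reverses the inclusion, because the row of
    \<open>b\<close> is an intent. The set thereby becomes an intersection of columns of
    \<open>b\<close>, which are extents.\<close>
  also have "\<dots> = {x \<in> objs R. ?E \<subseteq> b `` {x}}"
  proof -
    have "down S (b `` {x}) \<subseteq> down S ?E \<longleftrightarrow> ?E \<subseteq> b `` {x}" if "x \<in> objs R" for x
      using subset_down_iff[of "down S (b `` {x})" S "up S (c\<inverse> `` {v})", OF down_subset up_subset]
      by (simp add: bond_row[OF b that])
    then show ?thesis by blast
  qed
  also have "\<dots> = objs R \<inter> \<Inter>((\<lambda>w. b\<inverse> `` {w}) ` ?E)" by auto
  finally show "extent R ((bond_comp R S T c b)\<inverse> `` {v})"
    using extent_Inter[of "(\<lambda>w. b\<inverse> `` {w}) ` ?E" R] bondD(3)[OF b] up_subset by fastforce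
qed (auto simp: bond_comp_def)

lemma bond_comp_assoc:
  assumes c: "bond S T c" and d: "bond T U d"
  shows "bond_comp R S U (bond_comp S T U d c) b = bond_comp R T U d (bond_comp R S T c b)"
proof -
  have "down S (b `` {x}) \<subseteq> (bond_comp S T U d c)\<inverse> `` {v} \<longleftrightarrow>
      down T (bond_comp R S T c b `` {x}) \<subseteq> d\<inverse> `` {v}" if x: "x \<in> objs R" and v: "v \<in> attrs U" for x v
  proof -
    let ?Y = "\<Union>z \<in> down S (b `` {x}). down T (c `` {z})"
    have "down S (b `` {x}) \<subseteq> (bond_comp S T U d c)\<inverse> `` {v} \<longleftrightarrow> ?Y \<subseteq> d\<inverse> `` {v}"
      using v down_subset[of S "b `` {x}"] by (auto simp: bond_comp_def)
    also have "\<dots> \<longleftrightarrow> down T (up T ?Y) \<subseteq> d\<inverse> `` {v}"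
      by (rule down_up_subset_iff[OF bondD(3)[OF d v], symmetric]) (intro UN_least down_subset)
    finally show ?thesis unfolding bond_comp_row[OF c x] .
  qed
  then show ?thesis
    unfolding bond_comp_def[of R S U "bond_comp S T U d c" b]
      bond_comp_def[of R T U d "bond_comp R S T c b"] by blast
qed

lemma bond_comp_inc_right:
  assumes R: "is_fcontext R" and b: "bond R S b"
  shows "bond_comp R R S b (inc R) = b"
proof -
  have "down R (inc R `` {x}) \<subseteq> b\<inverse> `` {w} \<longleftrightarrow> (x, w) \<in> b" if "x \<in> objs R" "w \<in> attrs S" for x w
  proof -
    have "inc R `` {x} = up R {x}" using R by (auto simp: is_fcontext_def up_def)
    then show ?thesis using down_up_subset_iff[OF bondD(3)[OF b that(2)], of "{x}"] that(1) by simp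
  qed
  then show ?thesis using bondD(1)[OF b] by (auto simp: bond_comp_def)
qed

lemma bond_comp_inc_left:
  assumes S: "is_fcontext S" and b: "bond R S b"
  shows "bond_comp R S S (inc S) b = b"
proof -
  have "down S (b `` {x}) \<subseteq> (inc S)\<inverse> `` {w} \<longleftrightarrow> (x, w) \<in> b" if "x \<in> objs R" "w \<in> attrs S" for x w
  proof -
    have "down S (b `` {x}) \<subseteq> (inc S)\<inverse> `` {w} \<longleftrightarrow> w \<in> up S (down S (b `` {x}))"
      using that by (auto simp: up_def)
    then show ?thesis by (simp add: bond_row[OF b that(1)])
  qed
  then show ?thesis using bondD(1)[OF b] by (auto simp: bond_comp_def)
qed

section \<open>Residuated relations\<close>

lemma residuated_relationD:
  assumes "residuated_relation R"
  shows "is_fcontext R" "smul R \<in> objs R \<rightarrow>\<^sub>E objs R \<rightarrow>\<^sub>E objs R"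
    "\<lbrakk>x \<in> objs R; y \<in> objs R\<rbrakk> \<Longrightarrow> smul R x y \<in> objs R"
    "\<lbrakk>x \<in> objs R; y \<in> objs R; z \<in> objs R\<rbrakk> \<Longrightarrow> smul R (smul R x y) z = smul R x (smul R y z)"
    "residuated R"
  using assms by (auto simp: residuated_relation_def)

text \<open>The residuals exhibit each set as the \<open>down\<close> of a single attribute,
  \<open>y \<swarrow> x\<close> or \<open>x \<searrow> y\<close>. In this form residuation enters
  the rest of the argument.\<close>

lemma residuated_extents:
  assumes R: "residuated_relation R" and x: "x \<in> objs R" and y: "y \<in> attrs R"
  shows "extent R {a \<in> objs R. (smul R a x, y) \<in> inc R}"
    and "extent R {a \<in> objs R. (smul R x a, y) \<in> inc R}"
proof -
  obtain sl sr where sl: "sl \<in> attrs R \<rightarrow> objs R \<rightarrow> attrs R" and sr: "sr \<in> objs R \<rightarrow> attrs R \<rightarrow> attrs R"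
    and *: "\<forall>x \<in> objs R. \<forall>x' \<in> objs R. \<forall>y \<in> attrs R.
          ((smul R x x', y) \<in> inc R \<longleftrightarrow> (x, sl y x') \<in> inc R) \<and>
          ((smul R x x', y) \<in> inc R \<longleftrightarrow> (x', sr x y) \<in> inc R)"
    using residuated_relationD(5)[OF R] unfolding residuated_def by blast
  have "{a \<in> objs R. (smul R a x, y) \<in> inc R} = down R {sl y x}"
    "{a \<in> objs R. (smul R x a, y) \<in> inc R} = down R {sr x y}"
    using * x y by (auto simp: down_def)
  moreover have "sl y x \<in> attrs R" "sr x y \<in> attrs R" using x y sl sr by blast+
  ultimately show "extent R {a \<in> objs R. (smul R a x, y) \<in> inc R}"
    "extent R {a \<in> objs R. (smul R x a, y) \<in> inc R}"
    by (simp_all add: extent_down)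
qed

lemma set_mul_objs:
  assumes "residuated_relation R" "A \<subseteq> objs R" "B \<subseteq> objs R"
  shows "set_mul R A B \<subseteq> objs R"
  using assms residuated_relationD(3)[OF assms(1)] by (auto simp: set_mul_def)

text \<open>For a fixed attribute and one fixed factor, the admissible values of the other factor
  form an extent, so they include the closure of any set of such values. Closing first the right
  factor and then the left one gives the equality.\<close>

lemma up_set_mul_cl:
  assumes R: "residuated_relation R" and A: "A \<subseteq> objs R" and B: "B \<subseteq> objs R"
  shows "up R (set_mul R (down R (up R A)) (down R (up R B))) = up R (set_mul R A B)"
proof -
  have "(\<forall>a \<in> down R (up R A). \<forall>b \<in> down R (up R B). (smul R a b, y) \<in> inc R) \<longleftrightarrow>
      (\<forall>a \<in> A. \<forall>b \<in> B. (smul R a b, y) \<in> inc R)" if y: "y \<in> attrs R" for y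
  proof -
    have 1: "(\<forall>a \<in> down R (up R A). (smul R a b, y) \<in> inc R) \<longleftrightarrow> (\<forall>a \<in> A. (smul R a b, y) \<in> inc R)"
      if "b \<in> objs R" for b
      using down_up_subset_iff[OF residuated_extents(1)[OF R that y] A] A down_subset[of R "up R A"]
      by (auto simp: subset_iff)
    have 2: "(\<forall>b \<in> down R (up R B). (smul R a b, y) \<in> inc R) \<longleftrightarrow> (\<forall>b \<in> B. (smul R a b, y) \<in> inc R)"
      if "a \<in> objs R" for a
      using down_up_subset_iff[OF residuated_extents(2)[OF R that y] B] B down_subset[of R "up R B"]
      by (auto simp: subset_iff)
    have "(\<forall>a \<in> down R (up R A). \<forall>b \<in> down R (up R B). (smul R a b, y) \<in> inc R) \<longleftrightarrow>
       (\<forall>a \<in> down R (up R A). \<forall>b \<in> B. (smul R a b, y) \<in> inc R)"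
      using 2 down_subset[of R "up R A"] by blast
    also have "\<dots> \<longleftrightarrow> (\<forall>b \<in> B. \<forall>a \<in> down R (up R A). (smul R a b, y) \<in> inc R)" by blast
    also have "\<dots> \<longleftrightarrow> (\<forall>b \<in> B. \<forall>a \<in> A. (smul R a b, y) \<in> inc R)" using 1 B by blast
    finally show ?thesis by blast
  qed
  moreover have "y \<in> up R (set_mul R A' B') \<longleftrightarrow>
      y \<in> attrs R \<and> (\<forall>a \<in> A'. \<forall>b \<in> B'. (smul R a b, y) \<in> inc R)" for y A' B'
    by (auto simp: up_def set_mul_def)
  ultimately show ?thesis by (simp add: set_eq_iff cong: conj_cong)
qed

lemma set_mul_cl_subset_iff:
  assumes R: "residuated_relation R" and A: "A \<subseteq> objs R" and B: "B \<subseteq> objs R" and E: "extent R E"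
  shows "set_mul R (down R (up R A)) (down R (up R B)) \<subseteq> E \<longleftrightarrow> set_mul R A B \<subseteq> E"
  unfolding down_up_subset_iff[OF E set_mul_objs[OF R A B], symmetric]
    down_up_subset_iff[OF E set_mul_objs[OF R down_subset down_subset], symmetric]
    up_set_mul_cl[OF R A B] ..

text \<open>The row of \<open>R\<close> at \<open>x\<close> is \<open>up R {x}\<close>, so the claim
  is the compatibility of closure and product for two singletons.\<close>

lemma multiplicative_inc:
  assumes R: "residuated_relation R"
  shows "multiplicative R R (inc R)"
  unfolding multiplicative_def intent_mul_def
proof (intro ballI)
  fix x x' assume x: "x \<in> objs R" "x' \<in> objs R"
  have inc: "inc R `` {z} = up R {z}" for z
    using residuated_relationD(1)[OF R] by (auto simp: is_fcontext_def up_def)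
  have "up R (set_mul R {x} {x'}) = up R {smul R x x'}" by (simp add: set_mul_def)
  then show "inc R `` {smul R x x'} = up R (set_mul R (down R (inc R `` {x})) (down R (inc R `` {x'})))"
    unfolding inc using up_set_mul_cl[OF R, of "{x}" "{x'}"] x by simp
qed

text \<open>Multiplicativity of \<open>b\<close> expresses the row at \<open>x x'\<close> by the
  closure of a product in \<open>S\<close>. The closure is dropped against the columns of
  \<open>c\<close>, leaving a condition on single products, to which multiplicativity of
  \<open>c\<close> applies. Collected over all pairs this is the \<open>up\<close> of the product of
  \<open>?Y x\<close> and \<open>?Y x'\<close>, and these sets may be replaced by their closures in
  \<open>T\<close>.\<close>

lemma multiplicative_comp:
  assumes R: "residuated_relation R" and S: "residuated_relation S" and T: "residuated_relation T"
    and b: "bond R S b" "multiplicative R S b" and c: "bond S T c" "multiplicative S T c"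
  shows "multiplicative R T (bond_comp R S T c b)"
  unfolding multiplicative_def
proof (intro ballI)
  fix x x' assume x: "x \<in> objs R" "x' \<in> objs R"
  let ?B = "\<lambda>x. down S (b `` {x})" and ?C = "\<lambda>z. down T (c `` {z})"
  let ?Y = "\<lambda>x. \<Union>z \<in> ?B x. ?C z"
  have xx: "smul R x x' \<in> objs R" using residuated_relationD(3)[OF R] x .
  have Y: "?Y x \<subseteq> objs T" for x by (intro UN_least down_subset)
  have Bs: "?B x \<subseteq> objs S" for x by (rule down_subset)
  have row: "bond_comp R S T c b `` {y} = {v \<in> attrs T. ?B y \<subseteq> c\<inverse> `` {v}}" if "y \<in> objs R" for y
    using that by (auto simp: bond_comp_def)
  have "?B (smul R x x') = down S (up S (set_mul S (?B x) (?B x')))"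
    using b(2) x by (simp add: multiplicative_def intent_mul_def)
  then have "bond_comp R S T c b `` {smul R x x'} = {v \<in> attrs T. set_mul S (?B x) (?B x') \<subseteq> c\<inverse> `` {v}}"
    unfolding row[OF xx]
    using down_up_subset_iff[OF bondD(3)[OF c(1)] set_mul_objs[OF S Bs Bs]] by (simp cong: conj_cong)
  also have "\<dots> = {v \<in> attrs T. \<forall>z \<in> ?B x. \<forall>z' \<in> ?B x'. v \<in> c `` {smul S z z'}}"
    by (auto simp: set_mul_def)
  also have "\<dots> = {v \<in> attrs T. \<forall>z \<in> ?B x. \<forall>z' \<in> ?B x'. v \<in> up T (set_mul T (?C z) (?C z'))}"
    using c(2) Bs unfolding multiplicative_def intent_mul_def by blast
  also have "\<dots> = up T (set_mul T (?Y x) (?Y x'))"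
    by (auto simp: up_def set_mul_def; blast)
  also have "\<dots> = intent_mul T (bond_comp R S T c b `` {x}) (bond_comp R S T c b `` {x'})"
    unfolding intent_mul_def bond_comp_row[OF c(1) x(1)] bond_comp_row[OF c(1) x(2)]
    by (rule up_set_mul_cl[OF T Y Y, symmetric])
  finally show "bond_comp R S T c b `` {smul R x x'}
      = intent_mul T (bond_comp R S T c b `` {x}) (bond_comp R S T c b `` {x'})" .
qed

lemma ResRel_Obj [simp]: "R \<in> Obj ResRel \<longleftrightarrow> residuated_relation R"
  by (simp add: ResRel_def)

lemma ResRel_Arr: "F \<in> Arr ResRel \<longleftrightarrow> residuated_relation (adom F) \<and> residuated_relation (acod F) \<and>
    bond (adom F) (acod F) (adat F) \<and> multiplicative (adom F) (acod F) (adat F)"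
  by (cases F) (auto simp: ResRel_def)

lemma ResRel_simps [simp]:
  "Dom ResRel = adom" "Cod ResRel = acod"
  "Idn ResRel R = \<lparr>adom = R, acod = R, adat = inc R\<rparr>"
  "Cmp ResRel G F = \<lparr>adom = adom F, acod = acod G,
     adat = bond_comp (adom F) (acod F) (acod G) (adat G) (adat F)\<rparr>"
  by (simp_all add: ResRel_def)

lemma category_ResRel: "category ResRel"
proof
  fix f :: "('u sgcontext, ('u \<times> 'u) set) arrow" and g A B D
  assume "f \<in> Hom ResRel A B" "g \<in> Hom ResRel B D"
  then show "g \<cdot>\<^bsub>ResRel\<^esub> f \<in> Hom ResRel A D"
    by (auto simp: Hom_def ResRel_Arr intro: bond_bond_comp multiplicative_comp)
next
  fix f :: "('u sgcontext, ('u \<times> 'u) set) arrow" and g h A B D E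
  assume "f \<in> Hom ResRel A B" "g \<in> Hom ResRel B D" "h \<in> Hom ResRel D E"
  then show "(h \<cdot>\<^bsub>ResRel\<^esub> g) \<cdot>\<^bsub>ResRel\<^esub> f = h \<cdot>\<^bsub>ResRel\<^esub> (g \<cdot>\<^bsub>ResRel\<^esub> f)"
    using bond_comp_assoc[of B D "adat g" E "adat h" A "adat f"]
    by (auto simp: Hom_def ResRel_Arr)
next
  fix f :: "('u sgcontext, ('u \<times> 'u) set) arrow" and A B
  assume f: "f \<in> Hom ResRel A B"
  then have "bond_comp A B B (inc B) (adat f) = adat f" "bond_comp A A B (adat f) (inc A) = adat f"
    using bond_comp_inc_left[of B A "adat f"] bond_comp_inc_right[of A B "adat f"]
    by (auto simp only: Hom_def ResRel_Arr ResRel_simps residuated_relationD(1) mem_Collect_eq)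
  with f show "Idn ResRel B \<cdot>\<^bsub>ResRel\<^esub> f = f" "f \<cdot>\<^bsub>ResRel\<^esub> Idn ResRel A = f"
    by (auto simp: Hom_def intro!: arrow_eqI)
qed (auto simp: Hom_def ResRel_Arr bond_inc multiplicative_inc residuated_relationD(1))

section \<open>Quantales as residuated relations\<close>

definition quantale_context :: "'u quantale \<Rightarrow> 'u sgcontext" where
  "quantale_context Q = \<lparr>objs = carrier Q, attrs = carrier Q,
     inc = {(x, y). x \<in> carrier Q \<and> y \<in> carrier Q \<and> x \<sqsubseteq>\<^bsub>Q\<^esub> y}, smul = qmul Q\<rparr>"

definition map_bond :: "'u quantale \<Rightarrow> 'u quantale \<Rightarrow> ('u \<Rightarrow> 'u) \<Rightarrow> ('u \<times> 'u) set" where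
  "map_bond Q P f = {(x, w). x \<in> carrier Q \<and> w \<in> carrier P \<and> f x \<sqsubseteq>\<^bsub>P\<^esub> w}"

definition Quant_to_ResRel ::
  "('u quantale, ('u quantale, 'u \<Rightarrow> 'u) arrow, 'u sgcontext, ('u sgcontext, ('u \<times> 'u) set) arrow) fctr" where
  "Quant_to_ResRel = \<lparr>on_obj = quantale_context,
     on_arr = \<lambda>f. \<lparr>adom = quantale_context (adom f), acod = quantale_context (acod f),
       adat = map_bond (adom f) (acod f) (adat f)\<rparr>\<rparr>"

lemma quantale_context_simps [simp]:
  "objs (quantale_context Q) = carrier Q" "attrs (quantale_context Q) = carrier Q"
  "smul (quantale_context Q) = qmul Q"
  "(x, y) \<in> inc (quantale_context Q) \<longleftrightarrow> x \<in> carrier Q \<and> y \<in> carrier Q \<and> x \<sqsubseteq>\<^bsub>Q\<^esub> y"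
  by (simp_all add: quantale_context_def)

lemma up_quantale_context:
  assumes "complete_lattice Q" "A \<subseteq> carrier Q"
  shows "up (quantale_context Q) A = {y \<in> carrier Q. \<Squnion>\<^bsub>Q\<^esub> A \<sqsubseteq>\<^bsub>Q\<^esub> y}"
  using assms(2) sup_le_iff[OF assms] by (auto simp: up_def)

lemma up_down_set:
  assumes Q: "complete_lattice Q" and p: "p \<in> carrier Q"
  shows "up (quantale_context Q) {x \<in> carrier Q. x \<sqsubseteq>\<^bsub>Q\<^esub> p} = {y \<in> carrier Q. p \<sqsubseteq>\<^bsub>Q\<^esub> y}"
  using p complete_lattice_leD(1)[OF Q p] complete_lattice_leD(3)[OF Q, of _ p] by (auto simp: up_def)

lemma down_up_set:
  assumes Q: "complete_lattice Q" and p: "p \<in> carrier Q"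
  shows "down (quantale_context Q) {y \<in> carrier Q. p \<sqsubseteq>\<^bsub>Q\<^esub> y} = {x \<in> carrier Q. x \<sqsubseteq>\<^bsub>Q\<^esub> p}"
  using p complete_lattice_leD(1)[OF Q p] complete_lattice_leD(3)[OF Q, of _ p] by (auto simp: down_def)

text \<open>\<open>up A\<close> consists of the elements above the supremum of \<open>A\<close>; for
  an intent, \<open>A\<close> is its \<open>down\<close>, and the supremum is the generator.\<close>

lemma intent_quantale_context:
  assumes Q: "complete_lattice Q"
  shows "intent (quantale_context Q) B \<longleftrightarrow> (\<exists>p \<in> carrier Q. B = {y \<in> carrier Q. p \<sqsubseteq>\<^bsub>Q\<^esub> y})"
proof
  assume B: "intent (quantale_context Q) B"
  let ?D = "down (quantale_context Q) B"
  have D: "?D \<subseteq> carrier Q" using down_subset[of "quantale_context Q"] by simp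
  have "B = {y \<in> carrier Q. \<Squnion>\<^bsub>Q\<^esub> ?D \<sqsubseteq>\<^bsub>Q\<^esub> y}"
    using intentD(1)[OF B] up_quantale_context[OF Q D] by simp
  then show "\<exists>p \<in> carrier Q. B = {y \<in> carrier Q. p \<sqsubseteq>\<^bsub>Q\<^esub> y}"
    using sup_in_carrier[OF Q D] by blast
next
  assume "\<exists>p \<in> carrier Q. B = {y \<in> carrier Q. p \<sqsubseteq>\<^bsub>Q\<^esub> y}"
  then show "intent (quantale_context Q) B"
    by (auto simp: intent_def down_up_set[OF Q] up_down_set[OF Q])
qed

lemma extent_quantale_context:
  assumes Q: "complete_lattice Q"
  shows "extent (quantale_context Q) A \<longleftrightarrow> (\<exists>p \<in> carrier Q. A = {x \<in> carrier Q. x \<sqsubseteq>\<^bsub>Q\<^esub> p})"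
proof
  assume A: "extent (quantale_context Q) A"
  then have Ac: "A \<subseteq> carrier Q" using extentD(2)[OF A] by simp
  note s = sup_in_carrier[OF Q Ac]
  have "A = {x \<in> carrier Q. x \<sqsubseteq>\<^bsub>Q\<^esub> \<Squnion>\<^bsub>Q\<^esub> A}"
    using extentD(1)[OF A] up_quantale_context[OF Q Ac] down_up_set[OF Q s] by simp
  then show "\<exists>p \<in> carrier Q. A = {x \<in> carrier Q. x \<sqsubseteq>\<^bsub>Q\<^esub> p}" using s by blast
next
  assume "\<exists>p \<in> carrier Q. A = {x \<in> carrier Q. x \<sqsubseteq>\<^bsub>Q\<^esub> p}"
  then show "extent (quantale_context Q) A"
    by (auto simp: extent_def down_up_set[OF Q] up_down_set[OF Q])
qed

lemma qmul_le_iff: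
  assumes Q: "is_quantale Q" and A: "A \<subseteq> carrier Q" and b: "b \<in> carrier Q" and u: "u \<in> carrier Q"
  shows "qmul Q (\<Squnion>\<^bsub>Q\<^esub> A) b \<sqsubseteq>\<^bsub>Q\<^esub> u \<longleftrightarrow> (\<forall>a \<in> A. qmul Q a b \<sqsubseteq>\<^bsub>Q\<^esub> u)"
    and "qmul Q b (\<Squnion>\<^bsub>Q\<^esub> A) \<sqsubseteq>\<^bsub>Q\<^esub> u \<longleftrightarrow> (\<forall>a \<in> A. qmul Q b a \<sqsubseteq>\<^bsub>Q\<^esub> u)"
proof -
  have "(\<lambda>a. qmul Q a b) ` A \<subseteq> carrier Q" "(\<lambda>a. qmul Q b a) ` A \<subseteq> carrier Q"
    using is_quantaleD(4)[OF Q] A b by auto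
  then show "qmul Q (\<Squnion>\<^bsub>Q\<^esub> A) b \<sqsubseteq>\<^bsub>Q\<^esub> u \<longleftrightarrow> (\<forall>a \<in> A. qmul Q a b \<sqsubseteq>\<^bsub>Q\<^esub> u)"
    "qmul Q b (\<Squnion>\<^bsub>Q\<^esub> A) \<sqsubseteq>\<^bsub>Q\<^esub> u \<longleftrightarrow> (\<forall>a \<in> A. qmul Q b a \<sqsubseteq>\<^bsub>Q\<^esub> u)"
    using sup_le_iff[OF is_quantaleD(2)[OF Q] _ u] by (simp_all add: is_quantaleD(6,7)[OF Q A b])
qed

lemma sup_down_set:
  assumes Q: "complete_lattice Q" and p: "p \<in> carrier Q"
  shows "\<Squnion>\<^bsub>Q\<^esub> {x \<in> carrier Q. x \<sqsubseteq>\<^bsub>Q\<^esub> p} = p"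
  by (rule sup_eqI[OF Q _ p])
    (use p complete_lattice_leD(1)[OF Q p] complete_lattice_leD(3)[OF Q, of _ p] in auto)

text \<open>\<open>l\<close> and \<open>r\<close> satisfy the inequality that their members satisfy,
  because multiplication preserves suprema; so they are the largest solutions.\<close>

lemma quantale_residual:
  assumes Q: "is_quantale Q" and b: "b \<in> carrier Q" and u: "u \<in> carrier Q"
  defines "l \<equiv> \<Squnion>\<^bsub>Q\<^esub> {a \<in> carrier Q. qmul Q a b \<sqsubseteq>\<^bsub>Q\<^esub> u}"
    and "r \<equiv> \<Squnion>\<^bsub>Q\<^esub> {a \<in> carrier Q. qmul Q b a \<sqsubseteq>\<^bsub>Q\<^esub> u}"
  assumes x: "x \<in> carrier Q"
  shows "qmul Q x b \<sqsubseteq>\<^bsub>Q\<^esub> u \<longleftrightarrow> x \<sqsubseteq>\<^bsub>Q\<^esub> l" "qmul Q b x \<sqsubseteq>\<^bsub>Q\<^esub> u \<longleftrightarrow> x \<sqsubseteq>\<^bsub>Q\<^esub> r"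
proof -
  note CL = is_quantaleD(2)[OF Q]
  note le = complete_lattice_leD[OF CL]
  have lc: "l \<in> carrier Q" "r \<in> carrier Q" unfolding l_def r_def by (rule sup_in_carrier[OF CL], blast)+
  have l: "qmul Q l b \<sqsubseteq>\<^bsub>Q\<^esub> u" "qmul Q b r \<sqsubseteq>\<^bsub>Q\<^esub> u"
    unfolding l_def r_def by (subst qmul_le_iff[OF Q _ b u]; blast)+
  show "qmul Q x b \<sqsubseteq>\<^bsub>Q\<^esub> u \<longleftrightarrow> x \<sqsubseteq>\<^bsub>Q\<^esub> l"
  proof
    assume "qmul Q x b \<sqsubseteq>\<^bsub>Q\<^esub> u"
    then show "x \<sqsubseteq>\<^bsub>Q\<^esub> l"
      using sup_le_iff[OF CL _ lc(1), of "{a \<in> carrier Q. qmul Q a b \<sqsubseteq>\<^bsub>Q\<^esub> u}"] le(1)[OF lc(1)] x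
      by (auto simp: l_def)
  next
    assume "x \<sqsubseteq>\<^bsub>Q\<^esub> l"
    \<comment> \<open>Since \<open>l\<close> is the supremum of its own down-set, distributivity
      passes the inequality from \<open>l\<close> to everything below it and takes the place of
      monotonicity.\<close>
    moreover have "\<forall>a \<in> {a \<in> carrier Q. a \<sqsubseteq>\<^bsub>Q\<^esub> l}. qmul Q a b \<sqsubseteq>\<^bsub>Q\<^esub> u"
      using l(1) by (subst qmul_le_iff(1)[OF Q _ b u, symmetric]) (auto simp: sup_down_set[OF CL lc(1)])
    ultimately show "qmul Q x b \<sqsubseteq>\<^bsub>Q\<^esub> u" using x by blast
  qed
  show "qmul Q b x \<sqsubseteq>\<^bsub>Q\<^esub> u \<longleftrightarrow> x \<sqsubseteq>\<^bsub>Q\<^esub> r"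
  proof
    assume "qmul Q b x \<sqsubseteq>\<^bsub>Q\<^esub> u"
    then show "x \<sqsubseteq>\<^bsub>Q\<^esub> r"
      using sup_le_iff[OF CL _ lc(2), of "{a \<in> carrier Q. qmul Q b a \<sqsubseteq>\<^bsub>Q\<^esub> u}"] le(1)[OF lc(2)] x
      by (auto simp: r_def)
  next
    assume "x \<sqsubseteq>\<^bsub>Q\<^esub> r"
    moreover have "\<forall>a \<in> {a \<in> carrier Q. a \<sqsubseteq>\<^bsub>Q\<^esub> r}. qmul Q b a \<sqsubseteq>\<^bsub>Q\<^esub> u"
      using l(2) by (subst qmul_le_iff(2)[OF Q _ b u, symmetric]) (auto simp: sup_down_set[OF CL lc(2)])
    ultimately show "qmul Q b x \<sqsubseteq>\<^bsub>Q\<^esub> u" using x by blast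
  qed
qed

lemma residuated_quantale_context:
  assumes Q: "is_quantale Q"
  shows "residuated_relation (quantale_context Q)"
proof -
  note CL = is_quantaleD(2)[OF Q]
  have "residuated (quantale_context Q)"
    unfolding residuated_def
  proof (intro bexI ballI)
    show "(\<lambda>u b. \<Squnion>\<^bsub>Q\<^esub> {a \<in> carrier Q. qmul Q a b \<sqsubseteq>\<^bsub>Q\<^esub> u}) \<in>
        attrs (quantale_context Q) \<rightarrow> objs (quantale_context Q) \<rightarrow> attrs (quantale_context Q)"
      "(\<lambda>b u. \<Squnion>\<^bsub>Q\<^esub> {a \<in> carrier Q. qmul Q b a \<sqsubseteq>\<^bsub>Q\<^esub> u}) \<in>
        objs (quantale_context Q) \<rightarrow> attrs (quantale_context Q) \<rightarrow> attrs (quantale_context Q)"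
      using sup_in_carrier[OF CL] by auto
  qed (use quantale_residual[OF Q] is_quantaleD(4)[OF Q] sup_in_carrier[OF CL] in auto)
  then show ?thesis
    using is_quantaleD[OF Q]
    by (auto simp: residuated_relation_def is_fcontext_def small_complete_lattice_def)
qed

lemma map_bond_row: "x \<in> carrier Q \<Longrightarrow> map_bond Q P f `` {x} = {w \<in> carrier P. f x \<sqsubseteq>\<^bsub>P\<^esub> w}"
  by (auto simp: map_bond_def)

text \<open>The row at \<open>x\<close> is generated by \<open>f x\<close>. The column at
  \<open>w\<close> is the down-set of its supremum \<open>?q\<close>, the value at \<open>w\<close>
  of the right adjoint of \<open>f\<close>; preservation of suprema puts \<open>?q\<close> itself
  into the column.\<close>

lemma map_bond_bond:
  assumes f: "sup_map Q P f"
  shows "bond (quantale_context Q) (quantale_context P) (map_bond Q P f)"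
  unfolding bond_def
proof (intro conjI ballI)
  note Q = sup_mapD(4)[OF f] and P = sup_mapD(5)[OF f]
  fix x assume "x \<in> objs (quantale_context Q)"
  then show "intent (quantale_context P) (map_bond Q P f `` {x})"
    using sup_mapD(2)[OF f] by (auto simp: map_bond_row intent_quantale_context[OF P])
next
  note Q = sup_mapD(4)[OF f] and P = sup_mapD(5)[OF f]
  fix w assume "w \<in> attrs (quantale_context P)"
  then have w: "w \<in> carrier P" by simp
  let ?A = "{x \<in> carrier Q. f x \<sqsubseteq>\<^bsub>P\<^esub> w}"
  let ?q = "\<Squnion>\<^bsub>Q\<^esub> ?A"
  have A: "?A \<subseteq> carrier Q" by auto
  have q: "?q \<in> carrier Q" by (rule sup_in_carrier[OF Q A])
  have fq: "f ?q \<sqsubseteq>\<^bsub>P\<^esub> w" using sup_map_le_iff[OF f A w] by simp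
  have "x \<sqsubseteq>\<^bsub>Q\<^esub> ?q" if "x \<in> ?A" for x
    using sup_le_iff[OF Q A q] complete_lattice_leD(1)[OF Q q] that by simp
  moreover have "f x \<sqsubseteq>\<^bsub>P\<^esub> w" if x: "x \<in> carrier Q" "x \<sqsubseteq>\<^bsub>Q\<^esub> ?q" for x
    by (rule complete_lattice_leD(3)[OF P sup_map_mono[OF f x(1) q x(2)] fq])
      (use x q w sup_mapD(2)[OF f] in auto)
  ultimately have "(map_bond Q P f)\<inverse> `` {w} = {x \<in> carrier Q. x \<sqsubseteq>\<^bsub>Q\<^esub> ?q}"
    using w by (auto simp: map_bond_def)
  then show "extent (quantale_context Q) ((map_bond Q P f)\<inverse> `` {w})"
    using q by (auto simp: extent_quantale_context[OF Q])
qed (auto simp: map_bond_def)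

lemma up_set_eq_iff:
  assumes P: "complete_lattice P" and "a \<in> carrier P" "b \<in> carrier P"
  shows "{w \<in> carrier P. a \<sqsubseteq>\<^bsub>P\<^esub> w} = {w \<in> carrier P. b \<sqsubseteq>\<^bsub>P\<^esub> w} \<longleftrightarrow> a = b"
proof
  assume "{w \<in> carrier P. a \<sqsubseteq>\<^bsub>P\<^esub> w} = {w \<in> carrier P. b \<sqsubseteq>\<^bsub>P\<^esub> w}"
  then show "a = b" by (intro le_eqI[OF assms]) blast
qed simp

text \<open>The up-set of \<open>p\<close> is the \<open>up\<close> of \<open>{p}\<close>. Its
  \<open>down\<close> is thus the closure of a singleton, and the closures can be removed from both
  factors.\<close>

lemma intent_mul_quantale_context:
  assumes Q: "is_quantale Q" and p: "p \<in> carrier Q" and q: "q \<in> carrier Q"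
  shows "intent_mul (quantale_context Q) {w \<in> carrier Q. p \<sqsubseteq>\<^bsub>Q\<^esub> w} {w \<in> carrier Q. q \<sqsubseteq>\<^bsub>Q\<^esub> w}
    = {w \<in> carrier Q. qmul Q p q \<sqsubseteq>\<^bsub>Q\<^esub> w}"
proof -
  note CL = is_quantaleD(2)[OF Q] and R = residuated_quantale_context[OF Q]
  note mul = is_quantaleD(4)[OF Q]
  let ?K = "quantale_context Q"
  have cl: "down ?K (up ?K {x}) = {y \<in> carrier Q. y \<sqsubseteq>\<^bsub>Q\<^esub> x}" if x: "x \<in> carrier Q" for x
  proof -
    have "up ?K {x} = {y \<in> carrier Q. x \<sqsubseteq>\<^bsub>Q\<^esub> y}" using x by (auto simp: up_def)
    then show ?thesis by (simp add: down_up_set[OF CL x])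
  qed
  have "up ?K (set_mul ?K {p} {q}) = {w \<in> carrier Q. qmul Q p q \<sqsubseteq>\<^bsub>Q\<^esub> w}"
    using mul[OF p q] by (auto simp: up_def set_mul_def)
  then show ?thesis
    using up_set_mul_cl[OF R, of "{p}" "{q}"] p q
    by (simp add: intent_mul_def down_up_set[OF CL] cl)
qed

lemma multiplicative_map_bond:
  assumes Q: "is_quantale Q" and P: "is_quantale P" and f: "sup_map Q P f"
  shows "multiplicative (quantale_context Q) (quantale_context P) (map_bond Q P f) \<longleftrightarrow> quantale_map Q P f"
proof -
  have "map_bond Q P f `` {qmul Q x x'}
        = intent_mul (quantale_context P) (map_bond Q P f `` {x}) (map_bond Q P f `` {x'})
      \<longleftrightarrow> f (qmul Q x x') = qmul P (f x) (f x')" if "x \<in> carrier Q" "x' \<in> carrier Q" for x x'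
    using that is_quantaleD(4)[OF Q that] is_quantaleD(4)[OF P] sup_mapD(2)[OF f]
    by (simp add: map_bond_row intent_mul_quantale_context[OF P] up_set_eq_iff[OF is_quantaleD(2)[OF P]])
  then show ?thesis using f by (simp add: multiplicative_def quantale_map_def)
qed

lemma map_bond_eqD:
  assumes f: "sup_map Q P f" and g: "sup_map Q P g" and eq: "map_bond Q P f = map_bond Q P g"
  shows "f = g"
proof (rule extensionalityI[OF sup_mapD(1)[OF f] sup_mapD(1)[OF g]])
  fix x assume x: "x \<in> carrier Q"
  then have "{w \<in> carrier P. f x \<sqsubseteq>\<^bsub>P\<^esub> w} = {w \<in> carrier P. g x \<sqsubseteq>\<^bsub>P\<^esub> w}"
    using arg_cong[OF eq, of "\<lambda>b. b `` {x}"] by (simp add: map_bond_row)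
  then show "f x = g x"
    using up_set_eq_iff[OF sup_mapD(5)[OF f]] sup_mapD(2)[OF f x] sup_mapD(2)[OF g x] by simp
qed

text \<open>Each row is a principal up-set, and \<open>f\<close> picks its generator. Each column is
  a principal down-set, so for every \<open>w\<close> there is \<open>q\<close> such that
  \<open>f x\<close> is below \<open>w\<close> exactly when \<open>x\<close> is below
  \<open>q\<close>. Such an adjunction makes \<open>f\<close> preserve suprema.\<close>

lemma bond_is_map_bond:
  assumes Q: "complete_lattice Q" and P: "complete_lattice P"
    and b: "bond (quantale_context Q) (quantale_context P) b"
  shows "\<exists>f. sup_map Q P f \<and> b = map_bond Q P f"
proof -
  have "\<forall>x \<in> carrier Q. \<exists>p. p \<in> carrier P \<and> b `` {x} = {w \<in> carrier P. p \<sqsubseteq>\<^bsub>P\<^esub> w}"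
    using bondD(2)[OF b] unfolding intent_quantale_context[OF P] Bex_def by simp
  from bchoice[OF this] obtain f0 where f0: "\<forall>x \<in> carrier Q. f0 x \<in> carrier P \<and>
    b `` {x} = {w \<in> carrier P. f0 x \<sqsubseteq>\<^bsub>P\<^esub> w}" ..
  define f where "f = restrict f0 (carrier Q)"
  have fc: "f x \<in> carrier P" and fb: "b `` {x} = {w \<in> carrier P. f x \<sqsubseteq>\<^bsub>P\<^esub> w}" if "x \<in> carrier Q" for x
    using f0 that by (simp_all add: f_def)
  have le: "f x \<sqsubseteq>\<^bsub>P\<^esub> w \<longleftrightarrow> (x, w) \<in> b" if "x \<in> carrier Q" "w \<in> carrier P" for x w
    using fb[OF that(1)] that(2) by auto
  have "sup_map Q P f"
  proof (rule sup_mapI[OF Q P])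
    fix A assume A: "A \<subseteq> carrier Q"
    note s = sup_in_carrier[OF Q A]
    show "f (\<Squnion>\<^bsub>Q\<^esub> A) = \<Squnion>\<^bsub>P\<^esub> (f ` A)"
    proof (rule sup_eqI[OF P, symmetric])
      fix w assume w: "w \<in> carrier P"
      then obtain q where q: "q \<in> carrier Q" "b\<inverse> `` {w} = {x \<in> carrier Q. x \<sqsubseteq>\<^bsub>Q\<^esub> q}"
        using bondD(3)[OF b, of w] unfolding extent_quantale_context[OF Q] by auto
      have fq: "f x \<sqsubseteq>\<^bsub>P\<^esub> w \<longleftrightarrow> x \<sqsubseteq>\<^bsub>Q\<^esub> q" if x: "x \<in> carrier Q" for x
      proof -
        have "x \<in> b\<inverse> `` {w} \<longleftrightarrow> x \<sqsubseteq>\<^bsub>Q\<^esub> q" unfolding q(2) using x by simp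
        then show ?thesis using le[OF x w] by simp
      qed
      have "f a \<sqsubseteq>\<^bsub>P\<^esub> w \<longleftrightarrow> a \<sqsubseteq>\<^bsub>Q\<^esub> q" if "a \<in> A" for a by (rule fq) (use A that in auto)
      then show "f (\<Squnion>\<^bsub>Q\<^esub> A) \<sqsubseteq>\<^bsub>P\<^esub> w \<longleftrightarrow> (\<forall>a \<in> f ` A. a \<sqsubseteq>\<^bsub>P\<^esub> w)"
        using fq[OF s] sup_le_iff[OF Q A q(1)] by simp
    qed (use A s fc in auto)
  qed (use fc in \<open>simp_all add: f_def\<close>)
  moreover have "b = map_bond Q P f"
    using le bondD(1)[OF b] by (auto simp: map_bond_def)
  ultimately show ?thesis by blast
qed

lemma bond_comp_iff:
  "(x, v) \<in> bond_comp R S T c b \<longleftrightarrow> x \<in> objs R \<and> v \<in> attrs T \<and> down S (b `` {x}) \<subseteq> c\<inverse> `` {v}"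
  by (simp add: bond_comp_def)

text \<open>Composition of bonds asks that \<open>g z\<close> be below \<open>v\<close> for every
  \<open>z\<close> below \<open>f x\<close>. As \<open>g\<close> preserves suprema and
  \<open>f x\<close> is the supremum of its down-set, the condition at \<open>f x\<close> alone is
  equivalent.\<close>

lemma map_bond_compose:
  assumes f: "sup_map Q P f" and g: "sup_map P R g"
  shows "map_bond Q R (compose (carrier Q) g f) =
    bond_comp (quantale_context Q) (quantale_context P) (quantale_context R) (map_bond P R g) (map_bond Q P f)"
proof -
  note P = sup_mapD(4)[OF g] and R = sup_mapD(5)[OF g]
  have "down (quantale_context P) (map_bond Q P f `` {x}) \<subseteq> (map_bond P R g)\<inverse> `` {v} \<longleftrightarrow> g (f x) \<sqsubseteq>\<^bsub>R\<^esub> v"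
    if x: "x \<in> carrier Q" and v: "v \<in> carrier R" for x v
  proof -
    note fx = sup_mapD(2)[OF f x]
    have "down (quantale_context P) (map_bond Q P f `` {x}) \<subseteq> (map_bond P R g)\<inverse> `` {v} \<longleftrightarrow>
        (\<forall>z \<in> {z \<in> carrier P. z \<sqsubseteq>\<^bsub>P\<^esub> f x}. g z \<sqsubseteq>\<^bsub>R\<^esub> v)"
      using v by (auto simp: map_bond_row[OF x] down_up_set[OF P fx] map_bond_def[of P R g])
    also have "\<dots> \<longleftrightarrow> g (f x) \<sqsubseteq>\<^bsub>R\<^esub> v"
      by (subst sup_map_le_iff[OF g _ v, symmetric]) (auto simp: sup_down_set[OF P fx])
    finally show ?thesis .
  qed
  then have "(x, v) \<in> map_bond Q R (compose (carrier Q) g f) \<longleftrightarrow> (x, v) \<in> bond_comp (quantale_context Q)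
      (quantale_context P) (quantale_context R) (map_bond P R g) (map_bond Q P f)" for x v
    by (simp add: map_bond_def[of Q R] bond_comp_iff compose_eq cong: conj_cong)
  then show ?thesis by (simp add: set_eq_iff)
qed

lemma map_bond_Idn: "map_bond Q Q (\<lambda>x \<in> carrier Q. x) = inc (quantale_context Q)"
  by (auto simp: map_bond_def quantale_context_def)

lemma Quant_to_ResRel_functor: "cat_functor Quant ResRel Quant_to_ResRel"
proof (rule cat_functorI[OF category_Quant category_ResRel])
  fix f :: "('u quantale, 'u \<Rightarrow> 'u) arrow" assume "f \<in> Arr Quant"
  then show "on_arr Quant_to_ResRel f \<in> Arr ResRel"
    using multiplicative_map_bond[of "adom f" "acod f" "adat f"] quantale_mapD(1)[of "adom f" "acod f" "adat f"]
    by (simp add: Quant_Arr ResRel_Arr Quant_to_ResRel_def residuated_quantale_context map_bond_bond)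
next
  fix f g :: "('u quantale, 'u \<Rightarrow> 'u) arrow"
  assume "f \<in> Arr Quant" "g \<in> Arr Quant" "Dom Quant g = Cod Quant f"
  then show "on_arr Quant_to_ResRel (g \<cdot>\<^bsub>Quant\<^esub> f) = on_arr Quant_to_ResRel g \<cdot>\<^bsub>ResRel\<^esub> on_arr Quant_to_ResRel f"
    using map_bond_compose[of "adom f" "acod f" "adat f" "acod g" "adat g"]
    by (simp add: Quant_Arr Quant_to_ResRel_def quantale_mapD(1))
qed (simp_all add: Quant_to_ResRel_def residuated_quantale_context map_bond_Idn)

section \<open>The quantale of extents of a residuated relation\<close>

lemma set_mul_assoc:
  assumes R: "residuated_relation R" and "A \<subseteq> objs R" "B \<subseteq> objs R" "C \<subseteq> objs R"
  shows "set_mul R (set_mul R A B) C = set_mul R A (set_mul R B C)"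
proof -
  have "set_mul R (set_mul R A B) C = (\<Union>x\<in>A. \<Union>y\<in>B. \<Union>z\<in>C. {smul R (smul R x y) z})"
    unfolding set_mul_def by blast
  also have "\<dots> = (\<Union>x\<in>A. \<Union>y\<in>B. \<Union>z\<in>C. {smul R x (smul R y z)})"
    by (intro SUP_cong refl) (simp add: residuated_relationD(4)[OF R] assms(2-4)[THEN subsetD])
  also have "\<dots> = set_mul R A (set_mul R B C)" unfolding set_mul_def by blast
  finally show ?thesis .
qed

locale encoded_extents = encoded_closure_system "objs R" "{A. extent R A}" e
  for R :: "'u sgcontext" and e :: "'u set \<Rightarrow> 'u" +
  assumes R: "residuated_relation R"
begin

text \<open>The quotient of the power-set quantale of the semigroup by the closure nucleus of
  \<open>R\<close>, carried along the encoding.\<close>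

definition extent_quantale :: "'u quantale" where
  "extent_quantale = \<lparr>carrier = carrier lat, eq = eq lat, le = le lat,
     qmul = \<lambda>x \<in> carrier lat. \<lambda>y \<in> carrier lat. e (down R (up R (set_mul R (dec x) (dec y))))\<rparr>"

lemma extent_quantale_simps [simp]:
  "carrier extent_quantale = carrier lat" "eq extent_quantale = eq lat" "le extent_quantale = le lat"
  by (simp_all add: extent_quantale_def)

lemma extent_quantale_sup: "\<Squnion>\<^bsub>extent_quantale\<^esub> A = \<Squnion>\<^bsub>lat\<^esub> A"
  by (rule lattice_sup_cong) simp_all

lemma extent_dec: "x \<in> carrier lat \<Longrightarrow> extent R (dec x)"
  using dec_closed[of x] by simp

lemma dec_objs: "x \<in> carrier lat \<Longrightarrow> dec x \<subseteq> objs R"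
  using extent_dec extentD(2) by blast

lemma extent_closure: "A \<subseteq> objs R \<Longrightarrow> extent R (down R (up R A))"
  by (rule extent_down[OF up_subset])

lemma mul_objs: "\<lbrakk>x \<in> carrier lat; y \<in> carrier lat\<rbrakk> \<Longrightarrow> set_mul R (dec x) (dec y) \<subseteq> objs R"
  by (rule set_mul_objs[OF R dec_objs dec_objs])

lemma qmul_closed:
  assumes "x \<in> carrier lat" "y \<in> carrier lat"
  shows "qmul extent_quantale x y \<in> carrier lat"
    and "dec (qmul extent_quantale x y) = down R (up R (set_mul R (dec x) (dec y)))"
  using assms extent_closure[OF mul_objs[OF assms]] e_carrier
  by (simp_all add: extent_quantale_def)

lemma qmul_le:
  assumes "x \<in> carrier lat" "y \<in> carrier lat" "u \<in> carrier lat"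
  shows "qmul extent_quantale x y \<sqsubseteq>\<^bsub>lat\<^esub> u \<longleftrightarrow> set_mul R (dec x) (dec y) \<subseteq> dec u"
  using le_lat_dec[OF qmul_closed(1)[OF assms(1,2)] assms(3)] qmul_closed(2)[OF assms(1,2)]
    down_up_subset_iff[OF extent_dec[OF assms(3)] mul_objs[OF assms(1,2)]] by simp

lemma set_mul_cl_left:
  assumes "A \<subseteq> objs R" "y \<in> carrier lat" "u \<in> carrier lat"
  shows "set_mul R (down R (up R A)) (dec y) \<subseteq> dec u \<longleftrightarrow> set_mul R A (dec y) \<subseteq> dec u"
  using set_mul_cl_subset_iff[OF R assms(1) dec_objs extent_dec, of y u] assms
    extentD(1)[OF extent_dec, of y] by simp

lemma set_mul_cl_right:
  assumes "A \<subseteq> objs R" "y \<in> carrier lat" "u \<in> carrier lat"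
  shows "set_mul R (dec y) (down R (up R A)) \<subseteq> dec u \<longleftrightarrow> set_mul R (dec y) A \<subseteq> dec u"
  using set_mul_cl_subset_iff[OF R dec_objs assms(1) extent_dec, of y u] assms
    extentD(1)[OF extent_dec, of y] by simp

text \<open>The closure of the abstract closure system is an intersection of extents; here it is
  identified with \<open>down\<close> after \<open>up\<close>, to which the product rules
  apply.\<close>

lemma dec_sup:
  assumes "A \<subseteq> carrier lat"
  shows "dec (\<Squnion>\<^bsub>lat\<^esub> A) = down R (up R (\<Union>(dec ` A)))"
proof -
  have U: "\<Union>(dec ` A) \<subseteq> objs R" using assms dec_objs by blast
  have "cl (\<Union>(dec ` A)) = down R (up R (\<Union>(dec ` A)))"
  proof (rule subset_antisym)
    show "cl (\<Union>(dec ` A)) \<subseteq> down R (up R (\<Union>(dec ` A)))"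
      using cl_subset_iff[OF U] extent_closure[OF U] subset_down_up[OF U] by simp
    have "extent R (cl (\<Union>(dec ` A)))" using cl_closed[of "\<Union>(dec ` A)"] by (simp only: mem_Collect_eq)
    then show "down R (up R (\<Union>(dec ` A))) \<subseteq> cl (\<Union>(dec ` A))"
      using down_up_subset_iff[OF _ U] subset_cl[OF U] by simp
  qed
  moreover have "dec (\<Squnion>\<^bsub>lat\<^esub> A) = cl (\<Union>(dec ` A))"
    unfolding sup_lat[OF assms] by (rule dec_e[OF cl_closed])
  ultimately show ?thesis by simp
qed

text \<open>Each law is tested against an arbitrary \<open>u\<close>. The closures drop out, and
  what remains is associativity of the elementwise product and its distributivity over
  unions.\<close>

lemma is_quantale_extents: "is_quantale extent_quantale"
  unfolding is_quantale_def
proof (intro conjI ballI allI impI)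
  show "small_complete_lattice extent_quantale"
    using small_complete_lattice_lat complete_lattice_cong[of extent_quantale lat]
    by (simp add: small_complete_lattice_def)
  show "qmul extent_quantale \<in> carrier extent_quantale \<rightarrow>\<^sub>E carrier extent_quantale \<rightarrow>\<^sub>E carrier extent_quantale"
    using qmul_closed(1) by (auto simp: PiE_def extensional_def extent_quantale_def)
next
  fix a b c assume "a \<in> carrier extent_quantale" "b \<in> carrier extent_quantale" "c \<in> carrier extent_quantale"
  then have abc: "a \<in> carrier lat" "b \<in> carrier lat" "c \<in> carrier lat" by simp_all
  note ab = qmul_closed[OF abc(1,2)] and bc = qmul_closed[OF abc(2,3)]
  have assoc: "set_mul R (set_mul R (dec a) (dec b)) (dec c) = set_mul R (dec a) (set_mul R (dec b) (dec c))"
    using abc by (intro set_mul_assoc[OF R] dec_objs)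
  show "qmul extent_quantale (qmul extent_quantale a b) c = qmul extent_quantale a (qmul extent_quantale b c)"
  proof (rule le_eqI[OF complete_lattice_lat])
    fix u assume u: "u \<in> carrier lat"
    show "qmul extent_quantale (qmul extent_quantale a b) c \<sqsubseteq>\<^bsub>lat\<^esub> u \<longleftrightarrow>
        qmul extent_quantale a (qmul extent_quantale b c) \<sqsubseteq>\<^bsub>lat\<^esub> u"
      unfolding qmul_le[OF ab(1) abc(3) u] qmul_le[OF abc(1) bc(1) u] ab(2) bc(2)
        set_mul_cl_left[OF mul_objs[OF abc(1,2)] abc(3) u]
        set_mul_cl_right[OF mul_objs[OF abc(2,3)] abc(1) u] assoc ..
  qed (use qmul_closed(1) ab bc abc in auto)
next
  fix A b assume "A \<subseteq> carrier extent_quantale" "b \<in> carrier extent_quantale"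
  then have A: "A \<subseteq> carrier lat" and b: "b \<in> carrier lat" by simp_all
  have s: "\<Squnion>\<^bsub>lat\<^esub> A \<in> carrier lat" by (rule sup_in_carrier[OF complete_lattice_lat A])
  have U: "\<Union>(dec ` A) \<subseteq> objs R" using A dec_objs by blast
  show "qmul extent_quantale (\<Squnion>\<^bsub>extent_quantale\<^esub> A) b
      = \<Squnion>\<^bsub>extent_quantale\<^esub> ((\<lambda>a. qmul extent_quantale a b) ` A)"
    unfolding extent_quantale_sup
  proof (rule sup_eqI[OF complete_lattice_lat, symmetric])
    fix u assume u: "u \<in> carrier lat"
    have "qmul extent_quantale (\<Squnion>\<^bsub>lat\<^esub> A) b \<sqsubseteq>\<^bsub>lat\<^esub> u \<longleftrightarrow> set_mul R (\<Union>(dec ` A)) (dec b) \<subseteq> dec u"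
      unfolding qmul_le[OF s b u] dec_sup[OF A] by (rule set_mul_cl_left[OF U b u])
    also have "\<dots> \<longleftrightarrow> (\<forall>a \<in> A. set_mul R (dec a) (dec b) \<subseteq> dec u)" unfolding set_mul_def by blast
    also have "\<dots> \<longleftrightarrow> (\<forall>a \<in> A. qmul extent_quantale a b \<sqsubseteq>\<^bsub>lat\<^esub> u)"
      using qmul_le[OF _ b u] A by blast
    finally show "qmul extent_quantale (\<Squnion>\<^bsub>lat\<^esub> A) b \<sqsubseteq>\<^bsub>lat\<^esub> u \<longleftrightarrow>
        (\<forall>a \<in> (\<lambda>a. qmul extent_quantale a b) ` A. a \<sqsubseteq>\<^bsub>lat\<^esub> u)" by simp
  qed (use A s b qmul_closed(1) in auto)
  show "qmul extent_quantale b (\<Squnion>\<^bsub>extent_quantale\<^esub> A)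
      = \<Squnion>\<^bsub>extent_quantale\<^esub> ((\<lambda>a. qmul extent_quantale b a) ` A)"
    unfolding extent_quantale_sup
  proof (rule sup_eqI[OF complete_lattice_lat, symmetric])
    fix u assume u: "u \<in> carrier lat"
    have "qmul extent_quantale b (\<Squnion>\<^bsub>lat\<^esub> A) \<sqsubseteq>\<^bsub>lat\<^esub> u \<longleftrightarrow> set_mul R (dec b) (\<Union>(dec ` A)) \<subseteq> dec u"
      unfolding qmul_le[OF b s u] dec_sup[OF A] by (rule set_mul_cl_right[OF U b u])
    also have "\<dots> \<longleftrightarrow> (\<forall>a \<in> A. set_mul R (dec b) (dec a) \<subseteq> dec u)" unfolding set_mul_def by blast
    also have "\<dots> \<longleftrightarrow> (\<forall>a \<in> A. qmul extent_quantale b a \<sqsubseteq>\<^bsub>lat\<^esub> u)"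
      using qmul_le[OF b _ u] A by blast
    finally show "qmul extent_quantale b (\<Squnion>\<^bsub>lat\<^esub> A) \<sqsubseteq>\<^bsub>lat\<^esub> u \<longleftrightarrow>
        (\<forall>a \<in> (\<lambda>a. qmul extent_quantale b a) ` A. a \<sqsubseteq>\<^bsub>lat\<^esub> u)" by simp
  qed (use A s b qmul_closed(1) in auto)
qed

section \<open>The isomorphism between a residuated relation and its quantale of extents\<close>

definition to_context :: "('u \<times> 'u) set" where
  "to_context = {(q, y). q \<in> carrier lat \<and> y \<in> up R (dec q)}"

text \<open>\<open>to_context\<close> and \<open>from_context\<close> are the incidences of
  attributes and objects of \<open>R\<close> with extents. They are inverse bonds because the
  extents of the order are principal, and thus correspond to the extents of \<open>R\<close>
  themselves.\<close>

definition from_context :: "('u \<times> 'u) set" where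
  "from_context = {(x, w). w \<in> carrier lat \<and> x \<in> dec w}"

abbreviation "K \<equiv> quantale_context extent_quantale"

lemma complete_extent_quantale: "complete_lattice extent_quantale"
  by (rule is_quantaleD(2)[OF is_quantale_extents])

lemma to_context_row: "q \<in> carrier lat \<Longrightarrow> to_context `` {q} = up R (dec q)"
  by (auto simp: to_context_def)

text \<open>The extent of the object concept of \<open>x\<close>, as an element of the lattice; it
  generates the row of \<open>from_context\<close> at \<open>x\<close>.\<close>

definition cl1 :: "'u \<Rightarrow> 'u" where
  "cl1 x = e (down R (up R {x}))"

lemma cl1_carrier [simp]: "x \<in> objs R \<Longrightarrow> cl1 x \<in> carrier lat"
  and dec_cl1: "x \<in> objs R \<Longrightarrow> dec (cl1 x) = down R (up R {x})"
  using extent_closure[of "{x}"] by (simp_all add: cl1_def)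

lemma cl1_le: "\<lbrakk>x \<in> objs R; w \<in> carrier lat\<rbrakk> \<Longrightarrow> cl1 x \<sqsubseteq>\<^bsub>lat\<^esub> w \<longleftrightarrow> x \<in> dec w"
  using le_lat_dec[of "cl1 x" w] dec_cl1[of x] down_up_subset_iff[OF extent_dec, of w "{x}"] by simp

lemma from_context_row: "x \<in> objs R \<Longrightarrow> from_context `` {x} = {w \<in> carrier lat. cl1 x \<sqsubseteq>\<^bsub>lat\<^esub> w}"
  using cl1_le by (auto simp: from_context_def)

lemma bond_to_context: "bond K R to_context"
  unfolding bond_def
proof (intro conjI ballI)
  show "to_context \<subseteq> objs K \<times> attrs R" by (auto simp: to_context_def up_def)
next
  fix q assume "q \<in> objs K"
  then show "intent R (to_context `` {q})" using dec_objs by (simp add: to_context_row intent_up)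
next
  fix y assume y: "y \<in> attrs R"
  \<comment> \<open>The attribute extent of \<open>y\<close> is the largest extent related to
    \<open>y\<close>, so its code generates the column.\<close>
  have D: "extent R (down R {y})" using y by (simp add: extent_down)
  then have eD: "e (down R {y}) \<in> carrier lat" "dec (e (down R {y})) = down R {y}" by simp_all
  have "y \<in> up R (dec q) \<longleftrightarrow> q \<sqsubseteq>\<^bsub>lat\<^esub> e (down R {y})" if "q \<in> carrier lat" for q
    using le_lat_dec[OF that eD(1)] eD(2) subset_down_iff[OF dec_objs[OF that], of "{y}"] y by simp
  then have "to_context\<inverse> `` {y} = {q \<in> carrier lat. q \<sqsubseteq>\<^bsub>lat\<^esub> e (down R {y})}"
    by (auto simp: to_context_def)
  then show "extent K (to_context\<inverse> `` {y})"
    using eD(1) by (auto simp: extent_quantale_context[OF complete_extent_quantale])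
qed

lemma bond_from_context: "bond R K from_context"
  unfolding bond_def
proof (intro conjI ballI)
  show "from_context \<subseteq> objs R \<times> attrs K" using dec_objs by (auto simp: from_context_def)
next
  fix x assume "x \<in> objs R"
  then show "intent K (from_context `` {x})"
    by (auto simp: from_context_row intent_quantale_context[OF complete_extent_quantale])
next
  fix w assume "w \<in> attrs K"
  then have "from_context\<inverse> `` {w} = dec w" "w \<in> carrier lat" by (auto simp: from_context_def)
  then show "extent R (from_context\<inverse> `` {w})" using extent_dec by simp
qed

lemma multiplicative_to_context: "multiplicative K R to_context"
  unfolding multiplicative_def
proof (intro ballI)
  fix q q' assume "q \<in> objs K" "q' \<in> objs K"
  then have q: "q \<in> carrier lat" "q' \<in> carrier lat" by simp_all
  show "to_context `` {smul K q q'} = intent_mul R (to_context `` {q}) (to_context `` {q'})"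
    using q qmul_closed[OF q] extentD(1)[OF extent_dec] mul_objs[OF q]
    by (simp add: to_context_row intent_mul_def)
qed

text \<open>The rows at \<open>x\<close> and \<open>x'\<close> are generated by \<open>cl1 x\<close>
  and \<open>cl1 x'\<close>. Tested against an extent, the product of these closures reduces to the
  single product \<open>smul R x x'\<close>.\<close>

lemma multiplicative_from_context: "multiplicative R K from_context"
  unfolding multiplicative_def
proof (intro ballI)
  fix x x' assume x: "x \<in> objs R" "x' \<in> objs R"
  note xx = residuated_relationD(3)[OF R x]
  have "from_context `` {smul R x x'} = {w \<in> carrier lat. qmul extent_quantale (cl1 x) (cl1 x') \<sqsubseteq>\<^bsub>lat\<^esub> w}"
  proof -
    have "qmul extent_quantale (cl1 x) (cl1 x') \<sqsubseteq>\<^bsub>lat\<^esub> w \<longleftrightarrow> cl1 (smul R x x') \<sqsubseteq>\<^bsub>lat\<^esub> w"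
      if w: "w \<in> carrier lat" for w
    proof -
      have "qmul extent_quantale (cl1 x) (cl1 x') \<sqsubseteq>\<^bsub>lat\<^esub> w \<longleftrightarrow> set_mul R {x} {x'} \<subseteq> dec w"
        using qmul_le[OF cl1_carrier[OF x(1)] cl1_carrier[OF x(2)] w]
          set_mul_cl_subset_iff[OF R _ _ extent_dec[OF w], of "{x}" "{x'}"] x by (simp add: dec_cl1)
      then show ?thesis using cl1_le[OF xx w] by (simp add: set_mul_def)
    qed
    then show ?thesis unfolding from_context_row[OF xx] by blast
  qed
  then show "from_context `` {smul R x x'} = intent_mul K (from_context `` {x}) (from_context `` {x'})"
    using intent_mul_quantale_context[OF is_quantale_extents, of "cl1 x" "cl1 x'"] x
    by (simp add: from_context_row)
qed

text \<open>The row of \<open>from_context\<close> at \<open>x\<close> is the \<open>up\<close> of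
  \<open>cl1 x\<close>, and a column of \<open>to_context\<close> is an extent. The inclusion
  therefore needs testing at \<open>cl1 x\<close> alone, where it says that \<open>y\<close> belongs
  to \<open>up R {x}\<close>.\<close>

lemma to_from_context: "bond_comp R K R to_context from_context = inc R"
proof -
  have "down K (from_context `` {x}) \<subseteq> to_context\<inverse> `` {y} \<longleftrightarrow> (x, y) \<in> inc R"
    if x: "x \<in> objs R" and y: "y \<in> attrs R" for x y
  proof -
    have c: "cl1 x \<in> carrier lat" using x by simp
    have row: "from_context `` {x} = up K {cl1 x}"
      unfolding from_context_row[OF x] using c by (auto simp: up_def)
    have "down K (from_context `` {x}) \<subseteq> to_context\<inverse> `` {y} \<longleftrightarrow> cl1 x \<in> to_context\<inverse> `` {y}"
      unfolding row using down_up_subset_iff[OF bondD(3)[OF bond_to_context y], of "{cl1 x}"] c by simp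
    also have "\<dots> \<longleftrightarrow> y \<in> up R (down R (up R {x}))" using c dec_cl1[OF x] by (simp add: to_context_def)
    also have "\<dots> \<longleftrightarrow> y \<in> up R {x}" using x by simp
    also have "\<dots> \<longleftrightarrow> (x, y) \<in> inc R" using y by (simp add: up_def)
    finally show ?thesis .
  qed
  moreover have "x \<in> objs R" "y \<in> attrs R" if "(x, y) \<in> inc R" for x y
    using residuated_relationD(1)[OF R] that by (auto simp: is_fcontext_def)
  ultimately have "(x, y) \<in> bond_comp R K R to_context from_context \<longleftrightarrow> (x, y) \<in> inc R" for x y
    unfolding bond_comp_iff by blast
  then show ?thesis by (simp add: set_eq_iff)
qed

lemma from_to_context: "bond_comp K R K from_context to_context = inc K"
proof -
  have "down R (to_context `` {q}) \<subseteq> from_context\<inverse> `` {w} \<longleftrightarrow> q \<sqsubseteq>\<^bsub>lat\<^esub> w"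
    if q: "q \<in> carrier lat" and w: "w \<in> carrier lat" for q w
  proof -
    have "down R (to_context `` {q}) = dec q" "from_context\<inverse> `` {w} = dec w"
      using q w extentD(1)[OF extent_dec[OF q]] by (auto simp: to_context_row from_context_def)
    then show ?thesis using le_lat_dec[OF q w] by simp
  qed
  then have "(q, w) \<in> bond_comp K R K from_context to_context \<longleftrightarrow> (q, w) \<in> inc K" for q w
    by (simp add: bond_comp_iff cong: conj_cong)
  then show ?thesis by (simp add: set_eq_iff)
qed

lemma is_iso_to_context:
  "\<lparr>adom = K, acod = R, adat = to_context\<rparr> \<in> Hom ResRel K R"
  "is_iso ResRel \<lparr>adom = K, acod = R, adat = to_context\<rparr>"
proof -
  note K = residuated_quantale_context[OF is_quantale_extents]
  interpret category ResRel by (rule category_ResRel)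
  have to: "\<lparr>adom = K, acod = R, adat = to_context\<rparr> \<in> Arr ResRel"
    using K R bond_to_context multiplicative_to_context by (simp add: ResRel_Arr)
  have "\<lparr>adom = R, acod = K, adat = from_context\<rparr> \<in> Arr ResRel"
    using K R bond_from_context multiplicative_from_context by (simp add: ResRel_Arr)
  with to have "inverse_arrows \<lparr>adom = K, acod = R, adat = to_context\<rparr> \<lparr>adom = R, acod = K, adat = from_context\<rparr>"
    unfolding inverse_arrows_def by (simp add: to_from_context from_to_context)
  then show "is_iso ResRel \<lparr>adom = K, acod = R, adat = to_context\<rparr>"
    unfolding is_iso_iff_inverse by blast
  show "\<lparr>adom = K, acod = R, adat = to_context\<rparr> \<in> Hom ResRel K R"
    using to by (simp add: Hom_def)
qed

end

context strong_limit
begin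

text \<open>The functor starts from \<open>Quant\<close>, where the context of a quantale is
  canonical. The quantale of extents depends on a choice of codes, which is then confined to the
  existence statement of essential surjectivity.\<close>

lemma Quant_ResRel: "(Quant :: ('u quantale, _) cat) \<simeq> (ResRel :: ('u sgcontext, _) cat)"
proof (rule weak_equivalence_imp_equivalent)
  let ?F = "Quant_to_ResRel :: ('u quantale, ('u quantale, 'u \<Rightarrow> 'u) arrow, 'u sgcontext, _) fctr"
  show "weak_equivalence Quant ResRel ?F"
    unfolding weak_equivalence_def
  proof (intro conjI ballI impI)
    show "cat_functor Quant ResRel ?F" by (rule Quant_to_ResRel_functor)
  next
    fix f g :: "('u quantale, 'u \<Rightarrow> 'u) arrow"
    assume fg: "f \<in> Arr Quant" "g \<in> Arr Quant" "Dom Quant f = Dom Quant g" "Cod Quant f = Cod Quant g"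
      and eq: "on_arr ?F f = on_arr ?F g"
    have "adat f = adat g"
    proof (rule map_bond_eqD)
      show "sup_map (adom f) (acod f) (adat f)" "sup_map (adom f) (acod f) (adat g)"
        using fg quantale_mapD(1) by (auto simp: Quant_Arr)
      show "map_bond (adom f) (acod f) (adat f) = map_bond (adom f) (acod f) (adat g)"
        using eq fg by (simp add: Quant_to_ResRel_def)
    qed
    with fg show "f = g" by (intro arrow_eqI) simp_all
  next
    fix Q P :: "'u quantale" and h
    assume "Q \<in> Obj Quant" "P \<in> Obj Quant" and h: "h \<in> Hom ResRel (on_obj ?F Q) (on_obj ?F P)"
    then have Q: "is_quantale Q" and P: "is_quantale P" by auto
    have h: "adom h = quantale_context Q" "acod h = quantale_context P"
        "bond (quantale_context Q) (quantale_context P) (adat h)"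
        "multiplicative (quantale_context Q) (quantale_context P) (adat h)"
      using h by (auto simp: Hom_def ResRel_Arr Quant_to_ResRel_def)
    obtain f where f: "sup_map Q P f" "adat h = map_bond Q P f"
      using bond_is_map_bond[OF is_quantaleD(2)[OF Q] is_quantaleD(2)[OF P] h(3)] by blast
    then have "quantale_map Q P f" using multiplicative_map_bond[OF Q P f(1)] h(4) by simp
    then have "\<lparr>adom = Q, acod = P, adat = f\<rparr> \<in> Hom Quant Q P"
      using Q P by (simp add: Hom_def Quant_Arr)
    moreover have "on_arr ?F \<lparr>adom = Q, acod = P, adat = f\<rparr> = h"
      by (rule arrow_eqI) (use h f in \<open>simp_all add: Quant_to_ResRel_def\<close>)
    ultimately show "\<exists>f \<in> Hom Quant Q P. on_arr ?F f = h" by blast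
  next
    fix R :: "'u sgcontext" assume "R \<in> Obj ResRel"
    then have R: "residuated_relation R" by simp
    then have "objs R \<prec> (UNIV :: 'u set)"
      by (auto dest: residuated_relationD(1) simp: is_fcontext_def small_def)
    moreover have "{A. extent R A} \<subseteq> Pow (objs R)" by (auto simp: extent_def)
    ultimately obtain e :: "'u set \<Rightarrow> 'u" where e: "inj_on e {A. extent R A}"
      and sm: "{A. extent R A} \<prec> (UNIV :: 'u set)" using encoding_exists by metis
    interpret encoded_extents R e
      by (intro encoded_extents.intro encoded_closure_system.intro encoded_closure_system_axioms.intro
          encoded_extents_axioms.intro closure_system_extents e sm R)
    show "\<exists>Q \<in> Obj Quant. \<exists>i \<in> Hom ResRel (on_obj ?F Q) R. is_iso ResRel i"
      using is_quantale_extents is_iso_to_context by (auto simp: Quant_to_ResRel_def)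
  qed
qed

end

section \<open>Transport along an isomorphism of categories\<close>

text \<open>\<open>D\<close> enters as bare data in bijection with a category. Its category laws are
  derived by reading every composite as the image of a composite in \<open>C\<close>; in this way
  \<open>BackDiag Rel\<close> is shown to be a category.\<close>

locale cat_isomorphism = C: category C
  for C :: "('o, 'm, 'y) cat_scheme" +
  fixes D :: "('p, 'n, 'z) cat_scheme"
    and F :: "('o, 'm, 'p, 'n) fctr" and G :: "('p, 'n, 'o, 'm) fctr"
  assumes F_obj [simp]: "A \<in> Obj C \<Longrightarrow> on_obj F A \<in> Obj D"
    and G_obj [simp]: "B \<in> Obj D \<Longrightarrow> on_obj G B \<in> Obj C"
    and GF_obj [simp]: "A \<in> Obj C \<Longrightarrow> on_obj G (on_obj F A) = A"
    and FG_obj [simp]: "B \<in> Obj D \<Longrightarrow> on_obj F (on_obj G B) = B"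
    and F_arr [simp]: "f \<in> Arr C \<Longrightarrow> on_arr F f \<in> Arr D"
      "f \<in> Arr C \<Longrightarrow> Dom D (on_arr F f) = on_obj F (Dom C f)"
      "f \<in> Arr C \<Longrightarrow> Cod D (on_arr F f) = on_obj F (Cod C f)"
    and G_arr [simp]: "h \<in> Arr D \<Longrightarrow> on_arr G h \<in> Arr C"
    and GF_arr [simp]: "f \<in> Arr C \<Longrightarrow> on_arr G (on_arr F f) = f"
    and FG_arr [simp]: "h \<in> Arr D \<Longrightarrow> on_arr F (on_arr G h) = h"
    and F_Idn: "A \<in> Obj C \<Longrightarrow> Idn D (on_obj F A) = on_arr F (Idn C A)"
    and F_Cmp: "\<lbrakk>f \<in> Arr C; g \<in> Arr C; Dom C g = Cod C f\<rbrakk>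
      \<Longrightarrow> on_arr F g \<cdot>\<^bsub>D\<^esub> on_arr F f = on_arr F (g \<cdot>\<^bsub>C\<^esub> f)"
begin

lemma D_arr [simp]:
  assumes "h \<in> Arr D"
  shows "Dom D h \<in> Obj D" "Cod D h \<in> Obj D"
    "Dom C (on_arr G h) = on_obj G (Dom D h)" "Cod C (on_arr G h) = on_obj G (Cod D h)"
  using F_arr(2,3)[OF G_arr[OF assms]] assms F_obj[of "Dom C (on_arr G h)"] F_obj[of "Cod C (on_arr G h)"]
    GF_obj[of "Dom C (on_arr G h)"] GF_obj[of "Cod C (on_arr G h)"] by simp_all

lemma D_Idn: "B \<in> Obj D \<Longrightarrow> Idn D B = on_arr F (Idn C (on_obj G B))"
  using F_Idn[of "on_obj G B"] by simp

lemma D_Cmp: "\<lbrakk>h \<in> Arr D; k \<in> Arr D; Dom D k = Cod D h\<rbrakk> \<Longrightarrow> k \<cdot>\<^bsub>D\<^esub> h = on_arr F (on_arr G k \<cdot>\<^bsub>C\<^esub> on_arr G h)"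
  using F_Cmp[of "on_arr G h" "on_arr G k"] by simp

lemma G_Cmp: "\<lbrakk>h \<in> Arr D; k \<in> Arr D; Dom D k = Cod D h\<rbrakk> \<Longrightarrow> on_arr G (k \<cdot>\<^bsub>D\<^esub> h) = on_arr G k \<cdot>\<^bsub>C\<^esub> on_arr G h"
  by (simp add: D_Cmp)

lemma category_D: "category D"
proof
  fix A assume "A \<in> Obj D"
  then show "Idn D A \<in> Hom D A A" by (simp add: D_Idn Hom_def)
next
  fix f A B g E assume "f \<in> Hom D A B" "g \<in> Hom D B E"
  then show "g \<cdot>\<^bsub>D\<^esub> f \<in> Hom D A E" by (auto simp: D_Cmp Hom_def)
next
  fix f A B assume f: "f \<in> Hom D A B"
  then have f: "f \<in> Arr D" "Dom D f = A" "Cod D f = B" "A \<in> Obj D" "B \<in> Obj D"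
    by (auto simp: Hom_def)
  have "Idn D A \<in> Arr D" "Idn D B \<in> Arr D" "Dom D (Idn D B) = B" "Cod D (Idn D A) = A"
    using f by (simp_all add: D_Idn)
  then show "Idn D B \<cdot>\<^bsub>D\<^esub> f = f" "f \<cdot>\<^bsub>D\<^esub> Idn D A = f"
    using f by (simp_all add: D_Cmp) (simp_all add: D_Idn)
next
  fix f A B g E h K assume "f \<in> Hom D A B" "g \<in> Hom D B E" "h \<in> Hom D E K"
  then have *: "f \<in> Arr D" "g \<in> Arr D" "h \<in> Arr D" "Dom D g = Cod D f" "Dom D h = Cod D g"
    by (auto simp: Hom_def)
  have gf: "g \<cdot>\<^bsub>D\<^esub> f \<in> Arr D" "Cod D (g \<cdot>\<^bsub>D\<^esub> f) = Cod D g" "Dom D (g \<cdot>\<^bsub>D\<^esub> f) = Dom D f"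
    and hg: "h \<cdot>\<^bsub>D\<^esub> g \<in> Arr D" "Cod D (h \<cdot>\<^bsub>D\<^esub> g) = Cod D h" "Dom D (h \<cdot>\<^bsub>D\<^esub> g) = Dom D g"
    using * by (simp_all add: D_Cmp)
  have "(h \<cdot>\<^bsub>D\<^esub> g) \<cdot>\<^bsub>D\<^esub> f = on_arr F (on_arr G (h \<cdot>\<^bsub>D\<^esub> g) \<cdot>\<^bsub>C\<^esub> on_arr G f)"
    by (rule D_Cmp) (use * hg in simp_all)
  also have "\<dots> = on_arr F (on_arr G h \<cdot>\<^bsub>C\<^esub> on_arr G (g \<cdot>\<^bsub>D\<^esub> f))"
    using * by (simp add: G_Cmp)
  also have "\<dots> = h \<cdot>\<^bsub>D\<^esub> g \<cdot>\<^bsub>D\<^esub> f"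
    by (rule D_Cmp[symmetric]) (use * gf in simp_all)
  finally show "(h \<cdot>\<^bsub>D\<^esub> g) \<cdot>\<^bsub>D\<^esub> f = h \<cdot>\<^bsub>D\<^esub> g \<cdot>\<^bsub>D\<^esub> f" .
qed (auto simp: Hom_def)

lemma cat_functor_F: "cat_functor C D F"
  by (rule cat_functorI) (use C.category_axioms category_D in \<open>simp_all add: F_Idn F_Cmp\<close>)

lemma cat_functor_G: "cat_functor D C G"
  by (rule cat_functorI) (use C.category_axioms category_D in \<open>simp_all add: D_Idn D_Cmp\<close>)

lemma weak_equivalence_F: "weak_equivalence C D F"
  unfolding weak_equivalence_def
proof (intro conjI ballI impI cat_functor_F)
  fix f g assume "f \<in> Arr C" "g \<in> Arr C" "on_arr F f = on_arr F g"
  then show "f = g" by (metis GF_arr)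
next
  fix A B h assume "A \<in> Obj C" "B \<in> Obj C" "h \<in> Hom D (on_obj F A) (on_obj F B)"
  then show "\<exists>f \<in> Hom C A B. on_arr F f = h"
    by (intro bexI[of _ "on_arr G h"]) (auto simp: Hom_def)
next
  interpret D: category D by (rule category_D)
  fix B assume B: "B \<in> Obj D"
  have "is_iso D (Idn D B)" using D.inverse_arrows_Idn[OF B] unfolding D.is_iso_iff_inverse by blast
  with B show "\<exists>A \<in> Obj C. \<exists>e \<in> Hom D (on_obj F A) B. is_iso D e"
    by (intro bexI[of _ "on_obj G B"] bexI[of _ "Idn D B"]) (simp_all add: D.Idn_in)
qed

text \<open>For the transported tensor \<open>F\<close> is strict, so identities serve as its
  coherence isomorphisms, and the laws in \<open>D\<close> are \<open>F\<close>-images of those in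
  \<open>C\<close>.\<close>

lemma SGrp_transport:
  assumes "semigroupal_category C T"
  shows "SGrp C T \<simeq> SGrp D (transport_tensor F G T)"
proof -
  let ?T = "transport_tensor F G T"
  interpret T: semigroupal_category C T by (rule assms)
  interpret F: cat_functor C D F by (rule cat_functor_F)
  interpret G: cat_functor D C G by (rule cat_functor_G)
  have T_simps [simp]: "A \<boxtimes>\<^bsub>?T\<^esub> B = on_obj F (on_obj G A \<boxtimes>\<^bsub>T\<^esub> on_obj G B)"
    "h \<otimes>\<^bsub>?T\<^esub> k = on_arr F (on_arr G h \<otimes>\<^bsub>T\<^esub> on_arr G k)"
    "assoc ?T A B E = on_arr F (assoc T (on_obj G A) (on_obj G B) (on_obj G E))" for A B E h k
    by (simp_all add: transport_tensor_def)
  interpret D: semigroupal_category D ?T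
  proof (unfold_locales)
    fix f f' g g' assume "f \<in> Arr D" "f' \<in> Arr D" "g \<in> Arr D" "g' \<in> Arr D"
      "Dom D f' = Cod D f" "Dom D g' = Cod D g"
    then show "(f' \<cdot>\<^bsub>D\<^esub> f) \<otimes>\<^bsub>?T\<^esub> (g' \<cdot>\<^bsub>D\<^esub> g) = (f' \<otimes>\<^bsub>?T\<^esub> g') \<cdot>\<^bsub>D\<^esub> (f \<otimes>\<^bsub>?T\<^esub> g)"
      by (simp add: T.tarr_Cmp')
  next
    fix f g h assume fgh: "f \<in> Arr D" "g \<in> Arr D" "h \<in> Arr D"
    let ?f = "on_arr G f" and ?g = "on_arr G g" and ?h = "on_arr G h"
    have "on_arr F (assoc T (Cod C ?f) (Cod C ?g) (Cod C ?h) \<cdot>\<^bsub>C\<^esub> ((?f \<otimes>\<^bsub>T\<^esub> ?g) \<otimes>\<^bsub>T\<^esub> ?h))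
        = on_arr F ((?f \<otimes>\<^bsub>T\<^esub> (?g \<otimes>\<^bsub>T\<^esub> ?h)) \<cdot>\<^bsub>C\<^esub> assoc T (Dom C ?f) (Dom C ?g) (Dom C ?h))"
      using T.assoc_nat[of ?f ?g ?h] fgh by simp
    then show "assoc ?T (Cod D f) (Cod D g) (Cod D h) \<cdot>\<^bsub>D\<^esub> ((f \<otimes>\<^bsub>?T\<^esub> g) \<otimes>\<^bsub>?T\<^esub> h)
        = (f \<otimes>\<^bsub>?T\<^esub> (g \<otimes>\<^bsub>?T\<^esub> h)) \<cdot>\<^bsub>D\<^esub> assoc ?T (Dom D f) (Dom D g) (Dom D h)"
      using fgh by simp
  qed simp_all
  define \<phi> where "\<phi> A B = Idn D (on_obj F (A \<boxtimes>\<^bsub>T\<^esub> B))" for A B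
  interpret strong_semigroupal_functor C T D ?T F \<phi>
  proof (unfold_locales)
    fix A B assume "A \<in> Obj C" "B \<in> Obj C"
    then have "F.D.inverse_arrows (\<phi> A B) (\<phi> A B)"
      unfolding \<phi>_def by (intro F.D.inverse_arrows_Idn) simp
    then show "is_iso D (\<phi> A B)" unfolding F.D.is_iso_iff_inverse by blast
  qed (simp_all add: \<phi>_def)
  show ?thesis
    by (rule weak_equivalence_imp_equivalent[OF SGrp_fctr_weak_equivalence[OF weak_equivalence_F]])
qed

end

section \<open>Bonds and back diagonals\<close>

lemma Rel_Arr: "f \<in> Arr Rel \<longleftrightarrow> small (adom f) \<and> small (acod f) \<and> adat f \<subseteq> adom f \<times> acod f"
  by (cases f) (auto simp: Rel_def)

lemma Rel_simps [simp]:
  "Dom Rel = adom" "Cod Rel = acod"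
  "Cmp Rel g f = \<lparr>adom = adom f, acod = acod g, adat = adat f O adat g\<rparr>"
  "aleq Rel f g \<longleftrightarrow> adom f = adom g \<and> acod f = acod g \<and> adat f \<subseteq> adat g"
  by (simp_all add: Rel_def)

lemma Rel_Hom: "f \<in> Hom Rel X Y \<longleftrightarrow> small X \<and> small Y \<and> adom f = X \<and> acod f = Y \<and> adat f \<subseteq> X \<times> Y"
  by (auto simp: Hom_def Rel_Arr)

text \<open>For relations, \<open>l\<close> followed by \<open>b\<close> lies inside
  \<open>s\<close> exactly when every pair of \<open>l\<close> satisfies the displayed condition.
  The displayed relation is therefore the greatest solution, and greatest solutions are
  unique.\<close>

lemma rlift_Rel:
  assumes s: "s \<in> Arr Rel" and b: "b \<in> Arr Rel" and eq: "acod s = acod b"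
  shows "rlift Rel s b = \<lparr>adom = adom s, acod = adom b,
    adat = {(z, x). z \<in> adom s \<and> x \<in> adom b \<and> (\<forall>w. (x, w) \<in> adat b \<longrightarrow> (z, w) \<in> adat s)}\<rparr>"
    (is "_ = ?l")
  unfolding rlift_def
proof (rule the_equality)
  have "aleq Rel l ?l" if "l \<in> Hom Rel (adom s) (adom b)" "aleq Rel (b \<cdot>\<^bsub>Rel\<^esub> l) s" for l
    using that by (auto simp: Rel_Hom)
  then show "?l \<in> Hom Rel (Dom Rel s) (Dom Rel b) \<and> aleq Rel (b \<cdot>\<^bsub>Rel\<^esub> ?l) s \<and>
      (\<forall>l' \<in> Hom Rel (Dom Rel s) (Dom Rel b). aleq Rel (b \<cdot>\<^bsub>Rel\<^esub> l') s \<longrightarrow> aleq Rel l' ?l)"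
    using s b eq by (auto simp: Rel_Hom Rel_Arr)
next
  fix l
  assume l: "l \<in> Hom Rel (Dom Rel s) (Dom Rel b) \<and> aleq Rel (b \<cdot>\<^bsub>Rel\<^esub> l) s \<and>
      (\<forall>l' \<in> Hom Rel (Dom Rel s) (Dom Rel b). aleq Rel (b \<cdot>\<^bsub>Rel\<^esub> l') s \<longrightarrow> aleq Rel l' l)"
  have "?l \<in> Hom Rel (Dom Rel s) (Dom Rel b)" "aleq Rel (b \<cdot>\<^bsub>Rel\<^esub> ?l) s"
    using s b eq by (auto simp: Rel_Hom Rel_Arr)
  then have "aleq Rel ?l l" using l by blast
  then show "l = ?l" using l by (intro arrow_eqI) (auto simp: Rel_Hom)
qed

lemma rext_Rel:
  assumes s: "s \<in> Arr Rel" and l: "l \<in> Arr Rel" and eq: "adom s = adom l"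
  shows "rext Rel s l = \<lparr>adom = acod l, acod = acod s,
    adat = {(x, w). x \<in> acod l \<and> w \<in> acod s \<and> (\<forall>z. (z, x) \<in> adat l \<longrightarrow> (z, w) \<in> adat s)}\<rparr>"
    (is "_ = ?e")
  unfolding rext_def
proof (rule the_equality)
  have "aleq Rel e ?e" if "e \<in> Hom Rel (acod l) (acod s)" "aleq Rel (e \<cdot>\<^bsub>Rel\<^esub> l) s" for e
    using that by (auto simp: Rel_Hom)
  then show "?e \<in> Hom Rel (Cod Rel l) (Cod Rel s) \<and> aleq Rel (?e \<cdot>\<^bsub>Rel\<^esub> l) s \<and>
      (\<forall>e' \<in> Hom Rel (Cod Rel l) (Cod Rel s). aleq Rel (e' \<cdot>\<^bsub>Rel\<^esub> l) s \<longrightarrow> aleq Rel e' ?e)"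
    using s l eq by (auto simp: Rel_Hom Rel_Arr)
next
  fix e
  assume e: "e \<in> Hom Rel (Cod Rel l) (Cod Rel s) \<and> aleq Rel (e \<cdot>\<^bsub>Rel\<^esub> l) s \<and>
      (\<forall>e' \<in> Hom Rel (Cod Rel l) (Cod Rel s). aleq Rel (e' \<cdot>\<^bsub>Rel\<^esub> l) s \<longrightarrow> aleq Rel e' e)"
  have "?e \<in> Hom Rel (Cod Rel l) (Cod Rel s)" "aleq Rel (?e \<cdot>\<^bsub>Rel\<^esub> l) s"
    using s l eq by (auto simp: Rel_Hom Rel_Arr)
  then have "aleq Rel ?e e" using e by blast
  then show "e = ?e" using e by (intro arrow_eqI) (auto simp: Rel_Hom)
qed

lemma ctx_to_rel_simps [simp]:
  "adom (ctx_to_rel R) = objs R" "acod (ctx_to_rel R) = attrs R" "adat (ctx_to_rel R) = inc R"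
  by (simp_all add: ctx_to_rel_def)

lemma rel_to_ctx_simps [simp]:
  "objs (rel_to_ctx r) = adom r" "attrs (rel_to_ctx r) = acod r" "inc (rel_to_ctx r) = adat r"
  by (simp_all add: rel_to_ctx_def)

lemma ctx_rel_inverse [simp]: "rel_to_ctx (ctx_to_rel R) = R" "ctx_to_rel (rel_to_ctx r) = r"
  by (simp_all add: rel_to_ctx_def ctx_to_rel_def)

lemma ctx_to_rel_Arr: "ctx_to_rel R \<in> Arr Rel \<longleftrightarrow> is_fcontext R"
  by (simp add: Rel_Arr is_fcontext_def)

lemma rel_to_ctx_fcontext: "is_fcontext (rel_to_ctx r) \<longleftrightarrow> r \<in> Arr Rel"
  by (simp add: Rel_Arr is_fcontext_def)

definition bond_arrow :: "'u fcontext \<Rightarrow> 'u fcontext \<Rightarrow> ('u \<times> 'u) set \<Rightarrow> 'u rel_arrow" where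
  "bond_arrow R S b = \<lparr>adom = objs R, acod = attrs S, adat = b\<rparr>"

lemma bond_arrow_simps [simp]:
  "adom (bond_arrow R S b) = objs R" "acod (bond_arrow R S b) = attrs S" "adat (bond_arrow R S b) = b"
  by (simp_all add: bond_arrow_def)

text \<open>Lifting \<open>b\<close> through \<open>S\<close> replaces each row by its
  \<open>down\<close>, and extending again applies \<open>up\<close>. So one fixed-point equation
  says that rows are intents; the other, with the operations in reverse order and \<open>R\<close>
  in place of \<open>S\<close>, says that columns are extents.\<close>

lemma back_diagonal_Rel:
  assumes R: "is_fcontext R" and S: "is_fcontext S"
  shows "back_diagonal Rel (ctx_to_rel R) (ctx_to_rel S) \<beta> \<longleftrightarrow> (\<exists>b. bond R S b \<and> \<beta> = bond_arrow R S b)"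
proof -
  have Rr: "ctx_to_rel R \<in> Arr Rel" and Sr: "ctx_to_rel S \<in> Arr Rel"
    using R S by (simp_all add: ctx_to_rel_Arr)
  have main: "rext Rel (ctx_to_rel S) (rlift Rel (ctx_to_rel S) (bond_arrow R S b)) = bond_arrow R S b
        \<longleftrightarrow> (\<forall>x \<in> objs R. intent S (b `` {x}))"
    "rlift Rel (ctx_to_rel R) (rext Rel (ctx_to_rel R) (bond_arrow R S b)) = bond_arrow R S b
        \<longleftrightarrow> (\<forall>w \<in> attrs S. extent R (b\<inverse> `` {w}))"
    if b: "b \<subseteq> objs R \<times> attrs S" for b
  proof -
    have \<beta>: "bond_arrow R S b \<in> Arr Rel"
      using R S b by (simp add: Rel_Arr is_fcontext_def)
    let ?l = "rlift Rel (ctx_to_rel S) (bond_arrow R S b)"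
    have l: "?l = \<lparr>adom = objs S, acod = objs R, adat = {(z, x). x \<in> objs R \<and> z \<in> down S (b `` {x})}\<rparr>"
      unfolding rlift_Rel[OF Sr \<beta>, simplified] by (auto simp: down_def)
    have lA: "?l \<in> Arr Rel"
      unfolding l using R S by (auto simp: Rel_Arr is_fcontext_def down_def)
    have "rext Rel (ctx_to_rel S) ?l = \<lparr>adom = objs R, acod = attrs S,
        adat = {(x, w). x \<in> objs R \<and> w \<in> up S (down S (b `` {x}))}\<rparr>"
      by (subst rext_Rel[OF Sr lA]) (auto simp: l up_def)
    also have "\<dots> = bond_arrow R S b \<longleftrightarrow> (\<forall>x \<in> objs R. up S (down S (b `` {x})) = b `` {x})"
      using b by (auto simp: bond_arrow_def set_eq_iff)
    also have "\<dots> \<longleftrightarrow> (\<forall>x \<in> objs R. intent S (b `` {x}))"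
      using b by (auto simp: intent_def)
    finally show "rext Rel (ctx_to_rel S) ?l = bond_arrow R S b \<longleftrightarrow> (\<forall>x \<in> objs R. intent S (b `` {x}))" .
    let ?e = "rext Rel (ctx_to_rel R) (bond_arrow R S b)"
    have e: "?e = \<lparr>adom = attrs S, acod = attrs R, adat = {(w, y). w \<in> attrs S \<and> y \<in> up R (b\<inverse> `` {w})}\<rparr>"
      unfolding rext_Rel[OF Rr \<beta>, simplified] by (auto simp: up_def)
    have eA: "?e \<in> Arr Rel"
      unfolding e using R S by (auto simp: Rel_Arr is_fcontext_def up_def)
    have "rlift Rel (ctx_to_rel R) ?e = \<lparr>adom = objs R, acod = attrs S,
        adat = {(x, w). w \<in> attrs S \<and> x \<in> down R (up R (b\<inverse> `` {w}))}\<rparr>"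
      by (subst rlift_Rel[OF Rr eA]) (auto simp: e down_def)
    also have "\<dots> = bond_arrow R S b \<longleftrightarrow> (\<forall>w \<in> attrs S. down R (up R (b\<inverse> `` {w})) = b\<inverse> `` {w})"
      using b by (auto simp: bond_arrow_def set_eq_iff)
    also have "\<dots> \<longleftrightarrow> (\<forall>w \<in> attrs S. extent R (b\<inverse> `` {w}))"
      using b by (auto simp: extent_def)
    finally show "rlift Rel (ctx_to_rel R) ?e = bond_arrow R S b \<longleftrightarrow> (\<forall>w \<in> attrs S. extent R (b\<inverse> `` {w}))" .
  qed
  have "\<beta> = bond_arrow R S (adat \<beta>) \<and> adat \<beta> \<subseteq> objs R \<times> attrs S" if "\<beta> \<in> Hom Rel (objs R) (attrs S)"
    using that by (auto simp: Rel_Hom bond_arrow_def intro!: arrow_eqI)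
  moreover have "bond_arrow R S b \<in> Hom Rel (objs R) (attrs S) \<longleftrightarrow> b \<subseteq> objs R \<times> attrs S" for b
    using R S by (auto simp: Rel_Hom is_fcontext_def)
  ultimately show ?thesis
    unfolding back_diagonal_def bond_def using main by (metis Rel_simps(1,2) ctx_to_rel_simps(1,2))
qed

lemma Bond_Obj [simp]: "R \<in> Obj Bond \<longleftrightarrow> is_fcontext R"
  by (simp add: Bond_def)

lemma Bond_Arr: "f \<in> Arr Bond \<longleftrightarrow> is_fcontext (adom f) \<and> is_fcontext (acod f) \<and>
    bond (adom f) (acod f) (adat f)"
  by (cases f) (auto simp: Bond_def)

lemma Bond_simps [simp]:
  "Dom Bond = adom" "Cod Bond = acod"
  "Idn Bond R = \<lparr>adom = R, acod = R, adat = inc R\<rparr>"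
  "Cmp Bond g f = \<lparr>adom = adom f, acod = acod g,
     adat = bond_comp (adom f) (acod f) (acod g) (adat g) (adat f)\<rparr>"
  by (simp_all add: Bond_def)

lemma BackDiag_Obj [simp]: "r \<in> Obj (BackDiag Q) \<longleftrightarrow> r \<in> Arr Q"
  by (simp add: BackDiag_def)

lemma BackDiag_Arr: "f \<in> Arr (BackDiag Q) \<longleftrightarrow> adom f \<in> Arr Q \<and> acod f \<in> Arr Q \<and>
    back_diagonal Q (adom f) (acod f) (adat f)"
  by (cases f) (auto simp: BackDiag_def)

lemma BackDiag_simps [simp]:
  "Dom (BackDiag Q) = adom" "Cod (BackDiag Q) = acod"
  "Idn (BackDiag Q) u = \<lparr>adom = u, acod = u, adat = u\<rparr>"
  "Cmp (BackDiag Q) g f = \<lparr>adom = adom f, acod = acod g, adat = rext Q (adat g) (rlift Q (acod f) (adat f))\<rparr>"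
  by (simp_all add: BackDiag_def)

lemma Bond_to_BRel_simps [simp]:
  "on_obj Bond_to_BRel R = ctx_to_rel R"
  "on_arr Bond_to_BRel f = \<lparr>adom = ctx_to_rel (adom f), acod = ctx_to_rel (acod f),
     adat = bond_arrow (adom f) (acod f) (adat f)\<rparr>"
  by (simp_all add: Bond_to_BRel_def bond_arrow_def)

lemma BRel_to_Bond_simps [simp]:
  "on_obj BRel_to_Bond r = rel_to_ctx r"
  "on_arr BRel_to_Bond f = \<lparr>adom = rel_to_ctx (adom f), acod = rel_to_ctx (acod f), adat = adat (adat f)\<rparr>"
  by (simp_all add: BRel_to_Bond_def)

text \<open>A back diagonal is itself an arrow of \<open>Rel\<close> with its own domain and
  codomain. The second conjunct forces these to be the ones prescribed by the two contexts, so that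
  the relation alone carries the information.\<close>

lemma BackDiag_Rel_Arr: "f \<in> Arr (BackDiag Rel) \<longleftrightarrow>
    on_arr BRel_to_Bond f \<in> Arr Bond \<and> on_arr Bond_to_BRel (on_arr BRel_to_Bond f) = f"
proof -
  have eq: "on_arr Bond_to_BRel (on_arr BRel_to_Bond f) = f \<longleftrightarrow>
      adat f = bond_arrow (rel_to_ctx (adom f)) (rel_to_ctx (acod f)) (adat (adat f))"
    by (cases f) auto
  show ?thesis
    using back_diagonal_Rel[of "rel_to_ctx (adom f)" "rel_to_ctx (acod f)" "adat f"]
    unfolding eq BackDiag_Arr Bond_Arr by (auto simp: rel_to_ctx_fcontext)
qed

lemma rext_rlift_bond_comp:
  assumes R: "is_fcontext R" and S: "is_fcontext S" and T: "is_fcontext T"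
    and b: "b \<subseteq> objs R \<times> attrs S" and c: "c \<subseteq> objs S \<times> attrs T"
  shows "rext Rel (bond_arrow S T c) (rlift Rel (ctx_to_rel S) (bond_arrow R S b))
    = bond_arrow R T (bond_comp R S T c b)"
proof -
  have \<beta>: "bond_arrow R S b \<in> Arr Rel" and \<gamma>: "bond_arrow S T c \<in> Arr Rel" and Sr: "ctx_to_rel S \<in> Arr Rel"
    using R S T b c by (simp_all add: Rel_Arr is_fcontext_def)
  let ?l = "rlift Rel (ctx_to_rel S) (bond_arrow R S b)"
  have l: "?l = \<lparr>adom = objs S, acod = objs R, adat = {(z, x). x \<in> objs R \<and> z \<in> down S (b `` {x})}\<rparr>"
    unfolding rlift_Rel[OF Sr \<beta>, simplified] by (auto simp: down_def)
  have lA: "?l \<in> Arr Rel"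
    unfolding l using R S by (auto simp: Rel_Arr is_fcontext_def down_def)
  show ?thesis
    unfolding rext_Rel[OF \<gamma> lA, unfolded l, simplified] l
    by (rule arrow_eqI) (auto simp: bond_comp_def)
qed

text \<open>The category laws of \<open>Bond\<close> are a premise here; the monoidal structure of
  the theorem supplies them.\<close>

lemma cat_isomorphism_Bond_BRel:
  assumes "category (Bond :: ('u fcontext, _) cat)"
  shows "cat_isomorphism (Bond :: ('u fcontext, _) cat) (BackDiag Rel) Bond_to_BRel BRel_to_Bond"
proof -
  interpret category "Bond :: ('u fcontext, _) cat" by (rule assms)
  have GF: "on_arr BRel_to_Bond (on_arr Bond_to_BRel f) = f" for f :: "('u fcontext, ('u \<times> 'u) set) arrow"
    by (cases f) simp
  show ?thesis
  proof
    fix f :: "('u fcontext, ('u \<times> 'u) set) arrow" assume "f \<in> Arr Bond"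
    then show "on_arr Bond_to_BRel f \<in> Arr (BackDiag Rel)"
      unfolding BackDiag_Rel_Arr GF by simp
  next
    fix f g :: "('u fcontext, ('u \<times> 'u) set) arrow"
    assume "f \<in> Arr Bond" "g \<in> Arr Bond" "Dom Bond g = Cod Bond f"
    then show "on_arr Bond_to_BRel g \<cdot>\<^bsub>BackDiag Rel\<^esub> on_arr Bond_to_BRel f = on_arr Bond_to_BRel (g \<cdot>\<^bsub>Bond\<^esub> f)"
      using rext_rlift_bond_comp[of "adom f" "acod f" "acod g" "adat f" "adat g"]
        bondD(1)[of "adom f" "acod f" "adat f"] bondD(1)[of "acod f" "acod g" "adat g"]
      by (simp add: Bond_Arr)
  next
    fix R :: "'u fcontext"
    show "Idn (BackDiag Rel) (on_obj Bond_to_BRel R) = on_arr Bond_to_BRel (Idn Bond R)"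
      by (simp add: ctx_to_rel_def bond_arrow_def)
  qed (use GF BackDiag_Rel_Arr in \<open>auto simp: ctx_to_rel_Arr rel_to_ctx_fcontext simp del: BRel_to_Bond_simps(2)\<close>)
qed

theorem proposition7p1:
  fixes T :: "('u fcontext, ('u fcontext, ('u \<times> 'u) set) arrow) tensor"
  assumes "\<And>A :: 'u set. small A \<Longrightarrow> Pow A \<prec> (UNIV :: 'u set)"
    and "monoidal_category Bond T"
    and "\<exists>F \<phi> \<phi>0. strong_monoidal_equivalence Bond T
           (SupCat :: ('u gorder, ('u gorder, 'u \<Rightarrow> 'u) arrow) cat) sup_tensor F \<phi> \<phi>0"
  shows "(ResRel :: ('u sgcontext, _) cat) \<simeq> (Quant :: ('u quantale, _) cat)
       \<and> (Quant :: ('u quantale, _) cat) \<simeq> SGrp Bond T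
       \<and> SGrp Bond T \<simeq> SGrp (BackDiag Rel) (transport_tensor Bond_to_BRel BRel_to_Bond T)"
proof (intro conjI)
  interpret strong_limit "TYPE('u)" by unfold_locales (rule assms(1))
  interpret M: monoidal_category Bond T by (rule assms(2))
  show "(ResRel :: ('u sgcontext, _) cat) \<simeq> (Quant :: ('u quantale, _) cat)"
    by (rule equivalent_categories_sym[OF Quant_ResRel])
  \<comment> \<open>The assumed equivalence moves semigroup objects from \<open>Bond\<close> to
    \<open>SupCat\<close>, where they are quantales. The middle equivalence is the composite through
    \<open>SGrp SupCat sup_tensor\<close>.\<close>
  have "SGrp Bond T \<simeq> SGrp (SupCat :: ('u gorder, _) cat) sup_tensor"
    using assms(3) strong_monoidal_equivalence_SGrp[OF assms(2) semigroupal_SupCat] by blast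
  then show "(Quant :: ('u quantale, _) cat) \<simeq> SGrp Bond T"
    by (rule equivalent_categories_trans[OF Quant_SGrp_SupCat equivalent_categories_sym])
  show "SGrp Bond T \<simeq> SGrp (BackDiag Rel) (transport_tensor Bond_to_BRel BRel_to_Bond T)"
    by (rule cat_isomorphism.SGrp_transport[OF cat_isomorphism_Bond_BRel[OF M.category_axioms] M.semigroupal])
qed

end
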